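(* Let $\Lambda=(\lambda_n)_{n\in\mathbb N}$ be a lacunary sequence, let $\mu$ be a positive finite measure on $[0,1)$ and let $q>0$. (i) If $(D_n(2))_n\in\ell^q$, then $\|i_\mu^2\|_{\mathcal S^q}\lesssim\|(D_n(2))_n\|_{\ell^q}$. (ii) If moreover $\Lambda$ is quasi-geometric and $q\ge2$, then $\|i_\mu^2\|_{\mathcal S^q}\approx\|(D_n(2))_n\|_{\ell^q}$. The underlying constants depend only on $q$ and $\Lambda$.
   Context: $A\lesssim B$ means $A\le cB$ for a constant $c>0$; $A\approx B$ means $A\lesssim B$ and $B\lesssim A$. A sequence $(\lambda_n)_n$ of positive numbers is lacunary if there exists $r>1$ with $\lambda_{n+1}\ge r\lambda_n$ for every $n$, and quasi-geometric if there are constants $r,R$ with $1<r\le\frac{\lambda_{n+1}}{\lambda_n}\le R<+\infty$ for every $n$. $M_\Lambda^2$ is the closed linear span of the monomials $t^{\lambda_n}$ in $L^2([0,1],m)$, $m$ the Lebesgue measure; its elements have well-defined values $f(x)=\sum_na_nx^{\lambda_n}$ on $[0,1)$ (Clarkson–Erdős). $i_\mu^2:M_\Lambda^2\to L^2(\mu)$ is the embedding $f\mapsto f$. Further, $$D_n(2)=\Big(\int_{[0,1)}\lambda_n^{\frac12}t^{\lambda_n}\sum_{k\in\mathbb N}\lambda_k^{\frac12}t^{\lambda_k}\,d\mu\Big)^{\frac12}.$$ For a bounded operator $S$ between Hilbert spaces, $a_n(S)=\inf\{\|S-R\|:\operatorname{rank}(R)<n\}$ ($n\ge1$) and $\|S\|_{\mathcal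 S^q}=(\sum_na_n(S)^q)^{1/q}$. For $q>0$, $\|u\|_{\ell^q}=(\sum_n|u_n|^q)^{1/q}$. *)

theory Defs
  imports "HOL-Analysis.Analysis" "HOL-Library.Extended_Nat"
begin

text \<open>
  Scalars are complex. An element of \<open>L\<^sup>2(M)\<close> is represented by a square integrable function, two
  representatives being identified when they agree almost everywhere. Accordingly, operators act
  on representatives, and linearity and rank are understood up to almost everywhere equality.
\<close>

text \<open>Real powers in \<open>[0,\<infinity>]\<close>, meant for \<open>p > 0\<close>.\<close>

definition epowr :: "ennreal \<Rightarrow> real \<Rightarrow> ennreal" where
  "epowr x p = (if x = top then top else ennreal (enn2real x powr p))"

definition lq_norm :: "real \<Rightarrow> (nat \<Rightarrow> ennreal) \<Rightarrow> ennreal" where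
  "lq_norm q u = epowr (\<Sum>n. epowr (u n) q) (1 / q)"

definition L2_norm :: "'a measure \<Rightarrow> ('a \<Rightarrow> complex) \<Rightarrow> ennreal" where
  "L2_norm M f = epowr (\<integral>\<^sup>+ x. ennreal ((cmod (f x))\<^sup>2) \<partial>M) (1 / 2)"

definition L2_space :: "'a measure \<Rightarrow> ('a \<Rightarrow> complex) set" where
  "L2_space M = {f \<in> borel_measurable M. L2_norm M f < top}"

text \<open>
  Below, \<open>X\<close> is a linear subspace of \<open>L\<^sup>2(M)\<close> and \<open>T\<close> maps \<open>X\<close> to functions on the space of \<open>N\<close>.
  The operator norm is \<open>\<infinity>\<close> if \<open>T\<close> is unbounded or does not take its values in \<open>L\<^sup>2(N)\<close>.
\<close>

definition op_norm ::
  "'a measure \<Rightarrow> ('a \<Rightarrow> complex) set \<Rightarrow> 'b measure \<Rightarrow> (('a \<Rightarrow> complex) \<Rightarrow> 'b \<Rightarrow> complex) \<Rightarrow> ennreal"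
where
  "op_norm M X N T = (SUP f \<in> {f \<in> X. L2_norm M f \<le> 1}. L2_norm N (T f))"

text \<open>
  Linearity and finiteness of the norm force \<open>T f = T g\<close> a.e. whenever \<open>f = g\<close> a.e., so that \<open>T\<close>
  does induce an operator between the spaces of classes.
\<close>

definition bounded_op ::
  "'a measure \<Rightarrow> ('a \<Rightarrow> complex) set \<Rightarrow> 'b measure \<Rightarrow> (('a \<Rightarrow> complex) \<Rightarrow> 'b \<Rightarrow> complex) \<Rightarrow> bool"
where
  "bounded_op M X N T \<longleftrightarrow>
     (\<forall>f\<in>X. T f \<in> L2_space N) \<and>
     (\<forall>f\<in>X. \<forall>g\<in>X. \<forall>c. AE x in N. T (\<lambda>y. c * f y + g y) x = c * T f x + T g x) \<and>
     op_norm M X N T < top"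

text \<open>
  The rank is the dimension of the range modulo a.e. equality, i.e. the least number of vectors
  whose span contains the range (\<open>\<infinity>\<close> if there is no finite such family).
\<close>

definition op_rank ::
  "('a \<Rightarrow> complex) set \<Rightarrow> 'b measure \<Rightarrow> (('a \<Rightarrow> complex) \<Rightarrow> 'b \<Rightarrow> complex) \<Rightarrow> enat"
where
  "op_rank X N T =
     (INF B \<in> {B. finite B \<and> B \<subseteq> L2_space N \<and>
                  (\<forall>f\<in>X. \<exists>c. AE x in N. T f x = (\<Sum>b\<in>B. c b * b x))}. enat (card B))"

definition approx_number ::
  "'a measure \<Rightarrow> ('a \<Rightarrow> complex) set \<Rightarrow> 'b measure \<Rightarrow> (('a \<Rightarrow> complex) \<Rightarrow> 'b \<Rightarrow> complex) \<Rightarrow> nat \<Rightarrow> ennreal"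
where
  "approx_number M X N S n =
     (INF R \<in> {R. bounded_op M X N R \<and> op_rank X N R < enat n}.
        op_norm M X N (\<lambda>f x. S f x - R f x))"

text \<open>
  Approximation numbers are indexed from 1, hence the \<open>Suc\<close>. For an unbounded \<open>S\<close> all of them,
  and hence the Schatten norm, are \<open>\<infinity>\<close>.
\<close>

definition schatten_norm ::
  "real \<Rightarrow> 'a measure \<Rightarrow> ('a \<Rightarrow> complex) set \<Rightarrow> 'b measure \<Rightarrow> (('a \<Rightarrow> complex) \<Rightarrow> 'b \<Rightarrow> complex) \<Rightarrow> ennreal"
where
  "schatten_norm q M X N S = lq_norm q (\<lambda>n. approx_number M X N S (Suc n))"

definition lacunary :: "(nat \<Rightarrow> real) \<Rightarrow> bool" where
  "lacunary \<Lambda> \<longleftrightarrow> (\<forall>n. \<Lambda> n > 0) \<and> (\<exists>r>1. \<forall>n. \<Lambda> (Suc n) \<ge> r * \<Lambda> n)"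

definition quasi_geometric :: "(nat \<Rightarrow> real) \<Rightarrow> bool" where
  "quasi_geometric \<Lambda> \<longleftrightarrow> (\<forall>n. \<Lambda> n > 0) \<and>
     (\<exists>r R. 1 < r \<and> (\<forall>n. r \<le> \<Lambda> (Suc n) / \<Lambda> n \<and> \<Lambda> (Suc n) / \<Lambda> n \<le> R))"

abbreviation leb01 :: "real measure" where
  "leb01 \<equiv> lebesgue_on {0..1}"

definition muntz_space :: "(nat \<Rightarrow> real) \<Rightarrow> (real \<Rightarrow> complex) set" where
  "muntz_space \<Lambda> =
     {f \<in> L2_space leb01. \<forall>e>0. \<exists>N c.
        L2_norm leb01 (\<lambda>t. f t - (\<Sum>n<N. c n * complex_of_real (t powr \<Lambda> n))) < ennreal e}"

text \<open>
  By the Clarkson--Erdos theorem, every \<open>f\<close> in the Muntz space of a lacunary \<open>\<Lambda>\<close> coincides a.e.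
  on \<open>[0,1]\<close> with the sum of a unique series in the monomials that converges on \<open>[0,1)\<close>.
  Evaluating this series gives the values of \<open>f\<close> at every point of \<open>[0,1)\<close>; this matters because
  \<open>\<mu>\<close> need not be absolutely continuous.
\<close>

definition muntz_coeffs :: "(nat \<Rightarrow> real) \<Rightarrow> (real \<Rightarrow> complex) \<Rightarrow> nat \<Rightarrow> complex" where
  "muntz_coeffs \<Lambda> f =
     (THE a. (\<forall>x\<in>{0..<1}. summable (\<lambda>n. a n * complex_of_real (x powr \<Lambda> n))) \<and>
             (AE x in leb01. f x = (\<Sum>n. a n * complex_of_real (x powr \<Lambda> n))))"

definition muntz_embedding :: "(nat \<Rightarrow> real) \<Rightarrow> (real \<Rightarrow> complex) \<Rightarrow> real \<Rightarrow> complex" where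
  "muntz_embedding \<Lambda> f x = (\<Sum>n. muntz_coeffs \<Lambda> f n * complex_of_real (x powr \<Lambda> n))"

definition D2 :: "(nat \<Rightarrow> real) \<Rightarrow> real measure \<Rightarrow> nat \<Rightarrow> ennreal" where
  "D2 \<Lambda> \<mu> n =
     epowr (\<integral>\<^sup>+ t. ennreal (\<Lambda> n powr (1/2) * t powr \<Lambda> n) *
                   (\<Sum>k. ennreal (\<Lambda> k powr (1/2) * t powr \<Lambda> k)) \<partial>\<mu>) (1 / 2)"

definition finite_measure_on_01 :: "real measure \<Rightarrow> bool" where
  "finite_measure_on_01 \<mu> \<longleftrightarrow>
     sets \<mu> = sets (restrict_space borel {0..<1::real}) \<and> finite_measure \<mu>"

end

theory Submission
  imports Defs "HOL-Computational_Algebra.Polynomial"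
begin

text \<open>
  The Gram matrix of the monomials is the Cauchy matrix with entries \<open>1 / (x j + x k)\<close>, where
  \<open>x n = \<Lambda> n + 1/2\<close>. Lacunarity and Schur's test bound it above; its inverse is a Cauchy
  matrix up to diagonal factors that are convergent products, so the same test bounds it below.
  Hence the functions \<open>sqrt (\<Lambda> n) * t powr \<Lambda> n\<close> form a Riesz basis of the Muntz space.

  For (i), the Cauchy--Schwarz inequality with weights \<open>sqrt (\<Lambda> n) * t powr \<Lambda> n\<close> shows that
  the embedding, read in this basis, is dominated by the diagonal operator with entries
  \<open>D2 n\<close>; dropping the \<open>n\<close> largest entries bounds the approximation numbers.

  For (ii), a quasi-geometric sequence satisfies \<open>D2 n ^ 2 \<le> C * (\<Sum>m. \<theta> ^ \<bar>n - m\<bar> * d m)\<close>, where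
  \<open>d m\<close> is the squared norm of the image of the \<open>m\<close>-th basis element. Sums of \<open>d\<close> over sets of
  size \<open>m\<close> are at most a constant times the sum of the first \<open>m\<close> squared approximation
  numbers, so the same holds for \<open>D2 n ^ 2\<close>, and majorization gives the inequality between
  the \<open>q\<close>-norms for \<open>q \<ge> 2\<close>.
\<close>

section \<open>Cauchy matrices of lacunary sequences\<close>

text \<open>The lower Riesz bound is the delicate half, since Schur's test only bounds from above.
  Applied to the inverse Cauchy matrix, it bounds the inverse form; evaluating the positive Gram
  form at \<open>c - e\<close>, where \<open>e\<close> is a multiple of the inverse applied to the
  weighted coefficients, turns this into a lower bound without spectral theory. That bound serves
  for more than norms. The measure may be singular, so an L2 limit says nothing about the values
  that the embedding needs. The lower bound makes the coefficients of approximating polynomials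
  converge, and lacunarity upgrades this to convergence at every point of [0,1). The restriction to
  \<open>q\<close> at least 2 enters because the majorization compares squares of the two sequences:
  the power \<open>q / 2\<close> must be convex. All constants are independent of the length
  \<open>N\<close> of a finite section, of the measure and of \<open>q\<close>; the first fact is
  what lets finite estimates pass to the limit.\<close>

lemma sum_power_dist_le:
  fixes \<theta> :: real
  assumes "0 < \<theta>" "\<theta> < 1"
  shows "(\<Sum>j<N. \<theta> ^ ((i - j) + (j - i))) \<le> 2 / (1 - \<theta>)"
proof -
  have geo: "(\<Sum>j<M. \<theta> ^ j) \<le> 1 / (1 - \<theta>)" for M
    using assms by (simp add: sum_gp_strict divide_right_mono)
  \<comment> \<open>Subtraction on naturals truncates, so the exponent is the distance between
    \<open>i\<close> and \<open>j\<close>. Each side of \<open>i\<close> contributes one geometric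
    series; counting \<open>i\<close> twice is harmless.\<close>
  have "(\<Sum>j<N. \<theta> ^ ((i - j) + (j - i))) \<le> (\<Sum>j\<in>{..i} \<union> {i..i+N}. \<theta> ^ ((i - j) + (j - i)))"
    using assms by (intro sum_mono2) auto
  also have "\<dots> \<le> (\<Sum>j\<in>{..i} \<union> {i..i+N}. \<theta> ^ ((i - j) + (j - i))) + (\<Sum>j\<in>{..i} \<inter> {i..i+N}. \<theta> ^ ((i - j) + (j - i)))"
    using assms by (simp add: sum_nonneg)
  also have "\<dots> = (\<Sum>j\<in>{..i}. \<theta> ^ ((i - j) + (j - i))) + (\<Sum>j\<in>{i..i+N}. \<theta> ^ ((i - j) + (j - i)))"
    by (rule sum.union_inter) auto
  also have "(\<Sum>j\<in>{..i}. \<theta> ^ ((i - j) + (j - i))) = (\<Sum>j<Suc i. \<theta> ^ j)"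
    by (rule sum.reindex_bij_witness[of _ "\<lambda>j. i - j" "\<lambda>j. i - j"]) auto
  also have "(\<Sum>j\<in>{i..i+N}. \<theta> ^ ((i - j) + (j - i))) = (\<Sum>j<Suc N. \<theta> ^ j)"
    by (rule sum.reindex_bij_witness[of _ "\<lambda>j. i + j" "\<lambda>j. j - i"]) auto
  finally show ?thesis using geo[of "Suc i"] geo[of "Suc N"] by simp
qed

text \<open>Schur's test with constant weights: the arithmetic-geometric mean inequality separates
  the two indices, and by symmetry of the kernel both halves are controlled by its row sums.\<close>

lemma schur_test_power_dist:
  fixes \<theta> :: real and u :: "nat \<Rightarrow> real"
  assumes \<theta>: "0 < \<theta>" "\<theta> < 1"
  shows "(\<Sum>i<N. \<Sum>j<N. \<bar>u i\<bar> * \<bar>u j\<bar> * \<theta> ^ ((i - j) + (j - i))) \<le> 2 / (1 - \<theta>) * (\<Sum>i<N. (u i)\<^sup>2)"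
proof -
  let ?w = "\<lambda>i j. \<theta> ^ ((i - j) + (j - i))"
  have "\<bar>u i\<bar> * \<bar>u j\<bar> * ?w i j \<le> (u i)\<^sup>2 / 2 * ?w i j + (u j)\<^sup>2 / 2 * ?w i j" for i j
  proof -
    have "\<bar>u i\<bar> * \<bar>u j\<bar> \<le> (u i)\<^sup>2 / 2 + (u j)\<^sup>2 / 2"
      using sum_squares_bound[of "\<bar>u i\<bar>" "\<bar>u j\<bar>"] by simp
    then show ?thesis
      using \<theta> by (metis distrib_right mult_right_mono zero_le_power less_imp_le)
  qed
  then have "(\<Sum>i<N. \<Sum>j<N. \<bar>u i\<bar> * \<bar>u j\<bar> * ?w i j)
      \<le> (\<Sum>i<N. \<Sum>j<N. (u i)\<^sup>2 / 2 * ?w i j) + (\<Sum>i<N. \<Sum>j<N. (u j)\<^sup>2 / 2 * ?w i j)"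
    by (simp add: sum.distrib[symmetric] sum_mono)
  also have "(\<Sum>i<N. \<Sum>j<N. (u j)\<^sup>2 / 2 * ?w i j) = (\<Sum>i<N. \<Sum>j<N. (u i)\<^sup>2 / 2 * ?w i j)"
    by (subst sum.swap) (simp add: add.commute)
  also have "(\<Sum>i<N. \<Sum>j<N. (u i)\<^sup>2 / 2 * ?w i j) \<le> (\<Sum>i<N. (u i)\<^sup>2 / 2 * (2 / (1 - \<theta>)))"
    unfolding sum_distrib_left[symmetric]
    by (intro sum_mono mult_left_mono sum_power_dist_le \<theta>) auto
  finally show ?thesis
    by (simp add: sum_distrib_left[symmetric] sum_divide_distrib[symmetric] sum_distrib_right[symmetric])
qed

section \<open>Lagrange interpolation and the inverse of a Cauchy matrix\<close>

lemma lagrange_interpolation: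
  fixes p :: "real poly" and y :: "nat \<Rightarrow> real"
  assumes deg: "degree p < N" and inj: "inj_on y {..<N}"
  shows "poly p z = (\<Sum>k<N. poly p (y k) * (\<Prod>l\<in>{..<N}-{k}. (z - y l) / (y k - y l)))"
proof -
  define L where "L k = (\<Prod>l\<in>{..<N}-{k}. smult (1 / (y k - y l)) [:- y l, 1:])" for k
  define Q where "Q = (\<Sum>k<N. smult (poly p (y k)) (L k))"
  have L: "poly (L k) z = (\<Prod>l\<in>{..<N}-{k}. (z - y l) / (y k - y l))" for k z
    unfolding L_def poly_prod by (rule prod.cong) (auto simp: diff_divide_distrib)
  have "degree (L k) \<le> N - 1" if "k < N" for k
  proof -
    have "degree (L k) \<le> (\<Sum>l\<in>{..<N}-{k}. degree (smult (1 / (y k - y l)) [:- y l, 1:]))"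
      unfolding L_def by (rule degree_prod_sum_le[unfolded o_def]) simp
    also have "\<dots> \<le> (\<Sum>l\<in>{..<N}-{k}. 1)"
      by (intro sum_mono order_trans[OF degree_smult_le]) simp
    finally show ?thesis using that by simp
  qed
  then have degQ: "degree Q < N" unfolding Q_def using deg
    by (intro le_less_trans[OF degree_sum_le[where n="N - 1"]])
       (auto intro: order_trans[OF degree_smult_le])
  have "poly Q (y j) = poly p (y j)" if "j < N" for j
  proof -
    have "poly (L k) (y j) = (if k = j then 1 else 0)" if "k < N" for k
    proof (cases "k = j")
      case True
      have "y j - y l \<noteq> 0" if "l \<in> {..<N}-{j}" for l
        using inj \<open>j < N\<close> that by (auto simp: inj_on_def)
      then show ?thesis using True unfolding L by simp
    next
      case False
      then show ?thesis using \<open>j < N\<close> unfolding L by (auto intro!: prod_zero)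
    qed
    then have "poly Q (y j) = (\<Sum>k<N. if k = j then poly p (y k) else 0)"
      unfolding Q_def poly_sum poly_smult by (intro sum.cong) auto
    then show ?thesis using that by (simp add: sum.delta)
  qed
  moreover have "card (y ` {..<N}) = N" using inj by (simp add: card_image)
  ultimately have "p = Q"
    using deg degQ by (intro poly_eqI_degree[of "y ` {..<N}"]) auto
  then have "poly p z = poly Q z" by simp
  then show ?thesis unfolding Q_def poly_sum poly_smult L .
qed

text \<open>Interpolate the product of the \<open>z - x l\<close> over \<open>l\<close> different
  from \<open>i\<close> at the nodes \<open>- x k\<close> and evaluate at \<open>x j\<close>. The
  interpolation weights supply the denominators \<open>x j + x k\<close>, and the polynomial
  vanishes at \<open>x j\<close> unless \<open>j = i\<close>. The last quotient in \<open>B\<close>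
  normalises the remaining value to 1.\<close>

lemma cauchy_matrix_inverse:
  fixes x :: "nat \<Rightarrow> real"
  assumes pos: "\<And>n. x n > 0" and inj: "inj_on x {..<N}" and "i < N" "j < N"
  defines "B \<equiv> \<lambda>i k. (\<Prod>l\<in>{..<N}-{i}. - x k - x l) / (\<Prod>l\<in>{..<N}-{k}. x l - x k)
              * ((\<Prod>l<N. x i + x l) / (\<Prod>l\<in>{..<N}-{i}. x i - x l))"
  shows "(\<Sum>k<N. B i k / (x j + x k)) = (if i = j then 1 else 0)"
proof -
  define p where "p = (\<Prod>l\<in>{..<N}-{i}. [:- x l, 1:])"
  have pp: "poly p z = (\<Prod>l\<in>{..<N}-{i}. z - x l)" for z
    unfolding p_def poly_prod by (rule prod.cong) auto
  have "degree p < N"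
  proof -
    have "degree p \<le> (\<Sum>l\<in>{..<N}-{i}. degree [:- x l, 1:])"
      unfolding p_def by (rule degree_prod_sum_le[unfolded o_def]) simp
    then show ?thesis using \<open>i < N\<close> by simp
  qed
  moreover have "inj_on (\<lambda>k. - x k) {..<N}" using inj by (auto simp: inj_on_def)
  ultimately have "poly p (x j) = (\<Sum>k<N. poly p (- x k) * (\<Prod>l\<in>{..<N}-{k}. (x j - - x l) / (- x k - - x l)))"
    by (rule lagrange_interpolation)
  also have "\<dots> = (\<Sum>k<N. poly p (- x k) * (((\<Prod>l<N. x j + x l) / (x j + x k)) / (\<Prod>l\<in>{..<N}-{k}. x l - x k)))"
  proof (rule sum.cong)
    fix k assume "k \<in> {..<N}"
    then have "(\<Prod>l<N. x j + x l) = (x j + x k) * (\<Prod>l\<in>{..<N}-{k}. x j + x l)"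
      by (subst prod.remove[of _ k]) auto
    then show "poly p (- x k) * (\<Prod>l\<in>{..<N}-{k}. (x j - - x l) / (- x k - - x l))
      = poly p (- x k) * (((\<Prod>l<N. x j + x l) / (x j + x k)) / (\<Prod>l\<in>{..<N}-{k}. x l - x k))"
      using pos[of j] pos[of k] by (simp add: prod_dividef)
  qed simp
  finally have eq: "poly p (x j) = (\<Prod>l<N. x j + x l) * (\<Sum>k<N. poly p (- x k) / (\<Prod>l\<in>{..<N}-{k}. x l - x k) / (x j + x k))"
    by (simp add: sum_distrib_left field_simps)
  have nz: "(\<Prod>l<N. x j + x l) \<noteq> 0" using pos by (auto simp: add_pos_pos less_imp_neq[symmetric])
  have "(\<Sum>k<N. B i k / (x j + x k)) = (\<Sum>k<N. poly p (- x k) / (\<Prod>l\<in>{..<N}-{k}. x l - x k) / (x j + x k))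
       * ((\<Prod>l<N. x i + x l) / poly p (x i))"
    unfolding B_def pp sum_distrib_right by (rule sum.cong) auto
  also have "\<dots> = poly p (x j) / (\<Prod>l<N. x j + x l) * ((\<Prod>l<N. x i + x l) / poly p (x i))"
    using eq nz by simp
  also have "\<dots> = (if i = j then 1 else 0)"
  proof (cases "i = j")
    case True
    have "poly p (x j) \<noteq> 0" unfolding pp using True inj \<open>j < N\<close> by (auto simp: inj_on_def)
    then show ?thesis using True nz by simp
  next
    case False
    then have "poly p (x j) = 0" unfolding pp using \<open>j < N\<close> by (auto intro!: prod_zero)
    then show ?thesis using False by simp
  qed
  finally show ?thesis .
qed

text \<open>
  The decay rate is written as \<open>\<theta>\<^sup>2\<close> so that \<open>sqrt (x i / x j)\<close> is bounded by a power of \<open>\<theta>\<close>.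
\<close>

locale lacunary_rate =
  fixes x :: "nat \<Rightarrow> real" and \<theta> :: real
  assumes pos: "x n > 0" and rate: "0 < \<theta>" "\<theta> < 1" and step: "x n \<le> \<theta>\<^sup>2 * x (Suc n)"
begin

lemma decay: "i \<le> j \<Longrightarrow> x i \<le> \<theta> ^ (2 * (j - i)) * x j"
proof (induction j rule: dec_induct)
  case (step n)
  have "x i \<le> \<theta> ^ (2 * (n - i)) * (\<theta>\<^sup>2 * x (Suc n))"
    using step lacunary_rate.step[OF lacunary_rate_axioms, of n] rate
    by (meson order_trans mult_left_mono zero_le_power less_imp_le)
  then show ?case using step by (simp add: Suc_diff_le power2_eq_square algebra_simps)
qed simp

lemma less: "i < j \<Longrightarrow> x i < x j"
proof -
  assume "i < j"
  then have "\<theta> ^ (2 * (j - i)) < 1" using rate by (simp add: power_less_one_iff)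
  then show "x i < x j" using decay[of i j] \<open>i < j\<close> pos[of j]
    by (smt (verit, best) less_imp_le mult_less_cancel_right2)
qed

lemma inj: "inj x"
  using less by (metis injI less_irrefl linorder_neqE_nat)

lemma sqrt_ratio: "i \<le> j \<Longrightarrow> sqrt (x i) \<le> \<theta> ^ (j - i) * sqrt (x j)"
proof -
  assume "i \<le> j"
  then have "sqrt (x i) \<le> sqrt ((\<theta> ^ (j - i))\<^sup>2 * x j)"
    using decay[of i j] by (simp add: power_mult[symmetric] mult.commute)
  then show ?thesis using rate by (simp add: real_sqrt_mult)
qed

text \<open>Dropping the smaller term of the denominator leaves the square root of the ratio of the
  smaller to the larger node. The left side is the Gram matrix rescaled to have 1/2 on the
  diagonal.\<close>

lemma gram_entry_le: "sqrt (x i) * sqrt (x j) / (x i + x j) \<le> \<theta> ^ ((i - j) + (j - i))"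
proof -
  have *: "sqrt (x i) * sqrt (x j) / (x i + x j) \<le> \<theta> ^ (j - i)" if "i \<le> j" for i j
  proof -
    have "sqrt (x i) * sqrt (x j) \<le> \<theta> ^ (j - i) * sqrt (x j) * sqrt (x j)"
      using sqrt_ratio[OF that] pos[of j] by (intro mult_right_mono) auto
    also have "\<dots> = \<theta> ^ (j - i) * x j" using pos[of j] by simp
    also have "\<dots> \<le> \<theta> ^ (j - i) * (x i + x j)" using rate pos[of i] by (intro mult_left_mono) auto
    finally show ?thesis using pos[of i] pos[of j] by (simp add: divide_le_eq)
  qed
  show ?thesis
  proof (cases "i \<le> j")
    case True then show ?thesis using * by simp
  next
    case False
    then show ?thesis using *[of j i] by (simp add: add.commute mult.commute)
  qed
qed

definition prod_const :: real where
  "prod_const = exp (4 / (1 - \<theta>)\<^sup>2)"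

text \<open>With \<open>a\<close> the smaller and \<open>b\<close> the larger node, a factor is 1 +
  2(a/b)/(1 - a/b), hence at most the exponential of a constant times \<open>\<theta>\<close> to the
  distance of the indices. The exponents form a geometric series; \<open>prod_const\<close> collects
  one factor 2/(1 - \<open>\<theta>\<close>) from each single estimate and one from the
  series.\<close>

lemma prod_ratio_le:
  "(\<Prod>l\<in>{..<N}-{k}. (x k + x l) / \<bar>x k - x l\<bar>) \<le> prod_const"
proof -
  have fac: "(x k + x l) / \<bar>x k - x l\<bar> \<le> exp (2 / (1 - \<theta>) * \<theta> ^ ((k - l) + (l - k)))" if "l \<noteq> k" for l
  proof -
    have *: "(b + a) / (b - a) \<le> exp (2 / (1 - \<theta>) * \<theta> ^ d)"
      if ab: "a > 0" "a \<le> \<theta> ^ (2 * d) * b" "d > 0" "b > 0" for a b :: real and d :: nat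
    proof -
      have "\<theta> ^ (2 * d) \<le> \<theta> ^ d" using rate by (intro power_decreasing) auto
      then have y: "a / b \<le> \<theta> ^ d"
        using ab by (smt (verit) mult_right_mono pos_divide_le_eq)
      \<comment> \<open>Distinct indices give \<open>d > 0\<close>, which keeps the ratio at most
        \<open>\<theta>\<close> and the denominator 1 - a/b away from 0.\<close>
      have "\<theta> ^ d \<le> \<theta> ^ 1" using rate ab by (intro power_decreasing) auto
      then have yt: "a / b \<le> \<theta>" using y by simp
      have ba: "b - a > 0" using yt rate ab by (simp add: divide_le_eq) (smt (verit) mult_less_cancel_right2)
      have "(b + a) / (b - a) = 1 + 2 * (a / b) / (1 - a / b)"
        using ba ab by (simp add: field_simps)
      also have "2 * (a / b) / (1 - a / b) \<le> 2 * \<theta> ^ d / (1 - \<theta>)"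
        using y yt rate ab by (intro frac_le) auto
      also have "1 + 2 * \<theta> ^ d / (1 - \<theta>) \<le> exp (2 * \<theta> ^ d / (1 - \<theta>))" by (rule exp_ge_add_one_self)
      finally show ?thesis by (simp add: mult.commute)
    qed
    show ?thesis
    proof (cases "l < k")
      case True
      then show ?thesis using *[of "x l" "k - l" "x k"] decay[of l k] pos less[OF True] by simp
    next
      case False
      then have "k < l" using that by simp
      then show ?thesis using *[of "x k" "l - k" "x l"] decay[of k l] pos less[of k l] by (simp add: add.commute)
    qed
  qed
  have "(\<Prod>l\<in>{..<N}-{k}. (x k + x l) / \<bar>x k - x l\<bar>)
      \<le> (\<Prod>l\<in>{..<N}-{k}. exp (2 / (1 - \<theta>) * \<theta> ^ ((k - l) + (l - k))))"
    by (intro prod_mono) (use fac pos in \<open>auto intro!: divide_nonneg_nonneg add_nonneg_nonneg simp: less_imp_le\<close>)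
  also have "\<dots> = exp (2 / (1 - \<theta>) * (\<Sum>l\<in>{..<N}-{k}. \<theta> ^ ((k - l) + (l - k))))"
    by (simp add: exp_sum sum_distrib_left)
  also have "\<dots> \<le> exp (2 / (1 - \<theta>) * (2 / (1 - \<theta>)))"
  proof -
    have "(\<Sum>l\<in>{..<N}-{k}. \<theta> ^ ((k - l) + (l - k))) \<le> (\<Sum>l<N. \<theta> ^ ((k - l) + (l - k)))"
      using rate by (intro sum_mono2) auto
    also have "\<dots> \<le> 2 / (1 - \<theta>)" by (rule sum_power_dist_le[OF rate])
    finally show ?thesis using rate unfolding exp_le_cancel_iff by (intro mult_left_mono) auto
  qed
  finally show ?thesis unfolding prod_const_def by (simp add: power2_eq_square)
qed

text \<open>The 8 splits as 4 from the two factors \<open>2 * x i\<close> and \<open>2 * x k\<close>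
  that remain in an inverse entry, and 2 from the constant 2/(1 - \<open>\<theta>\<close>) of
  Schur's test; \<open>prod_const\<close> is squared because an inverse entry contains two
  products.\<close>

definition riesz_const :: real where
  "riesz_const = 8 * prod_const\<^sup>2 / (1 - \<theta>)"

lemma riesz_const_pos: "riesz_const > 0"
  unfolding riesz_const_def prod_const_def using rate by simp

text \<open>Write G for the Cauchy matrix, W for the left side and q for the double sum. With
  \<open>e\<close> chosen so that G e has the entries \<open>s * c j / x j\<close>, positivity at
  \<open>c - e\<close> gives 0 <= q - 2 s W + K s^2 W, where K is \<open>riesz_const\<close> and the
  last term is Schur's bound for the inverse. Positivity is assumed here; it is supplied later by
  writing the form as the integral of a square.\<close>

lemma riesz_lower:
  fixes c :: "nat \<Rightarrow> real"
  assumes psd: "\<And>c :: nat \<Rightarrow> real. (\<Sum>j<N. \<Sum>k<N. c j * c k / (x j + x k)) \<ge> 0"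
  shows "(\<Sum>j<N. (c j)\<^sup>2 / x j) \<le> riesz_const * (\<Sum>j<N. \<Sum>k<N. c j * c k / (x j + x k))"
proof -
  define B where "B i k = (\<Prod>l\<in>{..<N}-{i}. - x k - x l) / (\<Prod>l\<in>{..<N}-{k}. x l - x k)
              * ((\<Prod>l<N. x i + x l) / (\<Prod>l\<in>{..<N}-{i}. x i - x l))" for i k
  have GB: "(\<Sum>k<N. B i k / (x j + x k)) = (if i = j then 1 else 0)" if "i < N" "j < N" for i j
    unfolding B_def by (rule cauchy_matrix_inverse) (use that pos inj in \<open>auto intro: inj_on_subset\<close>)
  have absB: "\<bar>B i k\<bar> \<le> 4 * prod_const\<^sup>2 * (x i * x k / (x i + x k))" if ik: "i < N" "k < N" for i k
  proof -
    \<comment> \<open>The numerator omits index \<open>i\<close> while its denominator omits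
      \<open>k\<close>. Exchanging the omitted index brings out 1/(x k + x i), so the inverse is
      again of Cauchy type up to bounded products.\<close>
    have 1: "(\<Prod>l\<in>{..<N}-{i}. x k + x l) = (\<Prod>l\<in>{..<N}-{k}. x k + x l) * (2 * x k) / (x k + x i)"
    proof -
      have "(\<Prod>l<N. x k + x l) = (x k + x k) * (\<Prod>l\<in>{..<N}-{k}. x k + x l)"
        using ik by (subst prod.remove[of _ k]) auto
      moreover have "(\<Prod>l<N. x k + x l) = (x k + x i) * (\<Prod>l\<in>{..<N}-{i}. x k + x l)"
        using ik by (subst prod.remove[of _ i]) auto
      ultimately show ?thesis using pos[of i] pos[of k] by (simp add: field_simps)
    qed
    have 2: "(\<Prod>l<N. x i + x l) = (2 * x i) * (\<Prod>l\<in>{..<N}-{i}. x i + x l)"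
      using ik by (subst prod.remove[of _ i]) auto
    have absp: "\<bar>- x k - x l\<bar> = x k + x l" "\<bar>x i + x l\<bar> = x i + x l" for l
      using pos[of k] pos[of l] pos[of i] by auto
    have "\<bar>B i k\<bar> = (\<Prod>l\<in>{..<N}-{i}. x k + x l) / (\<Prod>l\<in>{..<N}-{k}. \<bar>x k - x l\<bar>)
              * ((\<Prod>l<N. x i + x l) / (\<Prod>l\<in>{..<N}-{i}. \<bar>x i - x l\<bar>))"
      unfolding B_def abs_mult abs_divide abs_prod absp by (simp only: abs_minus_commute[of _ "x k"])
    also have "\<dots> = (2 * x k) / (x k + x i) * (2 * x i)
        * (\<Prod>l\<in>{..<N}-{k}. (x k + x l) / \<bar>x k - x l\<bar>) * (\<Prod>l\<in>{..<N}-{i}. (x i + x l) / \<bar>x i - x l\<bar>)"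
      unfolding 1 2 prod_dividef by (simp add: mult_ac)
    also have "\<dots> \<le> (2 * x k) / (x k + x i) * (2 * x i) * prod_const * prod_const"
      using pos by (intro mult_mono prod_ratio_le mult_nonneg_nonneg prod_nonneg divide_nonneg_nonneg ballI)
        (auto simp: prod_const_def less_imp_le add_nonneg_nonneg)
    also have "\<dots> = 4 * prod_const\<^sup>2 * (x i * x k / (x i + x k))"
      by (simp add: power2_eq_square add.commute mult_ac)
    finally show ?thesis .
  qed
  define W where "W = (\<Sum>j<N. (c j)\<^sup>2 / x j)"
  \<comment> \<open>This value minimises the quadratic - 2 s + K s^2.\<close>
  define s where "s = 1 / riesz_const"
  define d where "d j = s * c j / x j" for j
  define e where "e k = (\<Sum>i<N. d i * B i k)" for k
  define q where "q = (\<Sum>j<N. \<Sum>k<N. c j * c k / (x j + x k))"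
  have Ge: "(\<Sum>k<N. e k / (x j + x k)) = d j" if "j < N" for j
  proof -
    have "(\<Sum>k<N. e k / (x j + x k)) = (\<Sum>i<N. d i * (\<Sum>k<N. B i k / (x j + x k)))"
      unfolding e_def sum_divide_distrib sum_distrib_left by (subst sum.swap) simp
    also have "\<dots> = (\<Sum>i<N. d i * (if i = j then 1 else 0))"
      by (rule sum.cong) (auto simp: GB that)
    finally show ?thesis using that by (simp add: if_distrib sum.delta cong: if_cong)
  qed
  have ce: "(\<Sum>j<N. \<Sum>k<N. a j * e k / (x j + x k)) = (\<Sum>j<N. a j * d j)" for a
    by (rule sum.cong) (auto simp: Ge[symmetric] sum_distrib_left)
  have ec: "(\<Sum>j<N. \<Sum>k<N. e j * c k / (x j + x k)) = (\<Sum>j<N. c j * d j)"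
    by (subst sum.swap) (simp add: ce[symmetric] add.commute mult.commute)
  have cd: "(\<Sum>j<N. c j * d j) = s * W"
    unfolding W_def d_def sum_distrib_left by (rule sum.cong) (auto simp: power2_eq_square)
  have ed: "(\<Sum>j<N. e j * d j) \<le> riesz_const * s\<^sup>2 * W"
  proof -
    \<comment> \<open>The scaling that brings the inverse entries into the form treated by
      \<open>gram_entry_le\<close>.\<close>
    define u where "u i = s * c i / sqrt (x i)" for i
    have dx: "\<bar>d i\<bar> * x i = \<bar>u i\<bar> * sqrt (x i)" for i
      using pos[of i] unfolding d_def u_def by (simp add: abs_mult)
    have "(\<Sum>j<N. e j * d j) = (\<Sum>j<N. \<Sum>i<N. d i * B i j * d j)"
      unfolding e_def sum_distrib_right ..
    also have "\<dots> \<le> (\<Sum>j<N. \<Sum>i<N. 4 * prod_const\<^sup>2 * (\<bar>u j\<bar> * \<bar>u i\<bar> * \<theta> ^ ((j - i) + (i - j))))"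
    proof (intro sum_mono)
      fix i j assume ij: "j \<in> {..<N}" "i \<in> {..<N}"
      have "d i * B i j * d j \<le> \<bar>d i\<bar> * \<bar>B i j\<bar> * \<bar>d j\<bar>"
        by (metis abs_ge_self abs_mult)
      also have "\<dots> \<le> \<bar>d i\<bar> * (4 * prod_const\<^sup>2 * (x i * x j / (x i + x j))) * \<bar>d j\<bar>"
        using absB ij pos[of i] pos[of j] by (intro mult_mono) auto
      also have "\<dots> = 4 * prod_const\<^sup>2 * ((\<bar>d i\<bar> * x i) * (\<bar>d j\<bar> * x j) / (x i + x j))"
        by (simp add: mult_ac)
      also have "\<dots> = 4 * prod_const\<^sup>2 * (\<bar>u j\<bar> * \<bar>u i\<bar> * (sqrt (x j) * sqrt (x i) / (x j + x i)))"
        unfolding dx by (simp add: mult_ac add.commute)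
      also have "\<dots> \<le> 4 * prod_const\<^sup>2 * (\<bar>u j\<bar> * \<bar>u i\<bar> * \<theta> ^ ((j - i) + (i - j)))"
        by (intro mult_left_mono gram_entry_le) auto
      finally show "d i * B i j * d j \<le> 4 * prod_const\<^sup>2 * (\<bar>u j\<bar> * \<bar>u i\<bar> * \<theta> ^ ((j - i) + (i - j)))" .
    qed
    also have "\<dots> \<le> 4 * prod_const\<^sup>2 * (2 / (1 - \<theta>) * (\<Sum>i<N. (u i)\<^sup>2))"
      unfolding sum_distrib_left[symmetric]
      by (intro mult_left_mono schur_test_power_dist rate) auto
    also have "(\<Sum>i<N. (u i)\<^sup>2) = s\<^sup>2 * W"
      unfolding W_def u_def sum_distrib_left
      by (rule sum.cong) (use pos in \<open>auto simp: power_divide power_mult_distrib less_imp_le\<close>)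
    finally show ?thesis unfolding riesz_const_def by (simp add: mult_ac)
  qed
  have "0 \<le> (\<Sum>j<N. \<Sum>k<N. (c j - e j) * (c k - e k) / (x j + x k))" by (rule psd)
  also have "\<dots> = q - (\<Sum>j<N. \<Sum>k<N. c j * e k / (x j + x k)) - (\<Sum>j<N. \<Sum>k<N. e j * c k / (x j + x k))
      + (\<Sum>j<N. \<Sum>k<N. e j * e k / (x j + x k))"
    unfolding q_def sum_subtractf[symmetric] sum.distrib[symmetric]
    by (intro sum.cong refl) (simp add: diff_divide_distrib[symmetric] add_divide_distrib[symmetric] algebra_simps)
  also have "\<dots> \<le> q - 2 * s * W + riesz_const * s\<^sup>2 * W"
    unfolding ce ec cd using ed by simp
  also have "\<dots> = q - s * W"
    unfolding s_def using riesz_const_pos by (simp add: power2_eq_square field_simps)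
  finally have "s * W \<le> q" by simp
  then show ?thesis unfolding s_def W_def[symmetric] q_def[symmetric]
    using riesz_const_pos by (simp add: field_simps)
qed

lemma riesz_upper:
  fixes c :: "nat \<Rightarrow> real"
  shows "(\<Sum>j<N. \<Sum>k<N. c j * c k / (x j + x k)) \<le> 2 / (1 - \<theta>) * (\<Sum>j<N. (c j)\<^sup>2 / x j)"
proof -
  define u where "u i = c i / sqrt (x i)" for i
  have c: "c i = u i * sqrt (x i)" for i using pos[of i] unfolding u_def by simp
  have "(\<Sum>j<N. \<Sum>k<N. c j * c k / (x j + x k)) \<le> (\<Sum>j<N. \<Sum>k<N. \<bar>u j\<bar> * \<bar>u k\<bar> * \<theta> ^ ((j - k) + (k - j)))"
  proof (intro sum_mono)
    fix j k
    have "c j * c k / (x j + x k) = u j * u k * (sqrt (x j) * sqrt (x k) / (x j + x k))"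
      unfolding c by (simp add: mult_ac)
    also have "\<dots> \<le> \<bar>u j * u k\<bar> * (sqrt (x j) * sqrt (x k) / (x j + x k))"
      using pos[of j] pos[of k] by (intro mult_right_mono) auto
    also have "\<dots> \<le> \<bar>u j * u k\<bar> * \<theta> ^ ((j - k) + (k - j))"
      by (intro mult_left_mono gram_entry_le) auto
    finally show "c j * c k / (x j + x k) \<le> \<bar>u j\<bar> * \<bar>u k\<bar> * \<theta> ^ ((j - k) + (k - j))"
      by (simp add: abs_mult)
  qed
  also have "\<dots> \<le> 2 / (1 - \<theta>) * (\<Sum>i<N. (u i)\<^sup>2)" by (rule schur_test_power_dist[OF rate])
  also have "(\<Sum>i<N. (u i)\<^sup>2) = (\<Sum>j<N. (c j)\<^sup>2 / x j)"
    unfolding u_def by (rule sum.cong) (use pos in \<open>auto simp: power_divide less_imp_le\<close>)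
  finally show ?thesis .
qed

end

section \<open>Muntz spaces of lacunary exponents\<close>

lemma epowr_ennreal: "0 \<le> a \<Longrightarrow> epowr (ennreal a) p = ennreal (a powr p)"
  by (simp add: epowr_def)

lemma epowr_top [simp]: "epowr top p = top"
  by (simp add: epowr_def)

lemma epowr_0 [simp]: "epowr 0 p = 0"
  by (simp add: epowr_def)

lemma epowr_1 [simp]: "epowr x 1 = x"
  by (cases x) (auto simp: epowr_def)

lemma epowr_epowr: "epowr (epowr x a) b = epowr x (a * b)"
  by (cases x) (auto simp: epowr_def powr_powr)

lemma epowr_mono: "x \<le> y \<Longrightarrow> 0 < p \<Longrightarrow> epowr x p \<le> epowr y p"
  by (cases x; cases y) (auto simp: epowr_def top_unique intro!: powr_mono2 ennreal_leI)

lemma epowr_le_iff: "0 < p \<Longrightarrow> epowr x p \<le> epowr y p \<longleftrightarrow> x \<le> y"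
  using epowr_mono[of x y p] epowr_mono[of "epowr x p" "epowr y p" "1 / p"]
  by (auto simp: epowr_epowr)

lemma epowr_less_top_iff [simp]: "epowr x p < top \<longleftrightarrow> x < top"
  by (cases x) (auto simp: epowr_def)

lemma epowr_mult:
  assumes "0 < p"
  shows "epowr (x * y) p = epowr x p * epowr y p"
proof (cases "x = top \<or> y = top")
  case True
  have "epowr z p = 0 \<longleftrightarrow> z = 0" for z
    by (cases z) (auto simp: epowr_def)
  then show ?thesis using True
    by (cases "x = 0 \<or> y = 0") (force simp: ennreal_top_mult ennreal_mult_top)+
next
  case False
  define a b where "a = enn2real x" and "b = enn2real y"
  have "x = ennreal a" "y = ennreal b" "0 \<le> a" "0 \<le> b"
    using False by (auto simp: a_def b_def less_top)
  then show ?thesis by (simp add: epowr_ennreal ennreal_mult[symmetric] powr_mult)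
qed

abbreviation L2_sq :: "'a measure \<Rightarrow> ('a \<Rightarrow> complex) \<Rightarrow> ennreal" where
  "L2_sq M f \<equiv> \<integral>\<^sup>+ x. ennreal ((cmod (f x))\<^sup>2) \<partial>M"

lemma epowr_L2_norm: "epowr (L2_norm M f) 2 = L2_sq M f"
  unfolding L2_norm_def epowr_epowr by simp

lemma L2_norm_le_iff:
  assumes "0 \<le> c"
  shows "L2_norm N g \<le> ennreal c * L2_norm M f \<longleftrightarrow> L2_sq N g \<le> ennreal (c\<^sup>2) * L2_sq M f"
proof -
  have "L2_norm N g \<le> ennreal c * L2_norm M f
      \<longleftrightarrow> epowr (L2_norm N g) 2 \<le> epowr (ennreal c * L2_norm M f) 2"
    by (simp add: epowr_le_iff)
  then show ?thesis using assms by (simp add: epowr_mult epowr_L2_norm epowr_ennreal)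
qed

lemma L2_norm_le_iff_real:
  assumes "0 \<le> c"
  shows "L2_norm M f \<le> ennreal c \<longleftrightarrow> L2_sq M f \<le> ennreal (c\<^sup>2)"
  using epowr_le_iff[of 2 "L2_norm M f" "ennreal c"] assms by (simp add: epowr_L2_norm epowr_ennreal)

lemma L2_space_iff: "f \<in> L2_space M \<longleftrightarrow> f \<in> borel_measurable M \<and> L2_sq M f < top"
  unfolding L2_space_def L2_norm_def by simp

lemma cmod_add_sq_le: "(cmod (a + b))\<^sup>2 \<le> 2 * (cmod a)\<^sup>2 + 2 * (cmod b)\<^sup>2"
proof -
  have "(cmod (a + b))\<^sup>2 \<le> (cmod a + cmod b)\<^sup>2" by (simp add: norm_triangle_ineq power_mono)
  also have "\<dots> \<le> 2 * (cmod a)\<^sup>2 + 2 * (cmod b)\<^sup>2"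
    using sum_squares_bound[of "cmod a" "cmod b"] by (simp add: power2_sum)
  finally show ?thesis .
qed

lemma L2_sq_add_le:
  assumes [measurable]: "f \<in> borel_measurable M" "g \<in> borel_measurable M"
  shows "L2_sq M (\<lambda>x. f x + g x) \<le> 2 * L2_sq M f + 2 * L2_sq M g"
proof -
  have "L2_sq M (\<lambda>x. f x + g x) \<le> (\<integral>\<^sup>+ x. 2 * ennreal ((cmod (f x))\<^sup>2) + 2 * ennreal ((cmod (g x))\<^sup>2) \<partial>M)"
  proof (rule nn_integral_mono)
    fix x
    have "ennreal ((cmod (f x + g x))\<^sup>2) \<le> ennreal (2 * (cmod (f x))\<^sup>2 + 2 * (cmod (g x))\<^sup>2)"
      by (intro ennreal_leI cmod_add_sq_le)
    then show "ennreal ((cmod (f x + g x))\<^sup>2) \<le> 2 * ennreal ((cmod (f x))\<^sup>2) + 2 * ennreal ((cmod (g x))\<^sup>2)"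
      by (simp add: ennreal_plus ennreal_mult)
  qed
  also have "\<dots> = 2 * L2_sq M f + 2 * L2_sq M g"
    by (simp add: nn_integral_add nn_integral_cmult)
  finally show ?thesis .
qed

lemma L2_sq_cmult:
  assumes [measurable]: "f \<in> borel_measurable M"
  shows "L2_sq M (\<lambda>x. c * f x) = ennreal ((cmod c)\<^sup>2) * L2_sq M f"
  by (simp add: norm_mult power_mult_distrib ennreal_mult nn_integral_cmult)

text \<open>Bridge from gauge integrals, in which the Gram entries are computed, to the measure
  \<open>leb01\<close>; passing to the completion does not change the integral.\<close>

lemma nn_integral_leb01_has_integral:
  fixes f :: "real \<Rightarrow> real"
  assumes [measurable]: "f \<in> borel_measurable borel"
    and "(f has_integral I) {0..1}" and nonneg: "\<And>x. x \<in> {0..1} \<Longrightarrow> 0 \<le> f x"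
  shows "(\<integral>\<^sup>+ x. ennreal (f x) \<partial>leb01) = ennreal I"
proof -
  have "(\<integral>\<^sup>+ x. ennreal (f x) \<partial>leb01) = (\<integral>\<^sup>+ x. ennreal (f x) * indicator {0..1} x \<partial>completion lborel)"
    by (intro nn_integral_restrict_space) simp
  also have "\<dots> = (\<integral>\<^sup>+ x. ennreal (f x) * indicator {0..1} x \<partial>lborel)"
    by (rule nn_integral_completion)
  also have "\<dots> = ennreal I"
    using nn_integral_has_integral_lebesgue'[OF nonneg assms(2)] by simp
  finally show ?thesis .
qed

text \<open>The growth condition is imposed on the shifted exponents because these are the nodes of
  the Gram matrix. It is inherited by the exponents themselves with the same rate, since the rate is
  below 1; hence the two interpretations \<open>shift\<close> and \<open>exps\<close>.\<close>

locale muntz_exponents =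
  fixes \<Lambda> :: "nat \<Rightarrow> real" and \<theta> :: real
  assumes pos: "\<Lambda> n > 0" and rate: "0 < \<theta>" "\<theta> < 1"
    and step: "\<Lambda> n + 1 / 2 \<le> \<theta>\<^sup>2 * (\<Lambda> (Suc n) + 1 / 2)"
begin

sublocale shift: lacunary_rate "\<lambda>n. \<Lambda> n + 1 / 2" \<theta>
  by unfold_locales (use pos rate step in \<open>auto intro: add_pos_pos\<close>)

sublocale exps: lacunary_rate \<Lambda> \<theta>
proof
  fix n
  have "\<theta>\<^sup>2 \<le> 1" using rate by (simp add: power_le_one)
  then show "\<Lambda> n \<le> \<theta>\<^sup>2 * \<Lambda> (Suc n)" using step[of n] by (simp add: algebra_simps)
qed (use pos rate in auto)

definition muntz_poly :: "nat \<Rightarrow> (nat \<Rightarrow> complex) \<Rightarrow> real \<Rightarrow> complex" where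
  "muntz_poly N c t = (\<Sum>n<N. c n * complex_of_real (t powr \<Lambda> n))"

lemma borel_measurable_muntz_poly [measurable]: "muntz_poly N c \<in> borel_measurable borel"
  unfolding muntz_poly_def by measurable

lemma muntz_poly_leb01 [measurable]: "muntz_poly N c \<in> borel_measurable leb01"
  by (intro measurable_restrict_space1 measurable_completion) simp

lemma monom_has_integral: "((\<lambda>t. t powr \<Lambda> j * t powr \<Lambda> k) has_integral 1 / ((\<Lambda> j + 1/2) + (\<Lambda> k + 1/2))) {0..1}"
  using has_integral_powr_from_0[of "\<Lambda> j + \<Lambda> k" 1] pos[of j] pos[of k]
  by (simp add: powr_add add_ac)

definition gram_form :: "nat \<Rightarrow> (nat \<Rightarrow> real) \<Rightarrow> real" where
  "gram_form N c = (\<Sum>j<N. \<Sum>k<N. c j * c k / ((\<Lambda> j + 1/2) + (\<Lambda> k + 1/2)))"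

lemma square_has_integral: "((\<lambda>t. (\<Sum>n<N. c n * t powr \<Lambda> n)\<^sup>2) has_integral gram_form N c) {0..1}"
proof -
  have "((\<lambda>t. \<Sum>j<N. \<Sum>k<N. (c j * c k) * (t powr \<Lambda> j * t powr \<Lambda> k)) has_integral
        (\<Sum>j<N. \<Sum>k<N. (c j * c k) * (1 / ((\<Lambda> j + 1/2) + (\<Lambda> k + 1/2))))) {0..1}"
    by (intro has_integral_sum has_integral_mult_right monom_has_integral) auto
  then show ?thesis unfolding gram_form_def power2_eq_square sum_product
    by (simp add: mult_ac)
qed

lemma gram_form_nonneg: "0 \<le> gram_form N c"
  using has_integral_nonneg[OF square_has_integral] by simp

text \<open>The monomials are real, so real and imaginary parts of the coefficients decouple; this
  reduces complex coefficients to the real Riesz bounds.\<close>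

lemma L2_sq_muntz_poly:
  "L2_sq leb01 (muntz_poly N c) = ennreal (gram_form N (\<lambda>n. Re (c n)) + gram_form N (\<lambda>n. Im (c n)))"
proof (rule nn_integral_leb01_has_integral)
  have "(cmod (muntz_poly N c t))\<^sup>2 = (\<Sum>n<N. Re (c n) * t powr \<Lambda> n)\<^sup>2 + (\<Sum>n<N. Im (c n) * t powr \<Lambda> n)\<^sup>2" for t
    unfolding cmod_power2 muntz_poly_def by (simp add: Re_sum Im_sum)
  then show "((\<lambda>t. (cmod (muntz_poly N c t))\<^sup>2) has_integral
      gram_form N (\<lambda>n. Re (c n)) + gram_form N (\<lambda>n. Im (c n))) {0..1}"
    by (auto intro!: has_integral_add square_has_integral)
qed auto

text \<open>Twice the diagonal part of the Gram form, since the squared norm of a monomial is 1/(2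
  \<open>\<Lambda> n\<close> + 1).\<close>

definition coeff_norm :: "nat \<Rightarrow> (nat \<Rightarrow> complex) \<Rightarrow> real" where
  "coeff_norm N c = (\<Sum>n<N. (cmod (c n))\<^sup>2 / (\<Lambda> n + 1/2))"

lemma coeff_norm_split: "coeff_norm N c = (\<Sum>n<N. (Re (c n))\<^sup>2 / (\<Lambda> n + 1/2)) + (\<Sum>n<N. (Im (c n))\<^sup>2 / (\<Lambda> n + 1/2))"
  unfolding coeff_norm_def cmod_power2 by (simp add: add_divide_distrib sum.distrib)

lemma coeff_norm_le: "ennreal (coeff_norm N c) \<le> ennreal shift.riesz_const * L2_sq leb01 (muntz_poly N c)"
proof -
  have "coeff_norm N c \<le> shift.riesz_const * (gram_form N (\<lambda>n. Re (c n)) + gram_form N (\<lambda>n. Im (c n)))"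
    unfolding coeff_norm_split distrib_left gram_form_def
    by (intro add_mono shift.riesz_lower) (use gram_form_nonneg in \<open>auto simp: gram_form_def\<close>)
  then show ?thesis unfolding L2_sq_muntz_poly using shift.riesz_const_pos gram_form_nonneg
    by (simp add: ennreal_mult[symmetric] ennreal_leI del: ennreal_plus)
qed

lemma L2_sq_muntz_poly_le: "L2_sq leb01 (muntz_poly N c) \<le> ennreal (2 / (1 - \<theta>) * coeff_norm N c)"
  unfolding L2_sq_muntz_poly coeff_norm_split distrib_left gram_form_def
  by (intro ennreal_leI add_mono shift.riesz_upper)

section \<open>Pointwise convergence and uniqueness of lacunary series\<close>

lemma summable_exponent_powr:
  assumes "0 \<le> s" "s < (1::real)"
  shows "summable (\<lambda>n. \<Lambda> n * s powr \<Lambda> n)"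
proof (cases "s = 0")
  case False
  define \<tau> where "\<tau> = - ln s"
  have \<tau>: "\<tau> > 0" using assms False unfolding \<tau>_def by simp
  have "summable (\<lambda>n. 2 / (\<tau>\<^sup>2 * \<Lambda> 0) * (\<theta>\<^sup>2) ^ n)"
    using rate by (intro summable_mult summable_geometric) (simp add: power_less_one_iff)
  then show ?thesis
  proof (rule summable_comparison_test_ev[rotated], intro always_eventually allI)
    fix n
    define y where "y = \<tau> * \<Lambda> n"
    have y: "y > 0" using \<tau> pos by (simp add: y_def)
    \<comment> \<open>Quadratic decay is enough: one factor of the exponent cancels against the
      coefficient and the other gives a geometric series by lacunarity.\<close>
    have "y\<^sup>2 / 2 \<le> exp y" using exp_lower_Taylor_quadratic[of y] y by simp
    then have "exp (- y) \<le> 2 / y\<^sup>2" using y by (simp add: exp_minus field_simps)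
    moreover have "s powr \<Lambda> n = exp (- y)"
      using assms False unfolding powr_def y_def \<tau>_def by simp
    ultimately have "\<Lambda> n * s powr \<Lambda> n \<le> \<Lambda> n * (2 / y\<^sup>2)"
      using pos[of n] by (metis mult_left_mono less_imp_le)
    also have "\<dots> = 2 / \<tau>\<^sup>2 * (1 / \<Lambda> n)"
      using pos[of n] \<tau> unfolding y_def by (simp add: power2_eq_square field_simps)
    also have "\<dots> \<le> 2 / \<tau>\<^sup>2 * ((\<theta>\<^sup>2) ^ n / \<Lambda> 0)"
    proof (intro mult_left_mono)
      show "1 / \<Lambda> n \<le> (\<theta>\<^sup>2) ^ n / \<Lambda> 0"
        using exps.decay[OF le0, of n, unfolded power_mult diff_zero] pos[of 0] pos[of n]
        by (simp add: divide_simps mult.commute)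
    qed simp
    finally show "norm (\<Lambda> n * s powr \<Lambda> n) \<le> 2 / (\<tau>\<^sup>2 * \<Lambda> 0) * (\<theta>\<^sup>2) ^ n"
      using pos[of n] by (simp add: abs_mult)
  qed
qed simp

lemma summable_of_coeff_bound:
  fixes a :: "nat \<Rightarrow> 'a :: {real_normed_algebra_1, banach}"
  assumes "0 \<le> s" "s < (1::real)" and a: "\<And>n. norm (a n) \<le> C * \<Lambda> n"
  shows "summable (\<lambda>n. norm (a n * of_real (s powr \<Lambda> n)))" "summable (\<lambda>n. a n * of_real (s powr \<Lambda> n))"
proof -
  show 1: "summable (\<lambda>n. norm (a n * of_real (s powr \<Lambda> n)))"
  proof (rule summable_comparison_test[OF _ summable_mult[OF summable_exponent_powr[OF assms(1,2)], of C]], intro exI allI impI)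
    fix n
    have "norm (a n * of_real (s powr \<Lambda> n)) \<le> norm (a n) * s powr \<Lambda> n"
      by (rule order_trans[OF norm_mult_ineq]) simp
    also have "\<dots> \<le> C * \<Lambda> n * s powr \<Lambda> n" using a by (intro mult_right_mono) auto
    finally show "norm (norm (a n * of_real (s powr \<Lambda> n))) \<le> C * (\<Lambda> n * s powr \<Lambda> n)" by (simp add: mult_ac)
  qed
  show "summable (\<lambda>n. a n * of_real (s powr \<Lambda> n))" by (rule summable_norm_cancel[OF 1])
qed

lemma sqrt_le_const_mult: "sqrt (\<Lambda> n) \<le> 1 / sqrt (\<Lambda> 0) * \<Lambda> n"
proof -
  have "\<Lambda> 0 \<le> \<Lambda> n" using exps.less[of 0 n] by (cases "n = 0") auto
  then have "sqrt (\<Lambda> 0) * sqrt (\<Lambda> n) \<le> sqrt (\<Lambda> n) * sqrt (\<Lambda> n)" using pos[of n] by (intro mult_right_mono) auto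
  then show ?thesis using pos[of 0] pos[of n] by (simp add: field_simps)
qed

lemma shift_le: "\<Lambda> n + 1/2 \<le> (1 + 1 / (2 * \<Lambda> 0)) * \<Lambda> n"
proof -
  have "\<Lambda> 0 \<le> \<Lambda> n" using exps.less[of 0 n] by (cases "n = 0") auto
  then show ?thesis using pos[of 0] by (simp add: field_simps)
qed

text \<open>Exactly the predicate under the definite description in \<open>muntz_coeffs\<close>,
  which can be evaluated once existence and uniqueness are known.\<close>

definition represents :: "(nat \<Rightarrow> complex) \<Rightarrow> (real \<Rightarrow> complex) \<Rightarrow> bool" where
  "represents a f \<longleftrightarrow> (\<forall>x\<in>{0..<1}. summable (\<lambda>n. a n * complex_of_real (x powr \<Lambda> n))) \<and>
     (AE x in leb01. f x = (\<Sum>n. a n * complex_of_real (x powr \<Lambda> n)))"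

lemma AE_leb01_less_1: "AE x in leb01. x \<in> {0..<1}"
proof -
  have "AE x in lebesgue. x \<noteq> (1::real)"
    by (intro AE_I[of _ _ "{1}"]) auto
  then show ?thesis by (simp add: AE_restrict_space_iff) (auto elim: eventually_mono)
qed

text \<open>Convergence at 3/4 bounds the terms there, and 1/2 = (3/4)(2/3) leaves a summable factor
  at 2/3.\<close>

lemma summable_norm_at_half:
  assumes "\<forall>x\<in>{0..<1}. summable (\<lambda>n. a n * complex_of_real (x powr \<Lambda> n))"
  shows "summable (\<lambda>n. cmod (a n) * (1/2) powr \<Lambda> n)"
proof -
  have "summable (\<lambda>n. a n * complex_of_real ((3/4) powr \<Lambda> n))" using assms by auto
  then obtain B where B: "\<And>n. cmod (a n * complex_of_real ((3/4) powr \<Lambda> n)) \<le> B"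
    using summable_imp_Bseq[THEN BseqE] by blast
  have "summable (\<lambda>n. B * (2/3) powr \<Lambda> n)"
  proof -
    have "norm (B :: real) \<le> \<bar>B\<bar> / \<Lambda> 0 * \<Lambda> n" for n
    proof -
      have "\<Lambda> 0 \<le> \<Lambda> n" using exps.less[of 0 n] by (cases "n = 0") auto
      then have "\<bar>B\<bar> * \<Lambda> 0 \<le> \<bar>B\<bar> * \<Lambda> n" by (intro mult_left_mono) auto
      then show ?thesis using pos[of 0] by (simp add: field_simps)
    qed
    then show ?thesis using summable_of_coeff_bound(2)[of "2/3" "\<lambda>_. B" "\<bar>B\<bar> / \<Lambda> 0"] by simp
  qed
  then show ?thesis
  proof (rule summable_comparison_test[rotated], intro exI allI impI)
    fix n
    have "(1/2) powr \<Lambda> n = (3/4) powr \<Lambda> n * (2/3::real) powr \<Lambda> n" by (simp add: powr_mult[symmetric])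
    then have "cmod (a n) * (1/2) powr \<Lambda> n = cmod (a n * complex_of_real ((3/4) powr \<Lambda> n)) * (2/3) powr \<Lambda> n"
      by (simp add: norm_mult)
    also have "\<dots> \<le> B * (2/3) powr \<Lambda> n" using B by (intro mult_right_mono) auto
    finally show "norm (cmod (a n) * (1/2) powr \<Lambda> n) \<le> B * (2/3) powr \<Lambda> n" by simp
  qed
qed

text \<open>A direct identity theorem: once the lower coefficients vanish, dividing by the power
  with exponent \<open>\<Lambda> n\<close> at a zero \<open>t\<close> of the sum shows that
  \<open>a n\<close> is of order \<open>t powr \<delta>\<close>, with \<open>\<delta>\<close> the
  gap to the next exponent. Such zeros exist arbitrarily close to 0.\<close>

lemma represents_zero:
  assumes "represents a (\<lambda>x. 0)"
  shows "a n = 0"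
proof (induction n rule: less_induct)
  case (less n)
  have sm: "summable (\<lambda>n. a n * complex_of_real (x powr \<Lambda> n))" if "x \<in> {0..<1}" for x
    using assms that unfolding represents_def by auto
  have half: "summable (\<lambda>n. cmod (a n) * (1/2) powr \<Lambda> n)"
    using assms unfolding represents_def by (intro summable_norm_at_half) auto
  define \<delta> where "\<delta> = \<Lambda> (Suc n) - \<Lambda> n"
  have \<delta>: "\<delta> > 0" unfolding \<delta>_def using exps.less[of n "Suc n"] by simp
  \<comment> \<open>The absolute tail at 1/2, rescaled: for \<open>t\<close> at most 1/2 the powers
    beyond exponent \<open>\<Lambda> (Suc n)\<close> are compared with those of 1/2.\<close>
  define C where "C = (\<Sum>k. cmod (a (k + Suc n)) * (1/2) powr \<Lambda> (k + Suc n)) * 2 powr \<Lambda> (Suc n)"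
  have bound: "cmod (a n) \<le> t powr \<delta> * C"
    if t: "0 < t" "t \<le> 1/2" and z: "(\<Sum>n. a n * complex_of_real (t powr \<Lambda> n)) = 0" for t
  proof -
    have smt: "summable (\<lambda>k. a k * complex_of_real (t powr \<Lambda> k))" using sm t by auto
    have "(\<Sum>k. a (k + Suc n) * complex_of_real (t powr \<Lambda> (k + Suc n))) = - (a n * complex_of_real (t powr \<Lambda> n))"
      using suminf_split_initial_segment[OF smt, of "Suc n"] z less
      by (simp add: eq_neg_iff_add_eq_0 add.commute)
    then have "cmod (a n) * t powr \<Lambda> n = cmod (\<Sum>k. a (k + Suc n) * complex_of_real (t powr \<Lambda> (k + Suc n)))"
      by (simp add: norm_mult)
    also have "\<dots> \<le> (\<Sum>k. t powr \<Lambda> (Suc n) * 2 powr \<Lambda> (Suc n) * (cmod (a (k + Suc n)) * (1/2) powr \<Lambda> (k + Suc n)))"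
    proof (rule norm_suminf_le)
      show "summable (\<lambda>k. t powr \<Lambda> (Suc n) * 2 powr \<Lambda> (Suc n) * (cmod (a (k + Suc n)) * (1/2) powr \<Lambda> (k + Suc n)))"
        by (intro summable_mult summable_ignore_initial_segment[OF half])
      fix k
      have le: "0 \<le> \<Lambda> (k + Suc n) - \<Lambda> (Suc n)" using exps.less[of "Suc n" "k + Suc n"] by (cases k) auto
      have "t powr \<Lambda> (k + Suc n) = t powr \<Lambda> (Suc n) * t powr (\<Lambda> (k + Suc n) - \<Lambda> (Suc n))"
        using t by (simp add: powr_add[symmetric])
      also have "\<dots> \<le> t powr \<Lambda> (Suc n) * (1/2) powr (\<Lambda> (k + Suc n) - \<Lambda> (Suc n))"
        using t le by (intro mult_left_mono powr_mono2) auto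
      also have "(1/2) powr (\<Lambda> (k + Suc n) - \<Lambda> (Suc n)) = 2 powr \<Lambda> (Suc n) * (1/2::real) powr \<Lambda> (k + Suc n)"
        by (simp add: powr_diff powr_divide)
      finally have "cmod (a (k + Suc n)) * t powr \<Lambda> (k + Suc n)
          \<le> cmod (a (k + Suc n)) * (t powr \<Lambda> (Suc n) * (2 powr \<Lambda> (Suc n) * (1/2) powr \<Lambda> (k + Suc n)))"
        by (intro mult_left_mono) auto
      then show "norm (a (k + Suc n) * complex_of_real (t powr \<Lambda> (k + Suc n))) \<le>
        t powr \<Lambda> (Suc n) * 2 powr \<Lambda> (Suc n) * (cmod (a (k + Suc n)) * (1/2) powr \<Lambda> (k + Suc n))"
        by (simp add: norm_mult mult_ac)
    qed
    also have "\<dots> = t powr \<Lambda> (Suc n) * C"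
      unfolding C_def
      by (subst suminf_mult[OF summable_ignore_initial_segment[OF half, of "Suc n"]]) (simp add: mult_ac)
    also have "t powr \<Lambda> (Suc n) = t powr \<delta> * t powr \<Lambda> n"
      using t by (simp add: \<delta>_def powr_add[symmetric])
    finally have "cmod (a n) * t powr \<Lambda> n \<le> (t powr \<delta> * C) * t powr \<Lambda> n" by (simp add: mult_ac)
    then show ?thesis using t by simp
  qed
  \<comment> \<open>The sum vanishes almost everywhere, and an interval at 0 has positive
    measure.\<close>
  have ex: "\<exists>t. 0 < t \<and> t < e \<and> t \<le> 1/2 \<and> (\<Sum>n. a n * complex_of_real (t powr \<Lambda> n)) = 0" if "e > 0" for e
  proof (rule ccontr)
    assume no: "\<nexists>t. 0 < t \<and> t < e \<and> t \<le> 1/2 \<and> (\<Sum>n. a n * complex_of_real (t powr \<Lambda> n)) = 0"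
    define d where "d = min e (1/2)"
    have d: "d > 0" "d \<le> 1/2" "d \<le> e" using that by (auto simp: d_def)
    have "AE x in leb01. 0 = (\<Sum>n. a n * complex_of_real (x powr \<Lambda> n))"
      using assms unfolding represents_def by auto
    then have "AE x in lebesgue. x \<in> {0..1} \<longrightarrow> 0 = (\<Sum>n. a n * complex_of_real (x powr \<Lambda> n))"
      by (simp add: AE_restrict_space_iff)
    then have "AE x in lebesgue. x \<notin> {0<..<d}"
    proof (rule eventually_mono)
      fix x :: real
      assume "x \<in> {0..1} \<longrightarrow> 0 = (\<Sum>n. a n * complex_of_real (x powr \<Lambda> n))"
      then show "x \<notin> {0<..<d}" using no d
        by force
    qed
    then have "emeasure lebesgue {0<..<d} = 0"
      by (subst (asm) AE_iff_measurable[of "{0<..<d}"]) auto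
    then show False using d by simp
  qed
  have C: "C \<ge> 0" unfolding C_def using half
    by (intro mult_nonneg_nonneg suminf_nonneg summable_ignore_initial_segment[OF half]) auto
  have "cmod (a n) \<le> e" if e: "e > 0" for e
  proof -
    have "((\<lambda>t. t powr \<delta> * C) \<longlongrightarrow> 0 powr \<delta> * C) (at_right 0)"
      using \<delta> by (intro tendsto_intros tendsto_powr') (auto simp: eventually_at_filter)
    then have "eventually (\<lambda>t. t powr \<delta> * C < e) (at_right 0)"
      using e \<delta> by (intro order_tendstoD) auto
    then obtain b where b: "b > 0" "\<And>t. 0 < t \<Longrightarrow> t < b \<Longrightarrow> t powr \<delta> * C < e"
      unfolding eventually_at_right_field by auto
    obtain t where "0 < t" "t < b" "t \<le> 1/2" "(\<Sum>n. a n * complex_of_real (t powr \<Lambda> n)) = 0"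
      using ex[OF b(1)] by auto
    then show ?thesis using bound[of t] b(2)[of t] by simp
  qed
  then have "cmod (a n) \<le> 0" by (rule field_le_epsilon[of _ 0, simplified])
  then show ?case by simp
qed

lemma represents_lin:
  assumes a: "represents a f" and b: "represents b g"
  shows "represents (\<lambda>n. c * a n + b n) (\<lambda>x. c * f x + g x)"
    and "x \<in> {0..<1} \<Longrightarrow> (\<Sum>n. (c * a n + b n) * complex_of_real (x powr \<Lambda> n))
      = c * (\<Sum>n. a n * complex_of_real (x powr \<Lambda> n)) + (\<Sum>n. b n * complex_of_real (x powr \<Lambda> n))"
proof -
  have eq: "summable (\<lambda>n. (c * a n + b n) * complex_of_real (x powr \<Lambda> n)) \<and>
     (\<Sum>n. (c * a n + b n) * complex_of_real (x powr \<Lambda> n))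
      = c * (\<Sum>n. a n * complex_of_real (x powr \<Lambda> n)) + (\<Sum>n. b n * complex_of_real (x powr \<Lambda> n))"
    if "x \<in> {0..<1}" for x
  proof -
    have "(\<lambda>n. a n * complex_of_real (x powr \<Lambda> n)) sums (\<Sum>n. a n * complex_of_real (x powr \<Lambda> n))"
         "(\<lambda>n. b n * complex_of_real (x powr \<Lambda> n)) sums (\<Sum>n. b n * complex_of_real (x powr \<Lambda> n))"
      using a b that unfolding represents_def by (auto intro: summable_sums)
    from sums_add[OF sums_mult[OF this(1), of c] this(2)] show ?thesis
      by (auto simp: sums_iff algebra_simps)
  qed
  then show "x \<in> {0..<1} \<Longrightarrow> (\<Sum>n. (c * a n + b n) * complex_of_real (x powr \<Lambda> n))
      = c * (\<Sum>n. a n * complex_of_real (x powr \<Lambda> n)) + (\<Sum>n. b n * complex_of_real (x powr \<Lambda> n))"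
    by auto
  have "AE x in leb01. f x = (\<Sum>n. a n * complex_of_real (x powr \<Lambda> n))"
       "AE x in leb01. g x = (\<Sum>n. b n * complex_of_real (x powr \<Lambda> n))"
    using a b unfolding represents_def by auto
  then have "AE x in leb01. c * f x + g x = (\<Sum>n. (c * a n + b n) * complex_of_real (x powr \<Lambda> n))"
    using AE_leb01_less_1 by eventually_elim (use eq in auto)
  then show "represents (\<lambda>n. c * a n + b n) (\<lambda>x. c * f x + g x)"
    unfolding represents_def using eq by auto
qed

lemma represents_unique:
  assumes "represents a f" "represents b f"
  shows "a = b"
proof
  fix n
  have "represents (\<lambda>n. - 1 * a n + b n) (\<lambda>x. - 1 * f x + f x)"
    by (rule represents_lin(1)[OF assms])
  then have "- 1 * a n + b n = 0" by (intro represents_zero) simp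
  then show "a n = b n" by simp
qed

lemma muntz_coeffs_eq: "represents a f \<Longrightarrow> muntz_coeffs \<Lambda> f = a"
  unfolding muntz_coeffs_def represents_def[symmetric]
  using represents_unique by blast

lemma represents_muntz_poly: "represents (\<lambda>n. if n < N then c n else 0) (muntz_poly N c)"
proof -
  have "(\<lambda>n. (if n < N then c n else 0) * complex_of_real (x powr \<Lambda> n)) sums muntz_poly N c x" for x
    using sums_finite[of "{..<N}" "\<lambda>n. (if n < N then c n else 0) * complex_of_real (x powr \<Lambda> n)"]
    by (simp add: muntz_poly_def)
  then show ?thesis unfolding represents_def by (auto simp: sums_iff)
qed

lemma muntz_embedding_poly: "muntz_embedding \<Lambda> (muntz_poly N c) x = muntz_poly N c x"
proof -
  have "(\<lambda>n. (if n < N then c n else 0) * complex_of_real (x powr \<Lambda> n)) sums muntz_poly N c x"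
    using sums_finite[of "{..<N}" "\<lambda>n. (if n < N then c n else 0) * complex_of_real (x powr \<Lambda> n)"]
    by (simp add: muntz_poly_def)
  then show ?thesis
    unfolding muntz_embedding_def muntz_coeffs_eq[OF represents_muntz_poly] by (simp add: sums_iff)
qed

lemma muntz_poly_in_space: "muntz_poly N c \<in> muntz_space \<Lambda>"
proof -
  have "muntz_poly N c \<in> L2_space leb01"
    unfolding L2_space_iff L2_sq_muntz_poly by simp
  moreover have "L2_norm leb01 (\<lambda>t. muntz_poly N c t - (\<Sum>n<N. c n * complex_of_real (t powr \<Lambda> n))) = 0"
    unfolding muntz_poly_def L2_norm_def by simp
  ultimately show ?thesis unfolding muntz_space_def by (auto simp: ennreal_zero_less_top intro!: exI[of _ N] exI[of _ c])
qed

end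

section \<open>Sequence norms and decreasing rearrangement\<close>

lemma lq_norm_injection_le:
  assumes q: "0 < q" and "0 \<le> c" and inj: "inj \<sigma>" and le: "\<And>n. u n \<le> ennreal c * v (\<sigma> n)"
  shows "lq_norm q u \<le> ennreal c * lq_norm q v"
proof -
  have fin: "(\<Sum>n<M. epowr (v (\<sigma> n)) q) \<le> (\<Sum>n. epowr (v n) q)" for M
  proof -
    have "(\<Sum>n<M. epowr (v (\<sigma> n)) q) = (\<Sum>n\<in>\<sigma> ` {..<M}. epowr (v n) q)"
      using inj by (subst sum.reindex) (auto intro: inj_on_subset)
    also have "\<dots> \<le> (\<Sum>n. epowr (v n) q)"
      by (intro sum_le_suminf) (auto simp: summableI)
    finally show ?thesis .
  qed
  have "(\<Sum>n. epowr (u n) q) \<le> (\<Sum>n. epowr (ennreal c * v (\<sigma> n)) q)"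
    by (intro suminf_le epowr_mono le q summableI)
  also have "\<dots> = epowr (ennreal c) q * (\<Sum>n. epowr (v (\<sigma> n)) q)"
    unfolding epowr_mult[OF q] by simp
  also have "\<dots> \<le> epowr (ennreal c) q * (\<Sum>n. epowr (v n) q)"
    by (intro mult_left_mono suminf_le_const summableI fin) auto
  finally have "lq_norm q u \<le> epowr (epowr (ennreal c) q * (\<Sum>n. epowr (v n) q)) (1 / q)"
    unfolding lq_norm_def using q by (intro epowr_mono) auto
  also have "\<dots> = ennreal c * lq_norm q v"
    using q unfolding lq_norm_def by (simp add: epowr_mult epowr_epowr)
  finally show ?thesis .
qed

text \<open>Greedy choice: the next index maximises \<open>h\<close> outside the finitely many
  already chosen. The map need not be surjective, for zero entries may never be reached when
  infinitely many are positive; injectivity is enough for comparing sequence norms.\<close>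

lemma decreasing_injection:
  fixes h :: "nat \<Rightarrow> real"
  assumes "h \<longlonglongrightarrow> 0" and nonneg: "\<And>n. 0 \<le> h n"
  shows "\<exists>\<sigma> :: nat \<Rightarrow> nat. inj \<sigma> \<and> (\<forall>n k. k \<notin> \<sigma> ` {..<n} \<longrightarrow> h k \<le> h (\<sigma> n))"
proof -
  have ex: "\<exists>m. m \<notin> A \<and> (\<forall>k. k \<notin> A \<longrightarrow> h k \<le> h m)" if A: "finite A" for A
  proof (cases "\<exists>k. k \<notin> A \<and> h k > 0")
    case False
    obtain m where "m \<notin> A" using A ex_new_if_finite infinite_UNIV_nat by blast
    then show ?thesis using False nonneg by (meson leI order_trans)
  next
    case True
    then obtain k0 where k0: "k0 \<notin> A" "h k0 > 0" by auto
    \<comment> \<open>Since \<open>h\<close> tends to 0, only finitely many entries reach the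
      positive level \<open>h k0\<close>, so a maximum over the complement of \<open>A\<close> is
      attained.\<close>
    define B where "B = {k. k \<notin> A \<and> h k0 \<le> h k}"
    have "eventually (\<lambda>k. h k < h k0) sequentially"
      using assms(1) k0 by (intro order_tendstoD) auto
    then have "finite {k. \<not> h k < h k0}" by (simp add: cofinite_eq_sequentially[symmetric] eventually_cofinite)
    then have fin: "finite B" unfolding B_def by (rule rev_finite_subset) auto
    have "k0 \<in> B" using k0 by (simp add: B_def)
    then have "Max (h ` B) \<in> h ` B" using fin by (intro Max_in) auto
    then obtain m where m: "m \<in> B" "h m = Max (h ` B)" by auto
    have "h k \<le> h m" if "k \<notin> A" for k
    proof (cases "k \<in> B")
      case True then show ?thesis using fin m by simp
    next
      case False then show ?thesis using that m unfolding B_def by auto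
    qed
    then show ?thesis using m unfolding B_def by auto
  qed
  define m where "m A = (SOME m. m \<notin> A \<and> (\<forall>k. k \<notin> A \<longrightarrow> h k \<le> h m))" for A
  have m: "m A \<notin> A \<and> (\<forall>k. k \<notin> A \<longrightarrow> h k \<le> h (m A))" if "finite A" for A
    unfolding m_def by (rule someI_ex) (rule ex[OF that])
  define A where "A = rec_nat {} (\<lambda>_ S. insert (m S) S)"
  define \<sigma> where "\<sigma> n = m (A n)" for n
  have A: "A n = \<sigma> ` {..<n}" for n
    by (induction n) (auto simp: A_def \<sigma>_def lessThan_Suc)
  have s: "\<sigma> n \<notin> \<sigma> ` {..<n}" "k \<notin> \<sigma> ` {..<n} \<Longrightarrow> h k \<le> h (\<sigma> n)" for n k
    using m[of "A n"] unfolding \<sigma>_def[of n] unfolding A by auto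
  have "inj \<sigma>"
  proof (rule linorder_injI)
    fix i j :: nat assume "i < j"
    then have "\<sigma> i \<in> \<sigma> ` {..<j}" by (intro imageI) simp
    then show "\<sigma> i \<noteq> \<sigma> j" using s(1)[of j] by metis
  qed
  then show ?thesis by (intro exI[of _ \<sigma>] conjI allI impI s(2))
qed

section \<open>Series expansion of the elements of the Muntz space\<close>

context muntz_exponents
begin

text \<open>The Clarkson-Erdos theorem in this setting. The lower Riesz bound makes the coefficients
  of approximating polynomials Cauchy; the limiting series is their pointwise limit on [0,1), and
  Fatou's lemma identifies it with \<open>f\<close> almost everywhere. The factor 2 comes from the
  bound 2|u|^2 + 2|v|^2 for |u + v|^2.\<close>

lemma muntz_space_represents:
  assumes "f \<in> muntz_space \<Lambda>"
  obtains a where "represents a f"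
    "\<And>M. ennreal (coeff_norm M a) \<le> ennreal (2 * shift.riesz_const) * L2_sq leb01 f"
proof -
  define K where "K = shift.riesz_const"
  have K: "K > 0" using shift.riesz_const_pos by (simp add: K_def)
  have f [measurable]: "f \<in> borel_measurable leb01" and fin: "L2_sq leb01 f < top"
    using assms unfolding muntz_space_def L2_space_iff by auto
  define F where "F = enn2real (L2_sq leb01 f)"
  have F: "L2_sq leb01 f = ennreal F" "F \<ge> 0" using fin by (auto simp: F_def)
  define \<epsilon> where "\<epsilon> m = (1 / real (Suc m))\<^sup>2" for m
  have \<epsilon>: "\<epsilon> m > 0" for m by (simp add: \<epsilon>_def)
  have \<epsilon>0: "\<epsilon> \<longlonglongrightarrow> 0"
    unfolding \<epsilon>_def using tendsto_power[OF LIMSEQ_inverse_real_of_nat, of 2] by (simp add: divide_inverse)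
  have "\<forall>m. \<exists>N c. L2_norm leb01 (\<lambda>t. f t - muntz_poly N c t) < ennreal (1 / real (Suc m))"
    using assms unfolding muntz_space_def muntz_poly_def by auto
  then obtain N c where Nc: "\<And>m. L2_norm leb01 (\<lambda>t. f t - muntz_poly (N m) (c m) t) < ennreal (1 / real (Suc m))"
    by metis
  define p where "p m = muntz_poly (N m) (c m)" for m
  have [measurable]: "p m \<in> borel_measurable leb01" for m by (simp add: p_def)
  have fp: "L2_sq leb01 (\<lambda>t. f t - p m t) \<le> ennreal (\<epsilon> m)" for m
    using Nc[of m] unfolding \<epsilon>_def p_def by (subst L2_norm_le_iff_real[symmetric]) (auto intro: less_imp_le)
  then have pf: "L2_sq leb01 (\<lambda>t. p m t - f t) \<le> ennreal (\<epsilon> m)" for m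
    by (simp add: norm_minus_commute)
  \<comment> \<open>Padding by zeros lets polynomials of different lengths be compared coefficient
    by coefficient.\<close>
  define C where "C m n = (if n < N m then c m n else 0)" for m n
  have pC: "muntz_poly L (C m) = p m" if "N m \<le> L" for L m
    unfolding p_def muntz_poly_def C_def
    by (rule ext, rule sum.mono_neutral_cong_right) (use that in auto)
  have diff: "coeff_norm M (\<lambda>n. C m n - C l n) \<le> 2 * K * (\<epsilon> m + \<epsilon> l)" for M m l
  proof -
    define L where "L = max M (max (N m) (N l))"
    have "coeff_norm M (\<lambda>n. C m n - C l n) \<le> coeff_norm L (\<lambda>n. C m n - C l n)"
      unfolding coeff_norm_def L_def using pos by (intro sum_mono2) (auto simp: less_imp_le add_nonneg_nonneg)
    moreover have "ennreal (coeff_norm L (\<lambda>n. C m n - C l n)) \<le> ennreal (2 * K * (\<epsilon> m + \<epsilon> l))"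
    proof -
      have "muntz_poly L (\<lambda>n. C m n - C l n) = (\<lambda>t. (p m t - f t) + (f t - p l t))"
        using pC[of m L] pC[of l L] unfolding muntz_poly_def fun_eq_iff L_def
        by (simp add: sum_subtractf left_diff_distrib)
      then have "L2_sq leb01 (muntz_poly L (\<lambda>n. C m n - C l n))
          \<le> 2 * L2_sq leb01 (\<lambda>t. p m t - f t) + 2 * L2_sq leb01 (\<lambda>t. f t - p l t)"
        by (simp only:) (rule L2_sq_add_le; measurable)
      also have "\<dots> \<le> 2 * ennreal (\<epsilon> m) + 2 * ennreal (\<epsilon> l)"
        by (intro add_mono mult_left_mono pf fp) auto
      also have "\<dots> = ennreal (2 * (\<epsilon> m + \<epsilon> l))"
        using \<epsilon>[of m] \<epsilon>[of l] by (simp add: ennreal_mult distrib_left)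
      finally have "ennreal (coeff_norm L (\<lambda>n. C m n - C l n)) \<le> ennreal K * ennreal (2 * (\<epsilon> m + \<epsilon> l))"
        unfolding K_def by (intro order_trans[OF coeff_norm_le] mult_left_mono) auto
      then show ?thesis using K \<epsilon>[of m] \<epsilon>[of l] by (simp add: ennreal_mult[symmetric] mult_ac del: ennreal_plus)
    qed
    ultimately show ?thesis using K \<epsilon>[of m] \<epsilon>[of l] by (subst (asm) ennreal_le_iff) auto
  qed
  have term_le: "(cmod (b n))\<^sup>2 \<le> (\<Lambda> n + 1/2) * B" if "coeff_norm (Suc n) b \<le> B" for b n B
  proof -
    have "(cmod (b n))\<^sup>2 / (\<Lambda> n + 1/2) \<le> coeff_norm (Suc n) b"
      unfolding coeff_norm_def using pos by (intro member_le_sum) (auto simp: less_imp_le add_nonneg_nonneg)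
    then have "(cmod (b n))\<^sup>2 / (\<Lambda> n + 1/2) \<le> B" using that by simp
    then show ?thesis using pos[of n] by (simp add: divide_le_eq add_pos_pos mult.commute)
  qed
  have "Cauchy (\<lambda>m. C m n)" for n
  proof (rule metric_CauchyI)
    fix e :: real assume e: "e > 0"
    define e' where "e' = e\<^sup>2 / (4 * K * (\<Lambda> n + 1/2))"
    have e': "e' > 0" using e K pos[of n] by (simp add: e'_def add_pos_pos)
    obtain m0 where m0: "\<And>m. m \<ge> m0 \<Longrightarrow> \<epsilon> m < e'"
      using order_tendstoD(2)[OF \<epsilon>0 e'] unfolding eventually_sequentially by auto
    have "dist (C m n) (C l n) < e" if "m \<ge> m0" "l \<ge> m0" for m l
    proof -
      have "(cmod (C m n - C l n))\<^sup>2 \<le> (\<Lambda> n + 1/2) * (2 * K * (\<epsilon> m + \<epsilon> l))"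
        by (rule term_le[OF diff])
      also have "\<dots> < (\<Lambda> n + 1/2) * (2 * K * (e' + e'))"
        using m0[OF that(1)] m0[OF that(2)] K pos[of n] by (intro mult_strict_left_mono) (auto intro: add_pos_pos)
      also have "\<dots> = e\<^sup>2"
      proof -
        have "\<Lambda> n + 1/2 \<noteq> 0" using pos[of n] by simp
        then show ?thesis unfolding e'_def using K by simp
      qed
      finally show ?thesis using e unfolding dist_norm by (metis less_imp_le power_less_imp_less_base)
    qed
    then show "\<exists>M. \<forall>m\<ge>M. \<forall>n'\<ge>M. dist (C m n) (C n' n) < e" by blast
  qed
  then obtain a where a: "\<And>n. (\<lambda>m. C m n) \<longlonglongrightarrow> a n"
    unfolding Cauchy_convergent_iff convergent_def by metis
  have lim1: "coeff_norm M (\<lambda>n. C m n - a n) \<le> 2 * K * \<epsilon> m" for M m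
  proof (rule LIMSEQ_le)
    have nz: "\<Lambda> n + 1/2 \<noteq> 0" for n using pos[of n] by simp
    show "(\<lambda>l. coeff_norm M (\<lambda>n. C m n - C l n)) \<longlonglongrightarrow> coeff_norm M (\<lambda>n. C m n - a n)"
      unfolding coeff_norm_def by (intro tendsto_intros a nz)
    show "(\<lambda>l. 2 * K * (\<epsilon> m + \<epsilon> l)) \<longlonglongrightarrow> 2 * K * \<epsilon> m"
      using tendsto_mult[OF tendsto_const[of "2 * K"] tendsto_add[OF tendsto_const[of "\<epsilon> m"] \<epsilon>0]] by simp
    show "\<exists>N. \<forall>n\<ge>N. coeff_norm M (\<lambda>na. C m na - C n na) \<le> 2 * K * (\<epsilon> m + \<epsilon> n)" using diff by auto
  qed
  have bnd: "coeff_norm M a \<le> 2 * K * F" for M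
  proof (rule LIMSEQ_le)
    have nz: "\<Lambda> n + 1/2 \<noteq> 0" for n using pos[of n] by simp
    show "(\<lambda>m. coeff_norm M (C m)) \<longlonglongrightarrow> coeff_norm M a"
      unfolding coeff_norm_def by (intro tendsto_intros a nz)
    show "(\<lambda>m. K * (2 * F + 2 * \<epsilon> m)) \<longlonglongrightarrow> 2 * K * F"
      using tendsto_mult[OF tendsto_const[of K] tendsto_add[OF tendsto_const[of "2 * F"] tendsto_mult[OF tendsto_const[of 2] \<epsilon>0]]]
      by (simp add: mult_ac)
    have "coeff_norm M (C m) \<le> K * (2 * F + 2 * \<epsilon> m)" for m
    proof -
      define L where "L = max M (N m)"
      have "coeff_norm M (C m) \<le> coeff_norm L (C m)"
        unfolding coeff_norm_def L_def using pos by (intro sum_mono2) (auto simp: less_imp_le add_nonneg_nonneg)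
      moreover have "ennreal (coeff_norm L (C m)) \<le> ennreal (K * (2 * F + 2 * \<epsilon> m))"
      proof -
        have "muntz_poly L (C m) = (\<lambda>t. f t + (p m t - f t))" using pC[of m L] by (simp add: L_def)
        then have "L2_sq leb01 (muntz_poly L (C m)) \<le> 2 * L2_sq leb01 f + 2 * L2_sq leb01 (\<lambda>t. p m t - f t)"
          by (simp only:) (rule L2_sq_add_le; measurable)
        also have "\<dots> \<le> 2 * ennreal F + 2 * ennreal (\<epsilon> m)"
          unfolding F(1) by (intro add_mono mult_left_mono pf order_refl) auto
        also have "\<dots> = ennreal (2 * F + 2 * \<epsilon> m)"
          using \<epsilon>[of m] F by (simp add: ennreal_mult)
        finally have "ennreal (coeff_norm L (C m)) \<le> ennreal K * ennreal (2 * F + 2 * \<epsilon> m)"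
          unfolding K_def by (intro order_trans[OF coeff_norm_le] mult_left_mono) auto
        then show ?thesis using K F \<epsilon>[of m] by (simp add: ennreal_mult[symmetric] del: ennreal_plus)
      qed
      ultimately show ?thesis using K F \<epsilon>[of m] by (subst (asm) ennreal_le_iff) auto
    qed
    then show "\<exists>N. \<forall>n\<ge>N. coeff_norm M (C n) \<le> K * (2 * F + 2 * \<epsilon> n)" by auto
  qed
  have coeff_bound: "\<exists>B. \<forall>n. cmod (b n) \<le> B * \<Lambda> n" if b: "\<And>M. coeff_norm M b \<le> A" for b A
  proof -
    have A: "A \<ge> 0" using b[of 0] by (simp add: coeff_norm_def)
    have "cmod (b n) \<le> sqrt (A * (1 + 1 / (2 * \<Lambda> 0))) * (1 / sqrt (\<Lambda> 0)) * \<Lambda> n" for n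
    proof -
      have "(cmod (b n))\<^sup>2 \<le> (\<Lambda> n + 1/2) * A" by (rule term_le[OF b])
      also have "\<dots> \<le> (1 + 1 / (2 * \<Lambda> 0)) * \<Lambda> n * A" using A by (intro mult_right_mono shift_le)
      finally have "cmod (b n) \<le> sqrt (A * (1 + 1 / (2 * \<Lambda> 0)) * \<Lambda> n)"
        by (intro real_le_rsqrt) (simp add: mult_ac)
      also have "\<dots> = sqrt (A * (1 + 1 / (2 * \<Lambda> 0))) * sqrt (\<Lambda> n)" by (simp add: real_sqrt_mult)
      also have "\<dots> \<le> sqrt (A * (1 + 1 / (2 * \<Lambda> 0))) * (1 / sqrt (\<Lambda> 0) * \<Lambda> n)"
        using A pos[of 0] by (intro mult_left_mono sqrt_le_const_mult) auto
      finally show ?thesis by (simp add: mult_ac)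
    qed
    then show ?thesis by blast
  qed
  obtain B where B: "\<And>n. cmod (a n) \<le> B * \<Lambda> n" using coeff_bound[OF bnd] by auto
  have sm: "summable (\<lambda>n. a n * complex_of_real (x powr \<Lambda> n))" if "x \<in> {0..<1}" for x
    using summable_of_coeff_bound(2)[of x a B] B that by auto
  define g where "g x = (\<Sum>n. a n * complex_of_real (x powr \<Lambda> n))" for x
  have ptw: "(\<lambda>m. p m x) \<longlonglongrightarrow> g x" if x: "x \<in> {0..<1}" for x
  proof -
    \<comment> \<open>Chosen so that \<open>\<Lambda> n + 1/2\<close> is at most \<open>Q\<close>
      times the square of \<open>\<Lambda> n\<close>. This weakens square-root growth of the
      coefficient errors to linear growth, which the series of
      \<open>\<Lambda> n * x powr \<Lambda> n\<close> absorbs.\<close>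
    define Q where "Q = (1 + 1 / (2 * \<Lambda> 0)) / \<Lambda> 0"
    have Q: "Q > 0" using pos[of 0] by (simp add: Q_def add_pos_pos)
    define S where "S = (\<Sum>n. \<Lambda> n * x powr \<Lambda> n)"
    have smS: "summable (\<lambda>n. \<Lambda> n * x powr \<Lambda> n)" using summable_exponent_powr[of x] x by simp
    have "cmod (p m x - g x) \<le> sqrt (2 * K * \<epsilon> m * Q) * S" for m
    proof -
      have le: "cmod (C m n - a n) \<le> sqrt (2 * K * \<epsilon> m * Q) * \<Lambda> n" for n
      proof -
        have "(cmod (C m n - a n))\<^sup>2 \<le> (\<Lambda> n + 1/2) * (2 * K * \<epsilon> m)" by (rule term_le[OF lim1])
        also have "\<dots> \<le> (1 + 1 / (2 * \<Lambda> 0)) * \<Lambda> n * (2 * K * \<epsilon> m)"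
          using K \<epsilon>[of m] by (intro mult_right_mono shift_le) auto
        also have "\<dots> \<le> (1 + 1 / (2 * \<Lambda> 0)) * (\<Lambda> n * (\<Lambda> n / \<Lambda> 0)) * (2 * K * \<epsilon> m)"
        proof -
          have "\<Lambda> 0 \<le> \<Lambda> n" using exps.less[of 0 n] by (cases "n = 0") auto
          then have "\<Lambda> n * 1 \<le> \<Lambda> n * (\<Lambda> n / \<Lambda> 0)" using pos[of 0] pos[of n] by (intro mult_left_mono) auto
          then show ?thesis using K \<epsilon>[of m] pos[of 0] by (intro mult_right_mono mult_left_mono) auto
        qed
        also have "\<dots> = (2 * K * \<epsilon> m * Q) * (\<Lambda> n)\<^sup>2" unfolding Q_def by (simp add: power2_eq_square)
        finally have "cmod (C m n - a n) \<le> sqrt ((2 * K * \<epsilon> m * Q) * (\<Lambda> n)\<^sup>2)" by (rule real_le_rsqrt)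
        then show ?thesis using pos[of n] by (simp add: real_sqrt_mult)
      qed
      have "(\<lambda>n. C m n * complex_of_real (x powr \<Lambda> n)) sums p m x"
        using sums_finite[of "{..<N m}" "\<lambda>n. C m n * complex_of_real (x powr \<Lambda> n)"]
        unfolding pC[OF order_refl, symmetric] by (simp add: muntz_poly_def C_def)
      moreover have "(\<lambda>n. a n * complex_of_real (x powr \<Lambda> n)) sums g x"
        unfolding g_def by (rule summable_sums[OF sm[OF x]])
      ultimately have "(\<lambda>n. C m n * complex_of_real (x powr \<Lambda> n) - a n * complex_of_real (x powr \<Lambda> n)) sums (p m x - g x)"
        by (rule sums_diff)
      then have eq: "p m x - g x = (\<Sum>n. (C m n - a n) * complex_of_real (x powr \<Lambda> n))"
        by (simp add: sums_iff left_diff_distrib)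
      have "cmod (p m x - g x) \<le> (\<Sum>n. sqrt (2 * K * \<epsilon> m * Q) * (\<Lambda> n * x powr \<Lambda> n))"
        unfolding eq
      proof (rule norm_suminf_le)
        fix n
        have "cmod (C m n - a n) * x powr \<Lambda> n \<le> sqrt (2 * K * \<epsilon> m * Q) * \<Lambda> n * x powr \<Lambda> n"
          by (intro mult_right_mono le) auto
        then show "norm ((C m n - a n) * complex_of_real (x powr \<Lambda> n)) \<le> sqrt (2 * K * \<epsilon> m * Q) * (\<Lambda> n * x powr \<Lambda> n)"
          by (simp add: norm_mult mult_ac)
      qed (intro summable_mult smS)
      then show ?thesis unfolding S_def by (simp add: suminf_mult[OF smS])
    qed
    moreover have "(\<lambda>m. sqrt (2 * K * \<epsilon> m * Q) * S) \<longlonglongrightarrow> 0"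
    proof -
      have "(\<lambda>m. sqrt (2 * K * \<epsilon> m * Q) * S) \<longlonglongrightarrow> sqrt (2 * K * 0 * Q) * S" by (intro tendsto_intros \<epsilon>0)
      then show ?thesis by simp
    qed
    ultimately have "(\<lambda>m. p m x - g x) \<longlonglongrightarrow> 0"
      by (intro Lim_null_comparison[of "\<lambda>m. p m x - g x"]) auto
    then show ?thesis by (simp add: LIM_zero_iff)
  qed
  \<comment> \<open>Fatou's lemma: the squared L2 distances tend to 0, so the pointwise lower limit
    vanishes almost everywhere.\<close>
  have "(\<integral>\<^sup>+ x. liminf (\<lambda>m. ennreal ((cmod (f x - p m x))\<^sup>2)) \<partial>leb01) \<le> liminf (\<lambda>m. ennreal (\<epsilon> m))"
    by (intro order_trans[OF nn_integral_liminf] Liminf_mono always_eventually allI fp) measurable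
  also have "liminf (\<lambda>m. ennreal (\<epsilon> m)) = 0"
    using tendsto_ennrealI[OF \<epsilon>0] by (intro lim_imp_Liminf) auto
  finally have "(\<integral>\<^sup>+ x. liminf (\<lambda>m. ennreal ((cmod (f x - p m x))\<^sup>2)) \<partial>leb01) = 0" by simp
  then have "AE x in leb01. liminf (\<lambda>m. ennreal ((cmod (f x - p m x))\<^sup>2)) = 0"
    by (subst (asm) nn_integral_0_iff_AE) measurable
  then have "AE x in leb01. f x = g x"
    using AE_leb01_less_1
  proof eventually_elim
    fix x assume "liminf (\<lambda>m. ennreal ((cmod (f x - p m x))\<^sup>2)) = 0" "x \<in> {0..<1::real}"
    moreover have "liminf (\<lambda>m. ennreal ((cmod (f x - p m x))\<^sup>2)) = ennreal ((cmod (f x - g x))\<^sup>2)"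
      using ptw \<open>x \<in> {0..<1}\<close> by (intro lim_imp_Liminf tendsto_ennrealI tendsto_intros) auto
    ultimately show "f x = g x" by simp
  qed
  then have "represents a f" unfolding represents_def g_def using sm by auto
  moreover have "ennreal (coeff_norm M a) \<le> ennreal (2 * shift.riesz_const) * L2_sq leb01 f" for M
    unfolding F(1) K_def[symmetric] using bnd[of M] K F by (simp add: ennreal_mult[symmetric] ennreal_leI)
  ultimately show ?thesis using that by blast
qed

end

section \<open>Truncated embeddings\<close>

definition D2_integral :: "(nat \<Rightarrow> real) \<Rightarrow> real measure \<Rightarrow> nat \<Rightarrow> ennreal" where
  "D2_integral \<Lambda> \<mu> n = (\<integral>\<^sup>+ t. ennreal (\<Lambda> n powr (1/2) * t powr \<Lambda> n) *
                   (\<Sum>k. ennreal (\<Lambda> k powr (1/2) * t powr \<Lambda> k)) \<partial>\<mu>)"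

lemma epowr_D2: "epowr (D2 \<Lambda> \<mu> n) p = epowr (D2_integral \<Lambda> \<mu> n) (p / 2)"
  unfolding D2_def D2_integral_def epowr_epowr by simp

context
  fixes \<mu> :: "real measure"
  assumes \<mu>: "finite_measure_on_01 \<mu>"
begin

lemma sets_01: "sets \<mu> = sets (restrict_space borel {0..<1::real})"
  using \<mu> unfolding finite_measure_on_01_def by simp

lemma space_01: "space \<mu> = {0..<1}"
  using sets_eq_imp_space_eq[OF sets_01] by (simp add: space_restrict_space)

lemma borel_measurable_01:
  "f \<in> borel_measurable borel \<Longrightarrow> f \<in> borel_measurable \<mu>"
  by (subst measurable_cong_sets[OF sets_01 refl]) (rule measurable_restrict_space1)

end

lemma sum_sq_le_suminf_ennreal:
  fixes u v :: "nat \<Rightarrow> real"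
  shows "ennreal ((\<Sum>n<M. u n * v n)\<^sup>2) \<le> (\<Sum>n. ennreal ((u n)\<^sup>2)) * (\<Sum>n. ennreal ((v n)\<^sup>2))"
proof -
  have "ennreal ((\<Sum>n<M. u n * v n)\<^sup>2) \<le> ennreal ((\<Sum>n<M. (u n)\<^sup>2) * (\<Sum>n<M. (v n)\<^sup>2))"
    by (intro ennreal_leI Cauchy_Schwarz_ineq_sum)
  also have "\<dots> = (\<Sum>n<M. ennreal ((u n)\<^sup>2)) * (\<Sum>n<M. ennreal ((v n)\<^sup>2))"
    by (simp add: ennreal_mult sum_nonneg sum_ennreal)
  also have "\<dots> \<le> (\<Sum>n. ennreal ((u n)\<^sup>2)) * (\<Sum>n. ennreal ((v n)\<^sup>2))"
    by (intro mult_mono sum_le_suminf) (auto simp: summableI)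
  finally show ?thesis .
qed

context muntz_exponents
begin

definition trunc_series :: "nat set \<Rightarrow> (nat \<Rightarrow> complex) \<Rightarrow> real \<Rightarrow> complex" where
  "trunc_series K a x = (\<Sum>n. (if n \<in> K then a n else 0) * complex_of_real (x powr \<Lambda> n))"

lemma borel_measurable_trunc_series [measurable]: "trunc_series K a \<in> borel_measurable borel"
  unfolding trunc_series_def by measurable

lemma D2_integral_sqrt:
  "D2_integral \<Lambda> \<mu> n = (\<integral>\<^sup>+ t. ennreal (sqrt (\<Lambda> n) * t powr \<Lambda> n) * (\<Sum>k. ennreal (sqrt (\<Lambda> k) * t powr \<Lambda> k)) \<partial>\<mu>)"
  unfolding D2_integral_def using pos by (simp add: powr_half_sqrt less_imp_le)

lemma coeff_growth:
  assumes "\<And>M. (\<Sum>n<M. (cmod (a n))\<^sup>2 / \<Lambda> n) \<le> A"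
  shows "cmod (a n) \<le> sqrt A * (1 / sqrt (\<Lambda> 0)) * \<Lambda> n"
proof -
  have "(cmod (a n))\<^sup>2 / \<Lambda> n \<le> (\<Sum>n<Suc n. (cmod (a n))\<^sup>2 / \<Lambda> n)"
    using pos by (intro member_le_sum) (auto simp: less_imp_le)
  also have "\<dots> \<le> A" by (rule assms)
  finally have "(cmod (a n))\<^sup>2 \<le> A * \<Lambda> n" using pos[of n] by (simp add: field_simps)
  then have "cmod (a n) \<le> sqrt (A * \<Lambda> n)" by (rule real_le_rsqrt)
  also have "\<dots> = sqrt A * sqrt (\<Lambda> n)" by (simp add: real_sqrt_mult)
  also have "\<dots> \<le> sqrt A * (1 / sqrt (\<Lambda> 0) * \<Lambda> n)"
    using assms[of 0] by (intro mult_left_mono sqrt_le_const_mult) auto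
  finally show ?thesis by (simp add: mult_ac)
qed

text \<open>Each term splits as \<open>sqrt (w n * f n x) * sqrt (f n x)\<close>. Cauchy-Schwarz
  bounds the squared sum by the product of the sums of \<open>w n * f n x\<close> and of
  \<open>f k x\<close>. Integrating the product term by term in \<open>n\<close> produces exactly
  \<open>D2_integral\<close> with weight \<open>w n\<close>, and \<open>w\<close> is supported on
  \<open>K\<close>.\<close>

lemma trunc_series_L2_le:
  assumes \<mu>: "finite_measure_on_01 \<mu>" and "0 \<le> d"
    and D: "\<And>n. n \<in> K \<Longrightarrow> D2 \<Lambda> \<mu> n \<le> ennreal d"
    and A: "\<And>M. (\<Sum>n<M. (cmod (a n))\<^sup>2 / \<Lambda> n) \<le> A"
  shows "L2_sq \<mu> (trunc_series K a) \<le> ennreal (d\<^sup>2 * A)"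
proof -
  define f where "f n t = sqrt (\<Lambda> n) * t powr \<Lambda> n" for n and t :: real
  have f0: "0 \<le> f n t" for n t using pos[of n] by (simp add: f_def)
  have [measurable]: "f n \<in> borel_measurable \<mu>" for n
    unfolding f_def by (intro borel_measurable_01[OF \<mu>]) measurable
  define w where "w n = (if n \<in> K then (cmod (a n))\<^sup>2 / \<Lambda> n else 0)" for n
  have w0: "0 \<le> w n" for n using pos[of n] by (simp add: w_def)
  have A0: "0 \<le> A" using A[of 0] by simp
  have ptw: "ennreal ((cmod (trunc_series K a x))\<^sup>2) \<le> (\<Sum>n. ennreal (w n) * ennreal (f n x)) * (\<Sum>k. ennreal (f k x))"
    if x: "x \<in> {0..<1}" for x
  proof -
    define b where "b n = (if n \<in> K then a n else 0)" for n
    have "cmod (b n) \<le> sqrt A * (1 / sqrt (\<Lambda> 0)) * \<Lambda> n" for n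
      using coeff_growth[OF A, of n] pos[of n] pos[of 0] A0 by (auto simp: b_def)
    then have "summable (\<lambda>n. b n * complex_of_real (x powr \<Lambda> n))"
      using summable_of_coeff_bound(2)[of x b "sqrt A * (1 / sqrt (\<Lambda> 0))"] x by auto
    then have lim: "(\<lambda>M. \<Sum>n<M. b n * complex_of_real (x powr \<Lambda> n)) \<longlonglongrightarrow> trunc_series K a x"
      unfolding trunc_series_def b_def by (rule summable_LIMSEQ)
    \<comment> \<open>The inequality is proved for partial sums, with a bound free of
      \<open>M\<close>, and then passes to the limit.\<close>
    have bnd: "ennreal ((cmod (\<Sum>n<M. b n * complex_of_real (x powr \<Lambda> n)))\<^sup>2)
        \<le> (\<Sum>n. ennreal (w n) * ennreal (f n x)) * (\<Sum>k. ennreal (f k x))" for M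
    proof -
      have term_eq: "cmod (b n * complex_of_real (x powr \<Lambda> n)) = sqrt (w n * f n x) * sqrt (f n x)" for n
      proof -
        have "sqrt (w n * f n x) * sqrt (f n x) = sqrt (w n) * f n x"
          using f0[of n x] by (simp add: real_sqrt_mult)
        also have "sqrt (w n) * f n x = cmod (b n) * x powr \<Lambda> n"
          using pos[of n] unfolding w_def b_def f_def by (simp add: real_sqrt_divide)
        finally show ?thesis by (simp add: norm_mult)
      qed
      have "cmod (\<Sum>n<M. b n * complex_of_real (x powr \<Lambda> n)) \<le> (\<Sum>n<M. sqrt (w n * f n x) * sqrt (f n x))"
        unfolding term_eq[symmetric] by (rule norm_sum)
      then have "ennreal ((cmod (\<Sum>n<M. b n * complex_of_real (x powr \<Lambda> n)))\<^sup>2)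
          \<le> ennreal ((\<Sum>n<M. sqrt (w n * f n x) * sqrt (f n x))\<^sup>2)"
        by (intro ennreal_leI power_mono) auto
      also have "\<dots> \<le> (\<Sum>n. ennreal ((sqrt (w n * f n x))\<^sup>2)) * (\<Sum>n. ennreal ((sqrt (f n x))\<^sup>2))"
        by (rule sum_sq_le_suminf_ennreal)
      finally show ?thesis using f0 w0 by (simp add: ennreal_mult)
    qed
    have lim': "(\<lambda>M. ennreal ((cmod (\<Sum>n<M. b n * complex_of_real (x powr \<Lambda> n)))\<^sup>2)) \<longlonglongrightarrow> ennreal ((cmod (trunc_series K a x))\<^sup>2)"
      by (intro tendsto_ennrealI tendsto_intros lim)
    show ?thesis using LIMSEQ_le_const2[OF lim'] bnd by blast
  qed
  have "L2_sq \<mu> (trunc_series K a) \<le> (\<integral>\<^sup>+ x. (\<Sum>n. ennreal (w n) * (ennreal (f n x) * (\<Sum>k. ennreal (f k x)))) \<partial>\<mu>)"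
  proof (rule nn_integral_mono)
    fix x assume "x \<in> space \<mu>"
    then have "x \<in> {0..<1}" using space_01[OF \<mu>] by simp
    from ptw[OF this] show "ennreal ((cmod (trunc_series K a x))\<^sup>2)
        \<le> (\<Sum>n. ennreal (w n) * (ennreal (f n x) * (\<Sum>k. ennreal (f k x))))"
      by (simp add: mult.assoc[symmetric] ennreal_suminf_multc)
  qed
  also have "\<dots> = (\<Sum>n. ennreal (w n) * D2_integral \<Lambda> \<mu> n)"
    unfolding D2_integral_sqrt f_def[symmetric]
    by (subst nn_integral_suminf) (simp_all add: nn_integral_cmult)
  also have "\<dots> \<le> (\<Sum>n. ennreal (w n) * ennreal (d\<^sup>2))"
  proof (intro suminf_le summableI)
    fix n
    show "ennreal (w n) * D2_integral \<Lambda> \<mu> n \<le> ennreal (w n) * ennreal (d\<^sup>2)"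
    proof (cases "n \<in> K")
      case True
      have "epowr (D2 \<Lambda> \<mu> n) 2 \<le> epowr (ennreal d) 2" using D[OF True] by (simp add: epowr_le_iff)
      then have "D2_integral \<Lambda> \<mu> n \<le> ennreal (d\<^sup>2)" using \<open>0 \<le> d\<close> by (simp add: epowr_D2 epowr_ennreal)
      then show ?thesis by (intro mult_left_mono) auto
    qed (simp add: w_def)
  qed
  also have "\<dots> = ennreal (d\<^sup>2) * (\<Sum>n. ennreal (w n))"
    by (simp add: mult.commute)
  also have "(\<Sum>n. ennreal (w n)) \<le> ennreal A"
  proof (rule suminf_le_const[OF summableI])
    fix M
    have "(\<Sum>n<M. w n) \<le> (\<Sum>n<M. (cmod (a n))\<^sup>2 / \<Lambda> n)"
      using pos by (intro sum_mono) (auto simp: w_def less_imp_le)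
    then show "(\<Sum>n<M. ennreal (w n)) \<le> ennreal A"
      using A[of M] w0 by (simp add: sum_ennreal ennreal_leI)
  qed
  finally show ?thesis using A0 by (simp add: ennreal_mult mult_left_mono)
qed

end

section \<open>Truncations as finite-rank approximants of the embedding\<close>

context muntz_exponents
begin

text \<open>The first factor replaces the weight 1/(\<open>\<Lambda> n\<close> + 1/2) by
  1/\<open>\<Lambda> n\<close>; the second is the coefficient bound of
  \<open>muntz_space_represents\<close>.\<close>

definition embed_const :: real where
  "embed_const = (1 + 1 / (2 * \<Lambda> 0)) * (2 * shift.riesz_const)"

lemma embed_const_pos: "embed_const > 0"
  unfolding embed_const_def using pos[of 0] shift.riesz_const_pos by (intro mult_pos_pos add_pos_pos) auto

lemma muntz_coeffs_represents: "f \<in> muntz_space \<Lambda> \<Longrightarrow> represents (muntz_coeffs \<Lambda> f) f"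
  using muntz_space_represents muntz_coeffs_eq by metis

lemma muntz_space_finite: "f \<in> muntz_space \<Lambda> \<Longrightarrow> L2_sq leb01 f < top"
  unfolding muntz_space_def L2_space_iff by auto

lemma muntz_coeffs_bound:
  assumes "f \<in> muntz_space \<Lambda>"
  shows "(\<Sum>n<M. (cmod (muntz_coeffs \<Lambda> f n))\<^sup>2 / \<Lambda> n) \<le> embed_const * enn2real (L2_sq leb01 f)"
proof -
  define F where "F = enn2real (L2_sq leb01 f)"
  have F: "L2_sq leb01 f = ennreal F" "F \<ge> 0" using muntz_space_finite[OF assms] by (auto simp: F_def)
  obtain a where a: "represents a f"
    "\<And>M. ennreal (coeff_norm M a) \<le> ennreal (2 * shift.riesz_const) * L2_sq leb01 f"
    using muntz_space_represents[OF assms] by blast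
  have "ennreal (coeff_norm M a) \<le> ennreal (2 * shift.riesz_const * F)"
    using a(2)[of M] F shift.riesz_const_pos by (simp add: ennreal_mult)
  then have "coeff_norm M a \<le> 2 * shift.riesz_const * F"
    using F shift.riesz_const_pos by (subst (asm) ennreal_le_iff) auto
  moreover have "(\<Sum>n<M. (cmod (a n))\<^sup>2 / \<Lambda> n) \<le> (1 + 1 / (2 * \<Lambda> 0)) * coeff_norm M a"
    unfolding coeff_norm_def sum_distrib_left
  proof (rule sum_mono)
    fix n
    have "(cmod (a n))\<^sup>2 / \<Lambda> n = (cmod (a n))\<^sup>2 / (\<Lambda> n + 1/2) * ((\<Lambda> n + 1/2) / \<Lambda> n)"
      using pos[of n] by simp
    also have "\<dots> \<le> (cmod (a n))\<^sup>2 / (\<Lambda> n + 1/2) * (1 + 1 / (2 * \<Lambda> 0))"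
      using pos[of n] shift_le[of n] by (intro mult_left_mono) (auto simp: divide_le_eq)
    finally show "(cmod (a n))\<^sup>2 / \<Lambda> n \<le> (1 + 1 / (2 * \<Lambda> 0)) * ((cmod (a n))\<^sup>2 / (\<Lambda> n + 1/2))"
      by (simp add: mult.commute)
  qed
  ultimately have "(\<Sum>n<M. (cmod (a n))\<^sup>2 / \<Lambda> n) \<le> (1 + 1 / (2 * \<Lambda> 0)) * (2 * shift.riesz_const * F)"
    using pos[of 0] by (smt (verit) divide_nonneg_pos mult_left_mono)
  then show ?thesis
    unfolding muntz_coeffs_eq[OF a(1)] F_def[symmetric] embed_const_def by (simp add: mult_ac)
qed

definition trunc_op :: "nat set \<Rightarrow> (real \<Rightarrow> complex) \<Rightarrow> real \<Rightarrow> complex" where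
  "trunc_op K f = trunc_series K (muntz_coeffs \<Lambda> f)"

lemma muntz_embedding_eq: "muntz_embedding \<Lambda> = trunc_op UNIV"
  unfolding muntz_embedding_def trunc_op_def trunc_series_def by auto

lemma trunc_op_summable:
  assumes "f \<in> muntz_space \<Lambda>" "x \<in> {0..<1}"
  shows "summable (\<lambda>n. (if n \<in> K then muntz_coeffs \<Lambda> f n else 0) * complex_of_real (x powr \<Lambda> n))"
proof -
  define A where "A = embed_const * enn2real (L2_sq leb01 f)"
  have "cmod (if n \<in> K then muntz_coeffs \<Lambda> f n else 0) \<le> sqrt A * (1 / sqrt (\<Lambda> 0)) * \<Lambda> n" for n
    using coeff_growth[OF muntz_coeffs_bound[OF assms(1)], folded A_def, of n]
    by (auto intro: order_trans[OF norm_ge_zero])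
  from summable_of_coeff_bound(2)[OF _ _ this] show ?thesis using assms(2) by auto
qed

lemma trunc_op_norm_le:
  assumes \<mu>: "finite_measure_on_01 \<mu>" and "0 \<le> d" and D: "\<And>n. n \<in> K \<Longrightarrow> D2 \<Lambda> \<mu> n \<le> ennreal d"
    and f: "f \<in> muntz_space \<Lambda>"
  shows "L2_norm \<mu> (trunc_op K f) \<le> ennreal (d * sqrt embed_const) * L2_norm leb01 f"
proof -
  have "L2_sq \<mu> (trunc_op K f) \<le> ennreal (d\<^sup>2 * (embed_const * enn2real (L2_sq leb01 f)))"
    unfolding trunc_op_def by (rule trunc_series_L2_le[OF \<mu> \<open>0 \<le> d\<close> D muntz_coeffs_bound[OF f]])
  also have "\<dots> = ennreal ((d * sqrt embed_const)\<^sup>2) * L2_sq leb01 f"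
    using muntz_space_finite[OF f] embed_const_pos
    by (simp add: power_mult_distrib mult.assoc[symmetric] ennreal_mult)
  finally show ?thesis using \<open>0 \<le> d\<close> embed_const_pos by (subst L2_norm_le_iff) auto
qed

lemma trunc_op_lin:
  assumes "f \<in> muntz_space \<Lambda>" "g \<in> muntz_space \<Lambda>" "x \<in> {0..<1}"
  shows "trunc_op K (\<lambda>y. c * f y + g y) x = c * trunc_op K f x + trunc_op K g x"
proof -
  have "muntz_coeffs \<Lambda> (\<lambda>y. c * f y + g y) = (\<lambda>n. c * muntz_coeffs \<Lambda> f n + muntz_coeffs \<Lambda> g n)"
    by (rule muntz_coeffs_eq, rule represents_lin) (rule muntz_coeffs_represents, fact)+
  moreover have "(if n \<in> K then c * muntz_coeffs \<Lambda> f n + muntz_coeffs \<Lambda> g n else 0) * z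
      = c * ((if n \<in> K then muntz_coeffs \<Lambda> f n else 0) * z) + (if n \<in> K then muntz_coeffs \<Lambda> g n else 0) * z" for n z
    by (simp add: algebra_simps)
  ultimately show ?thesis
    unfolding trunc_op_def trunc_series_def
    using trunc_op_summable[OF assms(1,3)] trunc_op_summable[OF assms(2,3)]
    by (simp only: suminf_add[symmetric] suminf_mult summable_mult)
qed

lemma trunc_op_compl:
  assumes "f \<in> muntz_space \<Lambda>" "x \<in> {0..<1}"
  shows "muntz_embedding \<Lambda> f x - trunc_op K f x = trunc_op (- K) f x"
  unfolding muntz_embedding_eq trunc_op_def trunc_series_def
  by (subst suminf_diff[OF trunc_op_summable[OF assms] trunc_op_summable[OF assms]])
     (auto intro!: suminf_cong)

context
  fixes \<mu> :: "real measure"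
  assumes \<mu>: "finite_measure_on_01 \<mu>"
begin

lemma trunc_op_bounded:
  assumes d: "0 \<le> d" "\<And>n. n \<in> K \<Longrightarrow> D2 \<Lambda> \<mu> n \<le> ennreal d"
  shows "bounded_op leb01 (muntz_space \<Lambda>) \<mu> (trunc_op K)"
    and "op_norm leb01 (muntz_space \<Lambda>) \<mu> (trunc_op K) \<le> ennreal (d * sqrt embed_const)"
proof -
  have le: "L2_norm \<mu> (trunc_op K f) \<le> ennreal (d * sqrt embed_const) * L2_norm leb01 f"
    if "f \<in> muntz_space \<Lambda>" for f by (rule trunc_op_norm_le[OF \<mu> d that])
  show norm: "op_norm leb01 (muntz_space \<Lambda>) \<mu> (trunc_op K) \<le> ennreal (d * sqrt embed_const)"
    unfolding op_norm_def
  proof (rule SUP_least)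
    fix f assume "f \<in> {f \<in> muntz_space \<Lambda>. L2_norm leb01 f \<le> 1}"
    then have "L2_norm \<mu> (trunc_op K f) \<le> ennreal (d * sqrt embed_const) * 1"
      by (intro order_trans[OF le] mult_left_mono) auto
    then show "L2_norm \<mu> (trunc_op K f) \<le> ennreal (d * sqrt embed_const)" by simp
  qed
  show "bounded_op leb01 (muntz_space \<Lambda>) \<mu> (trunc_op K)"
    unfolding bounded_op_def
  proof (intro conjI ballI allI)
    fix f assume f: "f \<in> muntz_space \<Lambda>"
    have "trunc_op K f \<in> borel_measurable \<mu>"
      unfolding trunc_op_def by (intro borel_measurable_01[OF \<mu>]) measurable
    moreover have "L2_norm leb01 f < top" using f unfolding muntz_space_def L2_space_def by auto
    then have "L2_norm \<mu> (trunc_op K f) < top"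
      by (intro le_less_trans[OF le[OF f]]) (simp add: ennreal_mult_less_top)
    ultimately show "trunc_op K f \<in> L2_space \<mu>" unfolding L2_space_def by auto
    fix g c assume "g \<in> muntz_space \<Lambda>"
    then show "AE x in \<mu>. trunc_op K (\<lambda>y. c * f y + g y) x = c * trunc_op K f x + trunc_op K g x"
      using trunc_op_lin[OF f] space_01[OF \<mu>] by (intro AE_I2) auto
  next
    show "op_norm leb01 (muntz_space \<Lambda>) \<mu> (trunc_op K) < top"
      by (rule le_less_trans[OF norm]) simp
  qed
qed

lemma trunc_op_rank:
  assumes K: "finite K"
  shows "op_rank (muntz_space \<Lambda>) \<mu> (trunc_op K) \<le> enat (card K)"
proof -
  define e where "e k x = complex_of_real (x powr \<Lambda> k)" for k x
  \<comment> \<open>The span in \<open>op_rank\<close> is indexed by a set of functions, so distinct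
    exponents must give distinct functions; they already differ at the point 2.\<close>
  have inj: "inj_on e K"
  proof (rule inj_onI)
    fix i j assume "e i = e j"
    then have "e i 2 = e j 2" by simp
    then have "\<Lambda> i = \<Lambda> j" by (simp add: e_def powr_inj)
    then show "i = j" using exps.inj by (simp add: inj_eq)
  qed
  have "e k \<in> L2_space \<mu>" for k
  proof -
    have "e k \<in> borel_measurable \<mu>"
      unfolding e_def by (intro borel_measurable_01[OF \<mu>]) measurable
    moreover have "L2_sq \<mu> (e k) \<le> (\<integral>\<^sup>+ x. 1 \<partial>\<mu>)"
    proof (rule nn_integral_mono)
      fix x assume "x \<in> space \<mu>"
      then have "0 \<le> x" "x < 1" using space_01[OF \<mu>] by auto
      then have "x powr \<Lambda> k \<le> 1" using pos[of k] by (intro powr_le1) auto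
      then show "ennreal ((cmod (e k x))\<^sup>2) \<le> 1"
        by (simp add: e_def power_le_one)
    qed
    moreover have "(\<integral>\<^sup>+ x. 1 \<partial>\<mu>) < top"
      using \<mu> unfolding finite_measure_on_01_def
      by (simp add: finite_measure.emeasure_finite less_top[symmetric])
    ultimately show ?thesis unfolding L2_space_iff using le_less_trans by blast
  qed
  moreover have "\<exists>c. AE x in \<mu>. trunc_op K f x = (\<Sum>b\<in>e ` K. c b * b x)" for f
  proof (intro exI AE_I2)
    fix x
    have "trunc_op K f x = (\<Sum>n\<in>K. muntz_coeffs \<Lambda> f n * e n x)"
      unfolding trunc_op_def trunc_series_def e_def
      by (subst suminf_finite[OF K]) auto
    also have "\<dots> = (\<Sum>b\<in>e ` K. muntz_coeffs \<Lambda> f (the_inv_into K e b) * b x)"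
      by (simp add: sum.reindex[OF inj] the_inv_into_f_f[OF inj])
    finally show "trunc_op K f x = (\<Sum>b\<in>e ` K. muntz_coeffs \<Lambda> f (the_inv_into K e b) * b x)" .
  qed
  ultimately have "op_rank (muntz_space \<Lambda>) \<mu> (trunc_op K) \<le> enat (card (e ` K))"
    unfolding op_rank_def using K by (intro INF_lower) auto
  then show ?thesis by (simp add: card_image[OF inj])
qed

text \<open>The competitor is \<open>trunc_op K\<close>, of rank at most \<open>card K\<close> and
  so strictly below \<open>Suc (card K)\<close>; the error is the truncation to the complement. The
  bound \<open>b\<close> makes the competitor a bounded operator and does not enter the
  estimate.\<close>

lemma approx_number_embedding_le:
  assumes K: "finite K" and d: "0 \<le> d" "\<And>n. n \<notin> K \<Longrightarrow> D2 \<Lambda> \<mu> n \<le> ennreal d"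
    and b: "0 \<le> b" "\<And>n. D2 \<Lambda> \<mu> n \<le> ennreal b"
  shows "approx_number leb01 (muntz_space \<Lambda>) \<mu> (muntz_embedding \<Lambda>) (Suc (card K))
    \<le> ennreal (d * sqrt embed_const)"
proof -
  have "op_norm leb01 (muntz_space \<Lambda>) \<mu> (\<lambda>f x. muntz_embedding \<Lambda> f x - trunc_op K f x)
      = op_norm leb01 (muntz_space \<Lambda>) \<mu> (trunc_op (- K))"
    unfolding op_norm_def L2_norm_def
    by (intro SUP_cong arg_cong[where f = "\<lambda>x. epowr x (1/2)"] nn_integral_cong)
       (auto simp: trunc_op_compl space_01[OF \<mu>])
  also have "\<dots> \<le> ennreal (d * sqrt embed_const)"
    by (rule trunc_op_bounded(2)) (use d in auto)
  finally have "op_norm leb01 (muntz_space \<Lambda>) \<mu> (\<lambda>f x. muntz_embedding \<Lambda> f x - trunc_op K f x)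
      \<le> ennreal (d * sqrt embed_const)" .
  moreover have "op_rank (muntz_space \<Lambda>) \<mu> (trunc_op K) < enat (Suc (card K))"
    by (rule le_less_trans[OF trunc_op_rank[OF K]]) simp
  ultimately show ?thesis
    unfolding approx_number_def
    using trunc_op_bounded(1)[OF b, of K] by (intro INF_lower2[of "trunc_op K"]) auto
qed

lemma schatten_norm_le:
  assumes q: "0 < q" and fin: "lq_norm q (D2 \<Lambda> \<mu>) < top"
  shows "bounded_op leb01 (muntz_space \<Lambda>) \<mu> (muntz_embedding \<Lambda>)"
    and "schatten_norm q leb01 (muntz_space \<Lambda>) \<mu> (muntz_embedding \<Lambda>)
      \<le> ennreal (sqrt embed_const) * lq_norm q (D2 \<Lambda> \<mu>)"
proof -
  define h where "h n = enn2real (epowr (D2 \<Lambda> \<mu> n) q)" for n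
  have sumfin: "(\<Sum>n. epowr (D2 \<Lambda> \<mu> n) q) < top" using fin by (simp add: lq_norm_def)
  have "epowr (D2 \<Lambda> \<mu> n) q < top" for n
    using sum_le_suminf[OF summableI, of "{n}" "\<lambda>n. epowr (D2 \<Lambda> \<mu> n) q"] sumfin
    by (force dest: le_less_trans simp del: epowr_less_top_iff)
  then have h: "epowr (D2 \<Lambda> \<mu> n) q = ennreal (h n)" and h0: "0 \<le> h n" and Dfin: "D2 \<Lambda> \<mu> n < top" for n
    unfolding h_def by auto
  have "summable h"
    using sumfin h0 unfolding h by (intro summable_suminf_not_top) auto
  then have "h \<longlonglongrightarrow> 0" by (rule summable_LIMSEQ_zero)
  from decreasing_injection[OF this h0]
  obtain \<sigma> :: "nat \<Rightarrow> nat" where \<sigma>: "inj \<sigma>" "\<forall>n k. k \<notin> \<sigma> ` {..<n} \<longrightarrow> h k \<le> h (\<sigma> n)"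
    by blast
  have dec: "D2 \<Lambda> \<mu> k \<le> D2 \<Lambda> \<mu> (\<sigma> n)" if "k \<notin> \<sigma> ` {..<n}" for k n
    using \<sigma>(2)[rule_format, OF that] h q epowr_le_iff[of q] by (metis ennreal_leI)
  define b where "b = enn2real (D2 \<Lambda> \<mu> (\<sigma> 0))"
  have b: "0 \<le> b" "D2 \<Lambda> \<mu> n \<le> ennreal b" for n
    using dec[of n 0] Dfin[of "\<sigma> 0"] by (auto simp: b_def)
  show "bounded_op leb01 (muntz_space \<Lambda>) \<mu> (muntz_embedding \<Lambda>)"
    unfolding muntz_embedding_eq by (rule trunc_op_bounded(1)[OF b])
  show "schatten_norm q leb01 (muntz_space \<Lambda>) \<mu> (muntz_embedding \<Lambda>)
      \<le> ennreal (sqrt embed_const) * lq_norm q (D2 \<Lambda> \<mu>)"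
    unfolding schatten_norm_def
  proof (rule lq_norm_injection_le[OF q _ \<sigma>(1)])
    fix n
    define d where "d = enn2real (D2 \<Lambda> \<mu> (\<sigma> n))"
    have d: "D2 \<Lambda> \<mu> (\<sigma> n) = ennreal d" "0 \<le> d" using Dfin by (auto simp: d_def)
    \<comment> \<open>Removing the \<open>n\<close> indices chosen before \<open>\<sigma> n\<close>
      leaves only entries at most \<open>D2 \<Lambda> \<mu> (\<sigma> n)\<close>.\<close>
    have "card (\<sigma> ` {..<n}) = n" using \<sigma>(1) by (simp add: card_image inj_on_subset)
    then have "approx_number leb01 (muntz_space \<Lambda>) \<mu> (muntz_embedding \<Lambda>) (Suc n) \<le> ennreal (d * sqrt embed_const)"
      using approx_number_embedding_le[of "\<sigma> ` {..<n}" d b] d dec[of _ n] b by simp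
    then show "approx_number leb01 (muntz_space \<Lambda>) \<mu> (muntz_embedding \<Lambda>) (Suc n)
        \<le> ennreal (sqrt embed_const) * D2 \<Lambda> \<mu> (\<sigma> n)"
      using d embed_const_pos by (simp add: ennreal_mult mult.commute)
  qed (use embed_const_pos in auto)
qed

end

end

section \<open>Approximation numbers and Bessel families\<close>

lemma abel_antimono_le:
  fixes g e :: "nat \<Rightarrow> real"
  assumes "\<And>i j. i \<le> j \<Longrightarrow> j \<le> n \<Longrightarrow> g j \<le> g i" and "\<And>m. m \<le> n \<Longrightarrow> (\<Sum>i<m. e i) \<le> 0"
  shows "(\<Sum>i<n. g i * e i) \<le> g n * (\<Sum>i<n. e i)"
  using assms
proof (induction n)
  case (Suc n)
  have "(\<Sum>i<Suc n. g i * e i) \<le> g n * (\<Sum>i<n. e i) + g n * e n"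
    using Suc.IH Suc.prems by (simp add: le_Suc_eq)
  also have "\<dots> = g n * (\<Sum>i<Suc n. e i)" by (simp add: distrib_left)
  \<comment> \<open>Abel summation one step at a time: lowering the common weight raises the bound
    because the partial sum is nonpositive.\<close>
  also have "\<dots> \<le> g (Suc n) * (\<Sum>i<Suc n. e i)"
    using Suc.prems(1)[of n "Suc n"] Suc.prems(2)[of "Suc n"] by (intro mult_right_mono_neg) auto
  finally show ?case .
qed simp

text \<open>The convex power lies above its tangent at \<open>b\<close>. Dividing by
  \<open>b powr p\<close> reduces this to the Bernoulli inequality for \<open>s = c / b\<close>, an
  instance of Young's inequality with weights 1/p and 1 - 1/p.\<close>

lemma powr_tangent_le:
  fixes b c p :: real
  assumes "1 \<le> p" "0 \<le> b" "0 \<le> c"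
  shows "b powr p - c powr p \<le> p * b powr (p - 1) * (b - c)"
proof (cases "b = 0 \<or> c = 0")
  case True
  then show ?thesis
  proof
    assume "c = 0"
    then have "p * b powr (p - 1) * (b - c) = p * b powr p"
      using assms by (cases "b = 0") (auto simp: powr_diff)
    moreover have "1 * b powr p \<le> p * b powr p" using assms by (intro mult_right_mono) auto
    ultimately show ?thesis using \<open>c = 0\<close> by (simp only:) simp
  qed simp
next
  case False
  then have b: "b > 0" and c: "c > 0" using assms by auto
  define s where "s = c / b"
  have s: "s > 0" using b c by (simp add: s_def)
  have "(s powr p) powr (1 / p) * 1 powr (1 - 1 / p) \<le> 1 / p * s powr p + (1 - 1 / p) * 1"
    using assms s by (intro Youngs_inequality_0) auto
  then have "s \<le> 1 / p * s powr p + (1 - 1 / p)" using assms s by (simp add: powr_powr)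
  then have "p * s \<le> p * (1 / p * s powr p + (1 - 1 / p))" using assms by (intro mult_left_mono) auto
  also have "\<dots> = s powr p + (p - 1)" using assms by (simp add: field_simps)
  finally have "1 - s powr p \<le> p * (1 - s)" by (simp add: algebra_simps)
  then have "b powr p * (1 - s powr p) \<le> b powr p * (p * (1 - s))" by (intro mult_left_mono) auto
  moreover have "b powr p * s powr p = c powr p" using b c by (simp add: s_def powr_mult[symmetric])
  moreover have "b powr p * (p * (1 - s)) = p * b powr (p - 1) * (b - c)"
  proof -
    have 1: "b powr p = b powr (p - 1) * b" using b by (simp add: powr_diff)
    have 2: "b - c = b * (1 - s)" using b by (simp add: s_def field_simps)
    show ?thesis unfolding 1 2 by (simp only: mult_ac)
  qed
  ultimately show ?thesis by (simp add: right_diff_distrib)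
qed

text \<open>Taking the tangents at the decreasing rearrangement \<open>b\<close> of \<open>d\<close>
  makes their slopes decreasing, so Abel summation applies to the differences
  \<open>b i - c i\<close>, whose partial sums are nonpositive. Hence \<open>c\<close> may be in any
  order.\<close>

lemma sum_powr_le_of_majorized:
  fixes d c :: "nat \<Rightarrow> real"
  assumes F: "finite F" and d: "\<And>i. 0 \<le> d i" and c: "\<And>k. 0 \<le> c k" and p: "1 \<le> p"
    and maj: "\<And>G. G \<subseteq> F \<Longrightarrow> (\<Sum>i\<in>G. d i) \<le> (\<Sum>k<card G. c k)"
  shows "(\<Sum>i\<in>F. d i powr p) \<le> (\<Sum>k<card F. c k powr p)"
proof -
  define xs where "xs = sort_key (\<lambda>i. - d i) (sorted_list_of_set F)"
  define n where "n = card F"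
  have xs: "distinct xs" "set xs = F" "length xs = n"
    using F by (simp_all add: xs_def n_def)
  have sorted: "sorted (map (\<lambda>i. - d i) xs)" unfolding xs_def by (rule sorted_sort_key)
  \<comment> \<open>Sorting by \<open>- d i\<close> lists the values decreasingly; the default 0
    keeps \<open>b\<close> decreasing at the index \<open>n\<close>, which Abel summation also
    evaluates.\<close>
  define b where "b i = (if i < n then d (xs ! i) else 0)" for i
  have b0: "0 \<le> b i" for i using d by (simp add: b_def)
  have anti: "b j \<le> b i" if "i \<le> j" for i j
    using sorted_nth_mono[OF sorted that] xs that d by (auto simp: b_def)
  have nth: "inj_on ((!) xs) {..<m}" if "m \<le> n" for m
    using xs that by (auto simp: inj_on_def nth_eq_iff_index_eq)
  have part: "(\<Sum>i<m. b i - c i) \<le> 0" if m: "m \<le> n" for m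
  proof -
    have "(\<Sum>i<m. b i) = (\<Sum>i\<in>(!) xs ` {..<m}. d i)"
      using m by (subst sum.reindex[OF nth[OF m]]) (auto simp: b_def)
    also have "\<dots> \<le> (\<Sum>k<card ((!) xs ` {..<m}). c k)"
      using m xs by (intro maj) (auto intro: nth_mem)
    finally show ?thesis using card_image[OF nth[OF m]] by (simp add: sum_subtractf)
  qed
  have "(\<Sum>i\<in>F. d i powr p) = (\<Sum>i<n. b i powr p)"
  proof -
    have "(!) xs ` {..<n} = F" using xs by (auto simp: set_conv_nth)
    then show ?thesis using sum.reindex[OF nth[OF order_refl], of "\<lambda>i. d i powr p"] by (auto simp: b_def)
  qed
  moreover have "(\<Sum>i<n. b i powr p) - (\<Sum>i<n. c i powr p) \<le> (\<Sum>i<n. (p * b i powr (p - 1)) * (b i - c i))"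
    unfolding sum_subtractf[symmetric] by (intro sum_mono powr_tangent_le p b0 c)
  moreover have "\<dots> \<le> (p * b n powr (p - 1)) * (\<Sum>i<n. b i - c i)"
    using p b0 by (intro abel_antimono_le part mult_left_mono powr_mono2 anti) auto
  moreover have "\<dots> \<le> 0"
    using p part[of n] by (intro mult_nonneg_nonpos) auto
  ultimately show ?thesis unfolding n_def by linarith
qed

section \<open>Underdetermined linear systems and Householder reflections\<close>

lemma homogeneous_system_solution:
  fixes \<beta> :: "'i \<Rightarrow> 'b \<Rightarrow> complex"
  assumes "finite B" "finite I" "card B < card I"
  shows "\<exists>c. (\<exists>i\<in>I. c i \<noteq> 0) \<and> (\<forall>b\<in>B. (\<Sum>i\<in>I. c i * \<beta> i b) = 0)"
  using assms
proof (induction B arbitrary: I \<beta> rule: finite_induct)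
  case empty
  then obtain i where "i \<in> I" by (cases "I = {}") auto
  then show ?case by (intro exI[of _ "\<lambda>_. 1"]) auto
next
  case (insert b B)
  show ?case
  proof (cases "\<forall>i\<in>I. \<beta> i b = 0")
    case True
    obtain c where "\<exists>i\<in>I. c i \<noteq> 0" "\<forall>b\<in>B. (\<Sum>i\<in>I. c i * \<beta> i b) = 0"
      using insert.IH[of I \<beta>] insert.prems insert.hyps by auto
    then show ?thesis using True by (intro exI[of _ c]) auto
  next
    case False
    then obtain p where p: "p \<in> I" "\<beta> p b \<noteq> 0" by auto
    \<comment> \<open>Gaussian elimination: equation \<open>b\<close> with pivot \<open>p\<close>
      removes the unknown \<open>c p\<close> from the other equations, and \<open>t\<close> restores
      it by back substitution.\<close>
    define \<gamma> where "\<gamma> i b' = \<beta> i b' - \<beta> i b / \<beta> p b * \<beta> p b'" for i b'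
    have "card B < card (I - {p})" using insert.prems insert.hyps p by simp
    then obtain c where c: "\<exists>i\<in>I-{p}. c i \<noteq> 0" "\<forall>b'\<in>B. (\<Sum>i\<in>I-{p}. c i * \<gamma> i b') = 0"
      using insert.IH[of "I - {p}" \<gamma>] insert.prems by blast
    define t where "t = - (\<Sum>i\<in>I-{p}. c i * \<beta> i b / \<beta> p b)"
    define c' where "c' = c(p := t)"
    have split: "(\<Sum>i\<in>I. c' i * \<beta> i b') = (\<Sum>i\<in>I-{p}. c i * \<beta> i b') + t * \<beta> p b'" for b'
      using insert.prems p by (subst sum.remove[of I p]) (auto simp: c'_def add.commute intro!: sum.cong)
    have "(\<Sum>i\<in>I. c' i * \<beta> i b) = 0"
      unfolding split t_def using p by (simp add: sum_divide_distrib[symmetric])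
    moreover have "(\<Sum>i\<in>I. c' i * \<beta> i b') = 0" if "b' \<in> B" for b'
    proof -
      have "t * \<beta> p b' = - (\<Sum>i\<in>I-{p}. c i * (\<beta> i b / \<beta> p b * \<beta> p b'))"
        unfolding t_def minus_mult_left[symmetric] sum_distrib_right by (simp add: mult.assoc)
      then have "(\<Sum>i\<in>I-{p}. c i * \<beta> i b') + t * \<beta> p b' = (\<Sum>i\<in>I-{p}. c i * \<gamma> i b')"
        unfolding \<gamma>_def right_diff_distrib sum_subtractf by simp
      then show ?thesis unfolding split using c(2) that by simp
    qed
    moreover have "\<exists>i\<in>I. c' i \<noteq> 0" using c(1) by (auto simp: c'_def)
    ultimately show ?thesis by (intro exI[of _ c']) auto
  qed
qed

text \<open>The map is the Householder reflection along \<open>w\<close>; the normalisation of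
  \<open>\<tau>\<close> makes the cross terms cancel the quadratic one.\<close>

lemma reflection_isometry:
  fixes w y :: "nat \<Rightarrow> complex" and \<tau> :: real
  assumes \<tau>: "\<tau> * (\<Sum>i<m. (cmod (w i))\<^sup>2) = 2"
  shows "(\<Sum>i<m. (cmod (y i - of_real \<tau> * w i * (\<Sum>j<m. cnj (w j) * y j)))\<^sup>2) = (\<Sum>i<m. (cmod (y i))\<^sup>2)"
proof -
  define s where "s = (\<Sum>j<m. cnj (w j) * y j)"
  have "complex_of_real (\<Sum>i<m. (cmod (y i - of_real \<tau> * w i * s))\<^sup>2)
      = (\<Sum>i<m. (y i - of_real \<tau> * w i * s) * cnj (y i - of_real \<tau> * w i * s))"
    by (simp add: complex_norm_square del: of_real_power)
  also have "\<dots> = (\<Sum>i<m. y i * cnj (y i)) - of_real \<tau> * cnj s * (\<Sum>i<m. cnj (w i) * y i)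
      - of_real \<tau> * s * (\<Sum>i<m. w i * cnj (y i)) + of_real \<tau> * of_real \<tau> * s * cnj s * (\<Sum>i<m. w i * cnj (w i))"
    unfolding sum_distrib_left sum_subtractf[symmetric] sum.distrib[symmetric]
    by (intro sum.cong refl) (simp add: algebra_simps)
  also have "(\<Sum>i<m. w i * cnj (y i)) = cnj s" unfolding s_def by simp
  also have "(\<Sum>i<m. cnj (w i) * y i) = s" unfolding s_def by simp
  also have "of_real \<tau> * of_real \<tau> * s * cnj s * (\<Sum>i<m. w i * cnj (w i)) = of_real \<tau> * s * cnj s * 2"
  proof -
    have "of_real \<tau> * (\<Sum>i<m. w i * cnj (w i)) = complex_of_real (\<tau> * (\<Sum>i<m. (cmod (w i))\<^sup>2))"
      by (simp add: complex_norm_square del: of_real_power)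
    then have "of_real \<tau> * (\<Sum>i<m. w i * cnj (w i)) = 2" unfolding \<tau> by simp
    moreover have "of_real \<tau> * of_real \<tau> * s * cnj s * (\<Sum>i<m. w i * cnj (w i))
        = of_real \<tau> * s * cnj s * (of_real \<tau> * (\<Sum>i<m. w i * cnj (w i)))"
      by (simp only: mult_ac)
    ultimately show ?thesis by (simp only:)
  qed
  also have "(\<Sum>i<m. y i * cnj (y i)) = complex_of_real (\<Sum>i<m. (cmod (y i))\<^sup>2)"
    by (simp add: complex_norm_square del: of_real_power)
  finally have "complex_of_real (\<Sum>i<m. (cmod (y i - of_real \<tau> * w i * s))\<^sup>2) = complex_of_real (\<Sum>i<m. (cmod (y i))\<^sup>2)"
    by (simp add: algebra_simps)
  then show ?thesis unfolding s_def of_real_eq_iff .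
qed

text \<open>
  The sign normalisation of the last coordinate keeps \<open>1 - v m\<close> away from \<open>0\<close>, so that the
  Householder reflection exchanging \<open>v\<close> and the last unit vector is always defined.
\<close>

lemma unitary_with_last_column:
  fixes v :: "nat \<Rightarrow> complex"
  assumes v: "(\<Sum>i<Suc m. (cmod (v i))\<^sup>2) = 1" and last: "v m = - of_real (cmod (v m))"
  obtains U :: "nat \<Rightarrow> nat \<Rightarrow> complex" where
    "\<And>j. j < Suc m \<Longrightarrow> U j m = v j"
    "\<And>y. (\<Sum>i<Suc m. (cmod (\<Sum>j<Suc m. U j i * y j))\<^sup>2) = (\<Sum>i<Suc m. (cmod (y i))\<^sup>2)"
    "\<And>y. (\<Sum>j<Suc m. (cmod (\<Sum>i<Suc m. U j i * y i))\<^sup>2) = (\<Sum>i<Suc m. (cmod (y i))\<^sup>2)"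
proof -
  define \<delta> where "\<delta> j i = (if j = i then 1 else 0 :: complex)" for j i :: nat
  define w where "w j = \<delta> j m - v j" for j
  \<comment> \<open>The vector \<open>w\<close> joins \<open>v\<close> to the last unit vector, and
    its squared norm is 2 - 2 Re \<open>(v m)\<close>, which equals 2(1 + |v m|) by the sign of
    \<open>v m\<close>.\<close>
  define \<tau> where "\<tau> = 1 / (1 + cmod (v m))"
  define U where "U j i = \<delta> j i - of_real \<tau> * w j * cnj (w i)" for j i
  have wm: "w m = of_real (1 + cmod (v m))"
    unfolding w_def \<delta>_def by (subst last) simp
  have nz: "1 + cmod (v m) \<noteq> 0" using norm_ge_zero[of "v m"] by linarith
  have sq: "(\<Sum>i<Suc m. (cmod (w i))\<^sup>2) = 2 * (1 + cmod (v m))"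
  proof -
    have "(\<Sum>i<m. (cmod (w i))\<^sup>2) = (\<Sum>i<m. (cmod (v i))\<^sup>2)"
      by (rule sum.cong) (auto simp: w_def \<delta>_def)
    moreover have "cmod (w m) = 1 + cmod (v m)"
      unfolding wm norm_of_real by simp
    ultimately show ?thesis using v by (simp add: power2_eq_square algebra_simps)
  qed
  have \<tau>: "\<tau> * (\<Sum>i<Suc m. (cmod (w i))\<^sup>2) = 2" unfolding sq \<tau>_def using nz by (simp add: divide_simps)
  \<comment> \<open>The transpose of the reflection along \<open>w\<close> is the reflection along
    its conjugate, which makes both sums over \<open>U\<close> isometric.\<close>
  have \<tau>': "\<tau> * (\<Sum>i<Suc m. (cmod (cnj (w i)))\<^sup>2) = 2" using \<tau> by simp
  have d1: "(\<Sum>j<Suc m. \<delta> j i * y j) = y i" if "i < Suc m" for i and y :: "nat \<Rightarrow> complex"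
  proof -
    have "(\<Sum>j<Suc m. \<delta> j i * y j) = (\<Sum>j<Suc m. if j = i then y j else 0)"
      by (rule sum.cong) (auto simp: \<delta>_def)
    then show ?thesis using that by (simp only: sum.delta' sum.delta) auto
  qed
  have d2: "(\<Sum>i<Suc m. \<delta> j i * y i) = y j" if "j < Suc m" for j and y :: "nat \<Rightarrow> complex"
    using d1[OF that, of y] by (simp add: \<delta>_def eq_commute)
  show ?thesis
  proof (rule that[of U])
    fix j assume "j < Suc m"
    have "U j m = \<delta> j m - w j * (of_real \<tau> * of_real (1 + cmod (v m)))"
      unfolding U_def wm complex_cnj_complex_of_real by (simp only: mult_ac)
    also have "complex_of_real \<tau> * of_real (1 + cmod (v m)) = 1"
      unfolding of_real_mult[symmetric] \<tau>_def using nz by simp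
    finally show "U j m = v j" by (simp add: w_def)
  next
    fix y :: "nat \<Rightarrow> complex"
    have "(\<Sum>i<Suc m. (cmod (\<Sum>j<Suc m. U j i * y j))\<^sup>2)
      = (\<Sum>i<Suc m. (cmod (y i - of_real \<tau> * cnj (w i) * (\<Sum>j<Suc m. cnj (cnj (w j)) * y j)))\<^sup>2)"
    proof (rule sum.cong)
      fix i assume "i \<in> {..<Suc m}"
      then have "(\<Sum>j<Suc m. U j i * y j) = y i - of_real \<tau> * cnj (w i) * (\<Sum>j<Suc m. cnj (cnj (w j)) * y j)"
        unfolding U_def left_diff_distrib sum_subtractf
        by (subst d1) (auto simp: sum_distrib_left mult_ac simp del: sum.lessThan_Suc)
      then show "(cmod (\<Sum>j<Suc m. U j i * y j))\<^sup>2 = (cmod (y i - of_real \<tau> * cnj (w i) * (\<Sum>j<Suc m. cnj (cnj (w j)) * y j)))\<^sup>2"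
        by (simp only:)
    qed simp
    then show "(\<Sum>i<Suc m. (cmod (\<Sum>j<Suc m. U j i * y j))\<^sup>2) = (\<Sum>i<Suc m. (cmod (y i))\<^sup>2)"
      unfolding reflection_isometry[OF \<tau>'] .
  next
    fix y :: "nat \<Rightarrow> complex"
    have "(\<Sum>j<Suc m. (cmod (\<Sum>i<Suc m. U j i * y i))\<^sup>2)
      = (\<Sum>j<Suc m. (cmod (y j - of_real \<tau> * w j * (\<Sum>i<Suc m. cnj (w i) * y i)))\<^sup>2)"
    proof (rule sum.cong)
      fix j assume "j \<in> {..<Suc m}"
      then have "(\<Sum>i<Suc m. U j i * y i) = y j - of_real \<tau> * w j * (\<Sum>i<Suc m. cnj (w i) * y i)"
        unfolding U_def left_diff_distrib sum_subtractf
        by (subst d2) (auto simp: sum_distrib_left mult_ac simp del: sum.lessThan_Suc)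
      then show "(cmod (\<Sum>i<Suc m. U j i * y i))\<^sup>2 = (cmod (y j - of_real \<tau> * w j * (\<Sum>i<Suc m. cnj (w i) * y i)))\<^sup>2"
        by (simp only:)
    qed simp
    then show "(\<Sum>j<Suc m. (cmod (\<Sum>i<Suc m. U j i * y i))\<^sup>2) = (\<Sum>i<Suc m. (cmod (y i))\<^sup>2)"
      unfolding reflection_isometry[OF \<tau>] .
  qed
qed

section \<open>Approximation numbers tested on Bessel families\<close>

lemma combination_member:
  fixes G :: "nat \<Rightarrow> 'a \<Rightarrow> complex"
  assumes X: "\<And>c. (\<lambda>t. \<Sum>i<m. c i * G i t) \<in> X" and "k < m"
  shows "G k \<in> X"
proof -
  have "(\<Sum>i<m. (if i = k then 1 else 0) * G i t) = G k t" for t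
  proof -
    have "(\<Sum>i<m. (if i = k then 1 else 0) * G i t) = (\<Sum>i<m. if i = k then G i t else 0)"
      by (rule sum.cong) auto
    then show ?thesis using \<open>k < m\<close> by simp
  qed
  then show ?thesis using X[of "\<lambda>i. if i = k then 1 else 0"] by simp
qed

lemma ae_linear_sum:
  fixes m :: nat and T :: "('a \<Rightarrow> complex) \<Rightarrow> 'b \<Rightarrow> complex"
  assumes lin: "\<And>f g a. f \<in> X \<Longrightarrow> g \<in> X \<Longrightarrow> AE x in N. T (\<lambda>y. a * f y + g y) x = a * T f x + T g x"
    and X: "\<And>c. (\<lambda>t. \<Sum>i<m. c i * G i t) \<in> X"
  shows "AE x in N. T (\<lambda>t. \<Sum>i<m. c i * G i t) x = (\<Sum>i<m. c i * T (G i) x)"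
proof -
  have Xk: "(\<lambda>t. \<Sum>i<k. c i * G i t) \<in> X" if "k \<le> m" for k
  proof -
    have "(\<lambda>t. \<Sum>i<k. c i * G i t) = (\<lambda>t. \<Sum>i<m. (if i < k then c i else 0) * G i t)"
      by (rule ext, rule sum.mono_neutral_cong_left, use that in auto)
    then show ?thesis using X by simp
  qed
  have XG: "G k \<in> X" if "k < m" for k
    using X that by (rule combination_member)
  have "AE x in N. T (\<lambda>t. \<Sum>i<k. c i * G i t) x = (\<Sum>i<k. c i * T (G i) x)" if "k \<le> m" for k
    using that
  proof (induction k)
    case 0
    \<comment> \<open>The relation - 0 + 0 = 0 with coefficient -1 shows that \<open>T\<close> maps
      the zero function to zero almost everywhere.\<close>
    then show ?case using lin[OF Xk[of 0] Xk[of 0], of "-1"] by simp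
  next
    case (Suc k)
    have "AE x in N. T (\<lambda>y. c k * G k y + (\<Sum>i<k. c i * G i y)) x = c k * T (G k) x + T (\<lambda>y. \<Sum>i<k. c i * G i y) x"
      using Suc.prems by (intro lin XG Xk) auto
    moreover have "AE x in N. T (\<lambda>t. \<Sum>i<k. c i * G i t) x = (\<Sum>i<k. c i * T (G i) x)"
      using Suc by auto
    ultimately show ?case by eventually_elim (simp add: add.commute)
  qed
  then show ?thesis by blast
qed

text \<open>
  An operator of rank less than \<open>m\<close> annihilates some unit combination of \<open>m\<close> vectors.
\<close>

lemma approx_number_unit_combination:
  assumes lin: "\<And>f g a. f \<in> X \<Longrightarrow> g \<in> X \<Longrightarrow> AE x in N. S (\<lambda>y. a * f y + g y) x = a * S f x + S g x"
    and meas: "\<And>f. f \<in> X \<Longrightarrow> S f \<in> borel_measurable N" and a: "approx_number M X N S m < ennreal \<alpha>" and C: "0 < C"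
    and X: "\<And>c. (\<lambda>t. \<Sum>i<m. c i * G i t) \<in> X"
    and bessel: "\<And>c. L2_sq M (\<lambda>t. \<Sum>i<m. c i * G i t) \<le> ennreal (C * (\<Sum>i<m. (cmod (c i))\<^sup>2))"
  shows "\<exists>c. (\<Sum>i<m. (cmod (c i))\<^sup>2) = 1 \<and> L2_sq N (\<lambda>x. \<Sum>i<m. c i * S (G i) x) \<le> ennreal (C * \<alpha>\<^sup>2)"
proof -
  obtain R where R: "bounded_op M X N R" "op_rank X N R < enat m"
    and SR: "op_norm M X N (\<lambda>f x. S f x - R f x) < ennreal \<alpha>"
    using a unfolding approx_number_def INF_less_iff by auto
  obtain B where B: "finite B" "card B < m" "\<forall>f\<in>X. \<exists>c. AE x in N. R f x = (\<Sum>b\<in>B. c b * b x)"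
    using R(2) unfolding op_rank_def INF_less_iff by auto
  have linR: "\<And>f g a. f \<in> X \<Longrightarrow> g \<in> X \<Longrightarrow> AE x in N. R (\<lambda>y. a * f y + g y) x = a * R f x + R g x"
    using R(1) unfolding bounded_op_def by blast
  have \<alpha>: "0 \<le> \<alpha>" using a by (metis ennreal_neg less_le_not_le linorder_linear not_less_zero)
  have XG: "G k \<in> X" if "k < m" for k
    using X that by (rule combination_member)
  have "\<forall>i\<in>{..<m}. \<exists>c. AE x in N. R (G i) x = (\<Sum>b\<in>B. c b * b x)"
    using B(3) XG by simp
  from bchoice[OF this] obtain \<beta> where \<beta>: "\<forall>i\<in>{..<m}. AE x in N. R (G i) x = (\<Sum>b\<in>B. \<beta> i b * b x)"
    by (rule exE)
  \<comment> \<open>The images under \<open>R\<close> of \<open>m\<close> vectors have coordinates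
    in a spanning set of fewer than \<open>m\<close> elements, so a nontrivial combination is
    annihilated.\<close>
  obtain c0 where c0: "\<exists>i<m. c0 i \<noteq> 0" "\<forall>b\<in>B. (\<Sum>i<m. c0 i * \<beta> i b) = 0"
    using homogeneous_system_solution[of B "{..<m}" \<beta>] B by auto
  define n where "n = sqrt (\<Sum>i<m. (cmod (c0 i))\<^sup>2)"
  have n: "n > 0"
  proof -
    obtain i where "i < m" "c0 i \<noteq> 0" using c0 by auto
    then have "0 < (\<Sum>i<m. (cmod (c0 i))\<^sup>2)"
      by (intro sum_pos2[of _ i]) auto
    then show ?thesis by (simp add: n_def)
  qed
  define c where "c i = c0 i / of_real n" for i
  have unit: "(\<Sum>i<m. (cmod (c i))\<^sup>2) = 1"
  proof -
    have "(\<Sum>i<m. (cmod (c i))\<^sup>2) = (\<Sum>i<m. (cmod (c0 i))\<^sup>2) / n\<^sup>2"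
      unfolding c_def sum_divide_distrib by (simp add: norm_divide power_divide)
    also have "n\<^sup>2 = (\<Sum>i<m. (cmod (c0 i))\<^sup>2)" unfolding n_def by (simp add: sum_nonneg)
    finally show ?thesis using n unfolding n_def by auto
  qed
  \<comment> \<open>Dividing by the square root of the Bessel constant puts the combination in the
    unit ball; the factor returns at the end as \<open>C\<close>.\<close>
  define e where "e i = c i / of_real (sqrt C)" for i
  have e0: "(\<Sum>i<m. e i * \<beta> i b) = 0" if "b \<in> B" for b
  proof -
    have "(\<Sum>i<m. e i * \<beta> i b) = (\<Sum>i<m. c0 i * \<beta> i b) / (of_real n * of_real (sqrt C))"
      unfolding e_def c_def sum_divide_distrib by simp
    then show ?thesis using c0 that by simp
  qed
  define g where "g t = (\<Sum>i<m. e i * G i t)" for t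
  have gX: "g \<in> X" unfolding g_def by (rule X)
  have "(\<Sum>i<m. (cmod (e i))\<^sup>2) = 1 / C"
    using C unit unfolding e_def by (simp add: norm_divide power_divide sum_divide_distrib[symmetric])
  then have "L2_sq M g \<le> ennreal (1\<^sup>2)" using bessel[of e] C unfolding g_def by simp
  then have "L2_norm M g \<le> 1" using L2_norm_le_iff_real[of 1 M g] by simp
  then have "L2_norm N (\<lambda>x. S g x - R g x) \<le> ennreal \<alpha>"
    using gX unfolding op_norm_def by (intro order_trans[OF _ less_imp_le[OF SR]]) (auto simp: op_norm_def intro!: SUP_upper2[of g])
  then have "L2_sq N (\<lambda>x. S g x - R g x) \<le> ennreal (\<alpha>\<^sup>2)" using \<alpha> by (simp add: L2_norm_le_iff_real)
  moreover have "AE x in N. R g x = 0"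
  proof -
    have "AE x in N. \<forall>i\<in>{..<m}. R (G i) x = (\<Sum>b\<in>B. \<beta> i b * b x)"
      by (rule AE_finite_allI) (use \<beta> in auto)
    moreover have "AE x in N. R g x = (\<Sum>i<m. e i * R (G i) x)"
      unfolding g_def by (rule ae_linear_sum[where T=R, OF linR X])
    ultimately show ?thesis
    proof eventually_elim
      case (elim x)
      then have "R g x = (\<Sum>i<m. \<Sum>b\<in>B. e i * \<beta> i b * b x)" by (simp add: sum_distrib_left mult.assoc)
      also have "\<dots> = (\<Sum>b\<in>B. (\<Sum>i<m. e i * \<beta> i b) * b x)" by (subst sum.swap) (simp add: sum_distrib_right)
      finally show ?case using e0 by simp
    qed
  qed
  moreover have "AE x in N. S g x = (\<Sum>i<m. e i * S (G i) x)"
    unfolding g_def by (rule ae_linear_sum[where T=S, OF lin X])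
  ultimately have le: "L2_sq N (\<lambda>x. \<Sum>i<m. e i * S (G i) x) \<le> ennreal (\<alpha>\<^sup>2)"
  proof -
    assume h: "L2_sq N (\<lambda>x. S g x - R g x) \<le> ennreal (\<alpha>\<^sup>2)" "AE x in N. R g x = 0" "AE x in N. S g x = (\<Sum>i<m. e i * S (G i) x)"
    have "L2_sq N (\<lambda>x. \<Sum>i<m. e i * S (G i) x) = L2_sq N (\<lambda>x. S g x - R g x)"
      by (rule nn_integral_cong_AE) (use h(2,3) in eventually_elim, simp)
    then show ?thesis using h(1) by simp
  qed
  have "L2_sq N (\<lambda>x. \<Sum>i<m. c i * S (G i) x) = L2_sq N (\<lambda>x. of_real (sqrt C) * (\<Sum>i<m. e i * S (G i) x))"
    using C unfolding e_def by (simp add: sum_distrib_left)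
  also have "\<dots> = ennreal ((cmod (of_real (sqrt C)))\<^sup>2) * L2_sq N (\<lambda>x. \<Sum>i<m. e i * S (G i) x)"
  proof (rule L2_sq_cmult)
    have "S (G i) \<in> borel_measurable N" if "i < m" for i
      using meas XG[OF that] by auto
    then show "(\<lambda>x. \<Sum>i<m. e i * S (G i) x) \<in> borel_measurable N"
      by (intro borel_measurable_sum borel_measurable_times) auto
  qed
  also have "\<dots> \<le> ennreal C * ennreal (\<alpha>\<^sup>2)"
    using C by (intro mult_mono le) auto
  finally have "L2_sq N (\<lambda>x. \<Sum>i<m. c i * S (G i) x) \<le> ennreal (C * \<alpha>\<^sup>2)" using C by (simp add: ennreal_mult)
  with unit show ?thesis by blast
qed

text \<open>
  A substitute for the singular value decomposition: rotating the family so that its last member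
  is nearly annihilated by the approximants of rank less than \<open>m\<close> preserves the sum on the left,
  by unitarity.
\<close>

lemma sum_L2_sq_le_of_approx_numbers_less:
  assumes lin: "\<And>f g a. f \<in> X \<Longrightarrow> g \<in> X \<Longrightarrow> AE x in N. S (\<lambda>y. a * f y + g y) x = a * S f x + S g x"
    and meas: "\<And>f. f \<in> X \<Longrightarrow> S f \<in> borel_measurable N" and a: "\<And>k. k < m \<Longrightarrow> approx_number M X N S (Suc k) < ennreal (\<alpha> k)" and C: "0 < C"
    and X: "\<And>c. (\<lambda>t. \<Sum>i<m. c i * G i t) \<in> X"
    and bessel: "\<And>c. L2_sq M (\<lambda>t. \<Sum>i<m. c i * G i t) \<le> ennreal (C * (\<Sum>i<m. (cmod (c i))\<^sup>2))"
  shows "(\<Sum>i<m. L2_sq N (S (G i))) \<le> ennreal (C * (\<Sum>k<m. (\<alpha> k)\<^sup>2))"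
  using a X bessel
proof (induction m arbitrary: G)
  case 0
  then show ?case by simp
next
  case (Suc m)
  have am: "approx_number M X N S (Suc m) < ennreal (\<alpha> m)" by (rule Suc.prems(1)) simp
  have "\<exists>c. (\<Sum>i<Suc m. (cmod (c i))\<^sup>2) = 1 \<and>
      L2_sq N (\<lambda>x. \<Sum>i<Suc m. c i * S (G i) x) \<le> ennreal (C * (\<alpha> m)\<^sup>2)"
    by (rule approx_number_unit_combination[where S=S and G=G, OF lin meas am C Suc.prems(2,3)])
  then obtain c where c: "(\<Sum>i<Suc m. (cmod (c i))\<^sup>2) = 1"
    "L2_sq N (\<lambda>x. \<Sum>i<Suc m. c i * S (G i) x) \<le> ennreal (C * (\<alpha> m)\<^sup>2)"
    by blast
  \<comment> \<open>A unimodular factor making the last coordinate real and nonpositive, as the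
    reflection requires; it leaves the norm of the combination unchanged.\<close>
  define \<zeta> where "\<zeta> = (if c m = 0 then 1 else - cnj (c m) / of_real (cmod (c m)))"
  have \<zeta>: "cmod \<zeta> = 1" by (simp add: \<zeta>_def norm_divide)
  define v where "v i = \<zeta> * c i" for i
  have v1: "(\<Sum>i<Suc m. (cmod (v i))\<^sup>2) = 1" using c(1) \<zeta> by (simp add: v_def norm_mult)
  have "v m = - of_real (cmod (c m))"
    by (simp add: v_def \<zeta>_def complex_norm_square[symmetric] mult.commute power2_eq_square)
  then have v2: "v m = - of_real (cmod (v m))" by simp
  obtain U where U: "\<And>j. j < Suc m \<Longrightarrow> U j m = v j"
    "\<And>y. (\<Sum>i<Suc m. (cmod (\<Sum>j<Suc m. U j i * y j))\<^sup>2) = (\<Sum>i<Suc m. (cmod (y i))\<^sup>2)"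
    "\<And>y. (\<Sum>j<Suc m. (cmod (\<Sum>i<Suc m. U j i * y i))\<^sup>2) = (\<Sum>i<Suc m. (cmod (y i))\<^sup>2)"
    using unitary_with_last_column[OF v1 v2] by blast
  define H where "H i t = (\<Sum>j<Suc m. U j i * G j t)" for i t
  have HX: "H i \<in> X" for i unfolding H_def by (rule Suc.prems(2))
  have XG: "G k \<in> X" if "k < Suc m" for k
    using Suc.prems(2) that by (rule combination_member)
  have comb: "(\<lambda>t. \<Sum>i<m. c i * H i t) = (\<lambda>t. \<Sum>j<Suc m. (\<Sum>i<m. U j i * c i) * G j t)" for c
    unfolding H_def sum_distrib_left sum_distrib_right by (subst sum.swap) (simp only: mult_ac)
  have IH: "(\<Sum>i<m. L2_sq N (S (H i))) \<le> ennreal (C * (\<Sum>k<m. (\<alpha> k)\<^sup>2))"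
  proof (rule Suc.IH)
    fix k assume "k < m" then show "approx_number M X N S (Suc k) < ennreal (\<alpha> k)" by (intro Suc.prems(1)) simp
  next
    fix c :: "nat \<Rightarrow> complex"
    show "(\<lambda>t. \<Sum>i<m. c i * H i t) \<in> X" unfolding comb by (rule Suc.prems(2))
    \<comment> \<open>Isometry of \<open>U\<close> on vectors padded by 0: the first
      \<open>m\<close> rotated members keep the Bessel constant \<open>C\<close>, as the induction
      hypothesis demands.\<close>
    have "(\<Sum>j<Suc m. (cmod (\<Sum>i<m. U j i * c i))\<^sup>2) = (\<Sum>i<m. (cmod (c i))\<^sup>2)"
      using U(3)[of "\<lambda>i. if i < m then c i else 0"] by simp
    then show "L2_sq M (\<lambda>t. \<Sum>i<m. c i * H i t) \<le> ennreal (C * (\<Sum>i<m. (cmod (c i))\<^sup>2))"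
      using Suc.prems(3)[of "\<lambda>j. \<Sum>i<m. U j i * c i"] fun_cong[OF comb[of c]] by (simp only:)
  qed
  have SH: "AE x in N. \<forall>i\<in>{..<m}. S (H i) x = (\<Sum>j<Suc m. U j i * S (G j) x)"
    unfolding H_def by (rule AE_finite_allI[OF finite_lessThan]) (rule ae_linear_sum[where T=S, OF lin Suc.prems(2)])
  have [measurable]: "(\<lambda>x. \<Sum>i<Suc m. c i * S (G i) x) \<in> borel_measurable N" for c
    by (intro borel_measurable_sum borel_measurable_times meas XG) auto
  have "(\<Sum>i<Suc m. L2_sq N (S (G i))) = (\<integral>\<^sup>+ x. (\<Sum>i<Suc m. ennreal ((cmod (S (G i) x))\<^sup>2)) \<partial>N)"
    by (rule nn_integral_sum[symmetric]) (auto intro!: measurable_compose[OF meas[OF XG]])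
  also have "\<dots> = (\<integral>\<^sup>+ x. (\<Sum>i<m. ennreal ((cmod (S (H i) x))\<^sup>2)) + ennreal ((cmod (\<Sum>i<Suc m. c i * S (G i) x))\<^sup>2) \<partial>N)"
  proof (rule nn_integral_cong_AE, use SH in eventually_elim)
    fix x assume x: "\<forall>i\<in>{..<m}. S (H i) x = (\<Sum>j<Suc m. U j i * S (G j) x)"
    have "(\<Sum>j<Suc m. U j m * S (G j) x) = \<zeta> * (\<Sum>i<Suc m. c i * S (G i) x)"
      unfolding sum_distrib_left by (rule sum.cong) (auto simp: U(1) v_def mult.assoc)
    then have "cmod (\<Sum>j<Suc m. U j m * S (G j) x) = cmod (\<Sum>i<Suc m. c i * S (G i) x)"
      using \<zeta> by (simp only: norm_mult mult_1)
    then have "(\<Sum>i<Suc m. (cmod (S (G i) x))\<^sup>2) = (\<Sum>i<m. (cmod (S (H i) x))\<^sup>2) + (cmod (\<Sum>i<Suc m. c i * S (G i) x))\<^sup>2"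
      unfolding U(2)[of "\<lambda>j. S (G j) x", symmetric] sum.lessThan_Suc[of _ m] using x by simp
    then have "ennreal (\<Sum>i<Suc m. (cmod (S (G i) x))\<^sup>2) = ennreal (\<Sum>i<m. (cmod (S (H i) x))\<^sup>2) + ennreal ((cmod (\<Sum>i<Suc m. c i * S (G i) x))\<^sup>2)"
      by (simp only: ennreal_plus sum_nonneg zero_le_power2)
    then show "(\<Sum>i<Suc m. ennreal ((cmod (S (G i) x))\<^sup>2)) = (\<Sum>i<m. ennreal ((cmod (S (H i) x))\<^sup>2)) + ennreal ((cmod (\<Sum>i<Suc m. c i * S (G i) x))\<^sup>2)"
      by (simp only: sum_ennreal zero_le_power2)
  qed
  also have "\<dots> = (\<Sum>i<m. L2_sq N (S (H i))) + L2_sq N (\<lambda>x. \<Sum>i<Suc m. c i * S (G i) x)"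
  proof -
    have [measurable]: "S (H i) \<in> borel_measurable N" for i by (rule meas[OF HX])
    show ?thesis by (simp add: nn_integral_add nn_integral_sum del: sum.lessThan_Suc sum_ennreal)
  qed
  also have "\<dots> \<le> ennreal (C * (\<Sum>k<m. (\<alpha> k)\<^sup>2)) + ennreal (C * (\<alpha> m)\<^sup>2)"
    by (intro add_mono IH c(2))
  also have "\<dots> = ennreal (C * (\<Sum>k<Suc m. (\<alpha> k)\<^sup>2))"
    using C by (simp add: ennreal_plus[symmetric] sum_nonneg distrib_left del: ennreal_plus)
  finally show ?case .
qed

text \<open>The infimum in an approximation number need not be attained, so the strict version is
  applied with a margin that then tends to 0.\<close>

lemma sum_L2_sq_le_approx_numbers:
  assumes lin: "\<And>f g a. f \<in> X \<Longrightarrow> g \<in> X \<Longrightarrow> AE x in N. S (\<lambda>y. a * f y + g y) x = a * S f x + S g x"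
    and meas: "\<And>f. f \<in> X \<Longrightarrow> S f \<in> borel_measurable N"
    and a: "\<And>k. approx_number M X N S (Suc k) = ennreal (a k)" "\<And>k. 0 \<le> a k" and C: "0 < C"
    and X: "\<And>c. (\<lambda>t. \<Sum>i<m. c i * G i t) \<in> X"
    and bessel: "\<And>c. L2_sq M (\<lambda>t. \<Sum>i<m. c i * G i t) \<le> ennreal (C * (\<Sum>i<m. (cmod (c i))\<^sup>2))"
  shows "(\<Sum>i<m. L2_sq N (S (G i))) \<le> ennreal (C * (\<Sum>k<m. (a k)\<^sup>2))"
proof (rule LIMSEQ_le_const)
  let ?\<epsilon> = "\<lambda>n. inverse (real (Suc n))"
  have "(\<lambda>n. C * (\<Sum>k<m. (a k + ?\<epsilon> n)\<^sup>2)) \<longlonglongrightarrow> C * (\<Sum>k<m. (a k + 0)\<^sup>2)"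
    by (intro tendsto_intros LIMSEQ_inverse_real_of_nat)
  then show "(\<lambda>n. ennreal (C * (\<Sum>k<m. (a k + ?\<epsilon> n)\<^sup>2))) \<longlonglongrightarrow> ennreal (C * (\<Sum>k<m. (a k)\<^sup>2))"
    by (intro tendsto_ennrealI) simp
  have "(\<Sum>i<m. L2_sq N (S (G i))) \<le> ennreal (C * (\<Sum>k<m. (a k + ?\<epsilon> n)\<^sup>2))" for n
    by (rule sum_L2_sq_le_of_approx_numbers_less[where S=S, OF lin meas _ C X bessel])
       (use a in \<open>auto intro: ennreal_lessI\<close>)
  then show "\<exists>N'. \<forall>n\<ge>N'. (\<Sum>i<m. L2_sq N (S (G i))) \<le> ennreal (C * (\<Sum>k<m. (a k + ?\<epsilon> n)\<^sup>2))"
    by blast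
qed

section \<open>Quasi-geometric exponents\<close>

context muntz_exponents
begin

section \<open>Pointwise domination of the normalised monomials\<close>

definition bump :: "nat \<Rightarrow> real \<Rightarrow> real" where
  "bump n t = sqrt (\<Lambda> n) * t powr \<Lambda> n"

lemma bump_nonneg: "0 \<le> bump n t"
  using pos[of n] by (simp add: bump_def)

text \<open>
  At a given \<open>t\<close> all the functions \<open>bump k\<close> are dominated by the one whose exponent is
  comparable with \<open>1 / - ln t\<close>; this is where the upper bound on the ratios is used.
\<close>

lemma bump_peak:
  assumes R: "1 \<le> R" "\<And>n. \<Lambda> (Suc n) \<le> R * \<Lambda> n" and t: "0 < t" "t < 1"
  obtains m where "\<And>k. bump k t \<le> R * exp 1 * \<theta> ^ ((k - m) + (m - k)) * bump m t"
proof -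
  define \<tau> where "\<tau> = - ln t"
  have \<tau>: "\<tau> > 0" using t by (simp add: \<tau>_def)
  define y where "y k = \<Lambda> k * \<tau>" for k
  have y: "y k > 0" for k using pos \<tau> by (simp add: y_def)
  have bump: "bump k t = sqrt (\<Lambda> k) * exp (- y k)" for k
    using t unfolding bump_def powr_def y_def \<tau>_def by simp
  have "\<exists>n. 1 < y n"
  proof -
    have "0 < \<Lambda> 0 * \<tau>" using pos \<tau> by simp
    then obtain n where n: "(\<theta>\<^sup>2) ^ n < \<Lambda> 0 * \<tau>"
      using real_arch_pow_inv[of "\<Lambda> 0 * \<tau>" "\<theta>\<^sup>2"] rate by (auto simp: power_less_one_iff)
    have "\<Lambda> 0 * \<tau> \<le> (\<theta>\<^sup>2) ^ n * y n"
      using mult_right_mono[OF exps.decay[OF le0, of n, unfolded power_mult diff_zero], of \<tau>] \<tau> by (simp add: y_def)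
    then have "(\<theta>\<^sup>2) ^ n * 1 < (\<theta>\<^sup>2) ^ n * y n" using n by simp
    then have "1 < y n" using rate by (subst (asm) mult_less_cancel_left_pos) auto
    then show ?thesis ..
  qed
  define n where "n = (LEAST n. 1 < y n)"
  have n: "1 < y n" unfolding n_def using \<open>\<exists>n. 1 < y n\<close> by (rule LeastI_ex)
  \<comment> \<open>The last index with \<open>y\<close> at most 1, except that truncation gives
    \<open>m = 0\<close> when already \<open>y 0 > 1\<close>; then no smaller index needs an
    estimate.\<close>
  define m where "m = n - 1"
  have m: "1 / R \<le> y m" "m = 0 \<or> y m \<le> 1"
  proof -
    show "m = 0 \<or> y m \<le> 1"
      using not_less_Least[of m "\<lambda>n. 1 < y n"] unfolding n_def[symmetric] m_def by (cases n) auto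
    show "1 / R \<le> y m"
    proof (cases n)
      case 0
      then have "1 \<le> y m" using n by (simp add: m_def)
      moreover have "1 / R \<le> 1" using R by simp
      ultimately show ?thesis by linarith
    next
      case (Suc k)
      have "y (Suc k) \<le> R * y k" using mult_right_mono[OF R(2)[of k], of \<tau>] \<tau> by (simp add: y_def)
      then show ?thesis using Suc n R by (simp add: m_def divide_le_eq mult.commute)
    qed
  qed
  have "bump k t \<le> R * exp 1 * \<theta> ^ ((k - m) + (m - k)) * bump m t" for k
  proof (cases "k \<le> m")
    case True
    have "1 \<le> R * exp 1"
      using R mult_mono[of 1 R 1 "exp 1"] by simp
    show ?thesis
    proof (cases "k = m")
      case True
      then show ?thesis using mult_right_mono[OF \<open>1 \<le> R * exp 1\<close> bump_nonneg[of m t]] by simp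
    next
      case False
      then have "y m \<le> 1" using \<open>k \<le> m\<close> m by auto
      then have "exp (- y k) \<le> exp 1 * exp (- y m)" using y[of k] by (simp add: exp_add[symmetric])
      also have "\<dots> \<le> R * exp 1 * exp (- y m)" using R by simp
      finally have "sqrt (\<Lambda> k) * exp (- y k) \<le> (\<theta> ^ (m - k) * sqrt (\<Lambda> m)) * (R * exp 1 * exp (- y m))"
        using exps.sqrt_ratio[OF \<open>k \<le> m\<close>] pos[of k] pos[of m] rate by (intro mult_mono) auto
      then show ?thesis using \<open>k \<le> m\<close> unfolding bump by (simp add: mult_ac)
    qed
  next
    case False
    then have mk: "m \<le> k" by simp
    define z where "z = \<Lambda> k / \<Lambda> m"
    have z: "1 \<le> z" using exps.less[of m k] False pos[of m] by (simp add: z_def)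
    have yk: "y k = y m * z" using pos[of m] by (simp add: y_def z_def)
    \<comment> \<open>Beyond the peak the exponential decays like \<open>exp (- (z / R))\<close>,
      which is at most \<open>R / z\<close>; against the growth of the normalisation by the square
      root of \<open>z\<close> this leaves a decay of order one over that root, which
      \<open>sqrt_ratio\<close> bounds by a power of \<open>\<theta>\<close>.\<close>
    have "(z - 1) / R \<le> y m * (z - 1)" using mult_right_mono[OF m(1), of "z - 1"] z by simp
    then have "exp (y m - y k) \<le> exp (1 / R) * exp (- (z / R))"
      unfolding yk exp_add[symmetric] by (simp add: algebra_simps diff_divide_distrib)
    also have "\<dots> \<le> exp 1 * exp (- (z / R))" using R by simp
    also have "exp (- (z / R)) \<le> R / z"
    proof -
      have "z / R \<le> exp (z / R)" using exp_ge_add_one_self[of "z / R"] by linarith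
      then show ?thesis using z R by (simp add: exp_minus field_simps)
    qed
    finally have "exp (y m - y k) \<le> exp 1 * (R / z)" by simp
    then have "\<Lambda> k * exp (y m - y k) \<le> \<Lambda> k * (exp 1 * (R / z))"
      using pos[of k] by (intro mult_left_mono) auto
    also have "\<dots> = R * exp 1 * (sqrt (\<Lambda> m) * sqrt (\<Lambda> m))" using pos[of k] pos[of m] by (simp add: z_def)
    also have "\<dots> \<le> R * exp 1 * (sqrt (\<Lambda> m) * (\<theta> ^ (k - m) * sqrt (\<Lambda> k)))"
      using exps.sqrt_ratio[OF mk] pos[of m] R by (intro mult_left_mono) auto
    finally have le: "\<Lambda> k * exp (y m - y k) \<le> R * exp 1 * (sqrt (\<Lambda> m) * (\<theta> ^ (k - m) * sqrt (\<Lambda> k)))" .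
    have "sqrt (\<Lambda> k) * (sqrt (\<Lambda> k) * exp (y m - y k)) = \<Lambda> k * exp (y m - y k)"
      using pos[of k] by (simp add: mult.assoc[symmetric])
    also note le
    also have "R * exp 1 * (sqrt (\<Lambda> m) * (\<theta> ^ (k - m) * sqrt (\<Lambda> k)))
        = sqrt (\<Lambda> k) * (R * exp 1 * \<theta> ^ (k - m) * sqrt (\<Lambda> m))"
      by (simp only: mult_ac)
    finally have "sqrt (\<Lambda> k) * (sqrt (\<Lambda> k) * exp (y m - y k)) \<le> sqrt (\<Lambda> k) * (R * exp 1 * \<theta> ^ (k - m) * sqrt (\<Lambda> m))" .
    then have "sqrt (\<Lambda> k) * exp (y m - y k) \<le> R * exp 1 * \<theta> ^ (k - m) * sqrt (\<Lambda> m)"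
      using pos[of k] by (subst (asm) mult_le_cancel_left_pos) auto
    then have "sqrt (\<Lambda> k) * exp (y m - y k) * exp (- y m) \<le> R * exp 1 * \<theta> ^ (k - m) * sqrt (\<Lambda> m) * exp (- y m)"
      by (intro mult_right_mono) auto
    moreover have "sqrt (\<Lambda> k) * exp (y m - y k) * exp (- y m) = sqrt (\<Lambda> k) * exp (- y k)"
      by (simp add: mult.assoc exp_add[symmetric])
    ultimately have "sqrt (\<Lambda> k) * exp (- y k) \<le> R * exp 1 * \<theta> ^ (k - m) * sqrt (\<Lambda> m) * exp (- y m)"
      by (simp only:)
    then show ?thesis using mk unfolding bump by (simp add: mult.assoc)
  qed
  then show ?thesis by (rule that)
qed

text \<open>By \<open>bump_peak\<close> the left side is at most a constant times
  \<open>\<theta>\<close> to the distance of \<open>n\<close> and \<open>m\<close>, times the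
  squared peak. The peak index \<open>m\<close> varies with \<open>t\<close>; replacing the single
  term by the sum over all distances \<open>j\<close> in both directions gives a bound that can be
  integrated. The guard \<open>j \<le> n\<close> prevents truncated subtraction from counting index
  0 repeatedly.\<close>

lemma bump_product_le:
  assumes R: "1 \<le> R" "\<And>n. \<Lambda> (Suc n) \<le> R * \<Lambda> n" and t: "0 \<le> t" "t < 1"
  shows "ennreal (bump n t) * (\<Sum>k. ennreal (bump k t))
    \<le> ennreal ((R * exp 1)\<^sup>2 * (2 / (1 - \<theta>))) *
      (\<Sum>j. ennreal (\<theta> ^ j) * (ennreal ((bump (n + j) t)\<^sup>2) + (if j \<le> n then ennreal ((bump (n - j) t)\<^sup>2) else 0)))"
    (is "_ \<le> ?C * suminf ?g")
proof (cases "t = 0")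
  case True
  then show ?thesis by (simp add: bump_def)
next
  case False
  then have "0 < t" using t by simp
  then obtain m where m: "\<And>k. bump k t \<le> R * exp 1 * \<theta> ^ ((k - m) + (m - k)) * bump m t"
    using bump_peak[OF R _ t(2)] by blast
  define b where "b = bump m t"
  have b: "0 \<le> b" by (simp add: b_def bump_nonneg)
  have RE: "0 \<le> R * exp 1" using R by simp
  have "(\<Sum>k. ennreal (bump k t)) \<le> ennreal (R * exp 1 * b * (2 / (1 - \<theta>)))"
  proof (rule suminf_le_const[OF summableI])
    fix M
    have "(\<Sum>k<M. bump k t) \<le> (\<Sum>k<M. R * exp 1 * b * \<theta> ^ ((m - k) + (k - m)))"
      using m by (intro sum_mono) (simp add: b_def mult_ac add.commute)
    also have "\<dots> \<le> R * exp 1 * b * (2 / (1 - \<theta>))"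
      unfolding sum_distrib_left[symmetric] using RE b
      by (intro mult_left_mono sum_power_dist_le rate) auto
    finally show "(\<Sum>k<M. ennreal (bump k t)) \<le> ennreal (R * exp 1 * b * (2 / (1 - \<theta>)))"
      by (simp add: sum_ennreal bump_nonneg ennreal_leI)
  qed
  then have "ennreal (bump n t) * (\<Sum>k. ennreal (bump k t))
      \<le> ennreal (R * exp 1 * \<theta> ^ ((n - m) + (m - n)) * b) * ennreal (R * exp 1 * b * (2 / (1 - \<theta>)))"
    using m[of n] by (intro mult_mono ennreal_leI) (auto simp: b_def)
  also have "\<dots> = ?C * (ennreal (\<theta> ^ ((n - m) + (m - n))) * ennreal (b\<^sup>2))"
  proof -
    have "ennreal (E * w * b) * ennreal (E * b * K) = ennreal (E\<^sup>2 * K) * (ennreal w * ennreal (b\<^sup>2))"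
      if "0 \<le> E" "0 \<le> K" "0 \<le> w" for E K w
      using that b by (simp add: ennreal_mult[symmetric] power2_eq_square mult_ac)
    from this[of "R * exp 1" "2 / (1 - \<theta>)"] show ?thesis using RE rate by simp
  qed
  also have "ennreal (\<theta> ^ ((n - m) + (m - n))) * ennreal (b\<^sup>2) \<le> ?g ((n - m) + (m - n))"
  proof (cases "m \<le> n")
    case True
    then show ?thesis by (auto simp: b_def intro!: mult_left_mono)
  next
    case False
    then show ?thesis by (auto simp: b_def intro!: mult_left_mono)
  qed
  also have "?g ((n - m) + (m - n)) \<le> suminf ?g"
    using sum_le_suminf[OF summableI, of "{(n - m) + (m - n)}" ?g] by simp
  finally show ?thesis by (simp add: mult_left_mono)
qed

section \<open>Comparison of D2 with the approximation numbers\<close>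

definition diag_integral :: "real measure \<Rightarrow> nat \<Rightarrow> ennreal" where
  "diag_integral \<mu> n = (\<integral>\<^sup>+ t. ennreal ((bump n t)\<^sup>2) \<partial>\<mu>)"

text \<open>Reorders a combination over an arbitrary finite index set into an initial segment of
  exponents. The normalisation by \<open>sqrt (\<Lambda> n)\<close> almost cancels the weight in
  \<open>coeff_norm\<close>, leaving a factor at most 1.\<close>

lemma bump_combination:
  fixes m :: nat
  assumes h: "bij_betw h {..<m} G" and "finite G"
  obtains N a where "(\<lambda>t. \<Sum>i<m. c i * complex_of_real (bump (h i) t)) = muntz_poly N a"
    "coeff_norm N a \<le> (\<Sum>i<m. (cmod (c i))\<^sup>2)"
proof -
  obtain N where N: "G \<subseteq> {..<N}" using \<open>finite G\<close> finite_nat_bounded by auto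
  define h' where "h' = the_inv_into {..<m} h"
  have h': "h' (h i) = i" if "i < m" for i
    unfolding h'_def using h that by (simp add: the_inv_into_f_f bij_betw_def)
  define a where "a n = (if n \<in> G then c (h' n) * complex_of_real (sqrt (\<Lambda> n)) else 0)" for n
  have re: "(\<Sum>n<N. if n \<in> G then F (h' n) n else 0) = (\<Sum>i<m. F i (h i))" for F :: "nat \<Rightarrow> nat \<Rightarrow> 'z :: comm_monoid_add"
  proof -
    have "(\<Sum>n<N. if n \<in> G then F (h' n) n else 0) = (\<Sum>n\<in>G. F (h' n) n)"
      using N by (intro sum.mono_neutral_cong_right) auto
    also have "\<dots> = (\<Sum>i<m. F (h' (h i)) (h i))" by (rule sum.reindex_bij_betw[OF h, symmetric])
    finally show ?thesis using h' by simp
  qed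
  have "(\<Sum>i<m. c i * complex_of_real (bump (h i) t)) = muntz_poly N a t" for t
    unfolding muntz_poly_def a_def re[of "\<lambda>i n. c i * complex_of_real (bump n t)", symmetric]
    by (rule sum.cong) (auto simp: bump_def)
  moreover have "coeff_norm N a \<le> (\<Sum>i<m. (cmod (c i))\<^sup>2)"
  proof -
    have "coeff_norm N a \<le> (\<Sum>n<N. if n \<in> G then (cmod (c (h' n)))\<^sup>2 else 0)"
      unfolding coeff_norm_def
    proof (rule sum_mono)
      fix n
      have "(cmod (c (h' n)))\<^sup>2 * \<Lambda> n / (\<Lambda> n + 1/2) \<le> (cmod (c (h' n)))\<^sup>2"
        using pos[of n] by (simp add: divide_le_eq mult_left_mono add_pos_pos)
      then show "(cmod (a n))\<^sup>2 / (\<Lambda> n + 1/2) \<le> (if n \<in> G then (cmod (c (h' n)))\<^sup>2 else 0)"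
        using pos[of n] by (simp add: a_def norm_mult power_mult_distrib)
    qed
    also have "\<dots> = (\<Sum>i<m. (cmod (c i))\<^sup>2)" by (rule re)
    finally show ?thesis .
  qed
  ultimately show ?thesis using that by blast
qed

context
  fixes \<mu> :: "real measure"
  assumes \<mu>: "finite_measure_on_01 \<mu>"
begin

text \<open>The normalised monomials form a Bessel family with constant 2/(1 -
  \<open>\<theta>\<close>), by the upper Riesz bound, and the embedding fixes them
  pointwise.\<close>

lemma diag_integral_sum_le:
  assumes a: "\<And>k. approx_number leb01 (muntz_space \<Lambda>) \<mu> (muntz_embedding \<Lambda>) (Suc k) = ennreal (a k)"
    "\<And>k. 0 \<le> a k" and G: "finite G"
  shows "(\<Sum>n\<in>G. diag_integral \<mu> n) \<le> ennreal (2 / (1 - \<theta>) * (\<Sum>k<card G. (a k)\<^sup>2))"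
proof -
  obtain h where h: "bij_betw h {..<card G} G"
    using ex_bij_betw_nat_finite[OF G] by (auto simp: atLeast0LessThan)
  define g where "g i t = complex_of_real (bump (h i) t)" for i t
  have comb: "(\<lambda>t. \<Sum>i<card G. c i * g i t) \<in> muntz_space \<Lambda>"
    "L2_sq leb01 (\<lambda>t. \<Sum>i<card G. c i * g i t) \<le> ennreal (2 / (1 - \<theta>) * (\<Sum>i<card G. (cmod (c i))\<^sup>2))" for c
  proof -
    obtain N b where b: "(\<lambda>t. \<Sum>i<card G. c i * g i t) = muntz_poly N b"
      "coeff_norm N b \<le> (\<Sum>i<card G. (cmod (c i))\<^sup>2)"
      unfolding g_def using bump_combination[OF h G, of c] by blast
    show "(\<lambda>t. \<Sum>i<card G. c i * g i t) \<in> muntz_space \<Lambda>" unfolding b(1) by (rule muntz_poly_in_space)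
    have "ennreal (2 / (1 - \<theta>) * coeff_norm N b) \<le> ennreal (2 / (1 - \<theta>) * (\<Sum>i<card G. (cmod (c i))\<^sup>2))"
      using b(2) rate by (intro ennreal_leI mult_left_mono) auto
    then show "L2_sq leb01 (\<lambda>t. \<Sum>i<card G. c i * g i t) \<le> ennreal (2 / (1 - \<theta>) * (\<Sum>i<card G. (cmod (c i))\<^sup>2))"
      using L2_sq_muntz_poly_le[of N b] fun_cong[OF b(1)] by simp
  qed
  have emb: "muntz_embedding \<Lambda> (g i) = g i" for i
  proof -
    have gi: "g i = muntz_poly (Suc (h i)) (\<lambda>n. if n = h i then complex_of_real (sqrt (\<Lambda> n)) else 0)"
      unfolding muntz_poly_def g_def by (auto simp: bump_def)
    show ?thesis unfolding gi by (rule ext) (rule muntz_embedding_poly)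
  qed
  have "(\<Sum>i<card G. L2_sq \<mu> (muntz_embedding \<Lambda> (g i))) \<le> ennreal (2 / (1 - \<theta>) * (\<Sum>k<card G. (a k)\<^sup>2))"
  proof (rule sum_L2_sq_le_approx_numbers[OF _ _ a _ comb])
    fix f1 f2 :: "real \<Rightarrow> complex" and c assume "f1 \<in> muntz_space \<Lambda>" "f2 \<in> muntz_space \<Lambda>"
    then show "AE x in \<mu>. muntz_embedding \<Lambda> (\<lambda>y. c * f1 y + f2 y) x = c * muntz_embedding \<Lambda> f1 x + muntz_embedding \<Lambda> f2 x"
      unfolding muntz_embedding_eq using trunc_op_lin space_01[OF \<mu>] by (intro AE_I2) auto
  next
    fix f show "muntz_embedding \<Lambda> f \<in> borel_measurable \<mu>"
      unfolding muntz_embedding_eq trunc_op_def by (intro borel_measurable_01[OF \<mu>]) measurable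
  qed (use rate in auto)
  also have "(\<Sum>i<card G. L2_sq \<mu> (muntz_embedding \<Lambda> (g i))) = (\<Sum>i<card G. diag_integral \<mu> (h i))"
    unfolding emb g_def diag_integral_def by simp
  also have "\<dots> = (\<Sum>n\<in>G. diag_integral \<mu> n)" by (rule sum.reindex_bij_betw[OF h])
  finally show ?thesis .
qed

text \<open>For each distance \<open>j\<close> the indices \<open>n + j\<close> and
  \<open>n - j\<close> with \<open>n\<close> in \<open>F\<close> form sets no larger than
  \<open>F\<close>, so each contributes at most \<open>A\<close>; this is why the hypothesis ranges
  over all such sets.\<close>

lemma D2_integral_sum_le:
  assumes R: "1 \<le> R" "\<And>n. \<Lambda> (Suc n) \<le> R * \<Lambda> n"
    and A: "0 \<le> A" "\<And>G. finite G \<Longrightarrow> card G \<le> card F \<Longrightarrow> (\<Sum>n\<in>G. diag_integral \<mu> n) \<le> ennreal A" and F: "finite F"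
  shows "(\<Sum>n\<in>F. D2_integral \<Lambda> \<mu> n) \<le> ennreal ((R * exp 1)\<^sup>2 * (2 / (1 - \<theta>))\<^sup>2 * A)"
proof -
  define C where "C = (R * exp 1)\<^sup>2 * (2 / (1 - \<theta>))"
  have C: "0 \<le> C" using rate by (simp add: C_def)
  have [measurable]: "bump n \<in> borel_measurable \<mu>" for n
    unfolding bump_def by (intro borel_measurable_01[OF \<mu>]) measurable
  define e where "e n = diag_integral \<mu> n" for n
  have le: "D2_integral \<Lambda> \<mu> n \<le> ennreal C * (\<Sum>j. ennreal (\<theta> ^ j) * (e (n + j) + (if j \<le> n then e (n - j) else 0)))" for n
  proof -
    have eq: "(\<integral>\<^sup>+ t. ennreal ((bump (n + j) t)\<^sup>2) + (if j \<le> n then ennreal ((bump (n - j) t)\<^sup>2) else 0) \<partial>\<mu>)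
        = e (n + j) + (if j \<le> n then e (n - j) else 0)" for j
      unfolding e_def diag_integral_def by (cases "j \<le> n") (simp_all add: nn_integral_add)
    have "D2_integral \<Lambda> \<mu> n \<le> (\<integral>\<^sup>+ t. ennreal C *
      (\<Sum>j. ennreal (\<theta> ^ j) * (ennreal ((bump (n + j) t)\<^sup>2) + (if j \<le> n then ennreal ((bump (n - j) t)\<^sup>2) else 0))) \<partial>\<mu>)"
      unfolding D2_integral_sqrt bump_def[symmetric] C_def
      using space_01[OF \<mu>] by (intro nn_integral_mono bump_product_le R) auto
    also have "\<dots> = ennreal C * (\<Sum>j. ennreal (\<theta> ^ j) * (\<integral>\<^sup>+ t. ennreal ((bump (n + j) t)\<^sup>2) + (if j \<le> n then ennreal ((bump (n - j) t)\<^sup>2) else 0) \<partial>\<mu>))"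
      by (simp add: nn_integral_cmult nn_integral_suminf)
    finally show ?thesis unfolding eq .
  qed
  have inner: "(\<Sum>n\<in>F. e (n + j) + (if j \<le> n then e (n - j) else 0)) \<le> ennreal (2 * A)" for j
  proof -
    have "(\<Sum>n\<in>F. e (n + j)) = (\<Sum>n\<in>(\<lambda>n. n + j) ` F. e n)"
      by (subst sum.reindex) auto
    also have "\<dots> \<le> ennreal A" unfolding e_def using F by (intro A(2) card_image_le) auto
    finally have 1: "(\<Sum>n\<in>F. e (n + j)) \<le> ennreal A" .
    have "(\<Sum>n\<in>F. if j \<le> n then e (n - j) else 0) = (\<Sum>n\<in>{n\<in>F. j \<le> n}. e (n - j))"
      using F by (simp add: sum.inter_filter)
    also have "\<dots> = (\<Sum>n\<in>(\<lambda>n. n - j) ` {n\<in>F. j \<le> n}. e n)"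
      by (subst sum.reindex) (auto simp: inj_on_def)
    also have "\<dots> \<le> ennreal A"
      unfolding e_def using F by (intro A(2) order_trans[OF card_image_le] card_mono) auto
    finally have 2: "(\<Sum>n\<in>F. if j \<le> n then e (n - j) else 0) \<le> ennreal A" .
    have "ennreal A + ennreal A = ennreal (2 * A)"
      unfolding ennreal_plus[OF A(1) A(1), symmetric] by simp
    then show ?thesis unfolding sum.distrib using add_mono[OF 1 2] by simp
  qed
  have geo: "(\<Sum>j. ennreal (\<theta> ^ j)) = ennreal (1 / (1 - \<theta>))"
    using rate by (subst suminf_ennreal2) (auto simp: suminf_geometric summable_geometric)
  have "(\<Sum>n\<in>F. D2_integral \<Lambda> \<mu> n) \<le> ennreal C * (\<Sum>n\<in>F. \<Sum>j. ennreal (\<theta> ^ j) * (e (n + j) + (if j \<le> n then e (n - j) else 0)))"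
    unfolding sum_distrib_left by (intro sum_mono le)
  also have "(\<Sum>n\<in>F. \<Sum>j. ennreal (\<theta> ^ j) * (e (n + j) + (if j \<le> n then e (n - j) else 0)))
      = (\<Sum>j. ennreal (\<theta> ^ j) * (\<Sum>n\<in>F. e (n + j) + (if j \<le> n then e (n - j) else 0)))"
    by (subst suminf_sum[symmetric]) (auto simp: sum_distrib_left summableI)
  also have "\<dots> \<le> (\<Sum>j. ennreal (\<theta> ^ j) * ennreal (2 * A))"
    by (intro suminf_le summableI mult_left_mono inner) auto
  also have "\<dots> = ennreal (1 / (1 - \<theta>)) * ennreal (2 * A)"
    unfolding geo[symmetric] by simp
  finally have "(\<Sum>n\<in>F. D2_integral \<Lambda> \<mu> n) \<le> ennreal C * (ennreal (1 / (1 - \<theta>)) * ennreal (2 * A))"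
    by (simp add: mult_left_mono)
  also have "\<dots> = ennreal ((R * exp 1)\<^sup>2 * (2 / (1 - \<theta>))\<^sup>2 * A)"
    using C A(1) rate by (simp add: ennreal_mult[symmetric] C_def power2_eq_square mult_ac)
  finally show ?thesis .
qed

text \<open>The set-sum bound is the hypothesis of \<open>sum_powr_le_of_majorized\<close> with
  exponent \<open>q / 2\<close>. The cube in \<open>C\<close> gathers three factors 2/(1 -
  \<open>\<theta>\<close>): from summing all monomials around the peak, from summing over the
  distances, and from the Bessel constant.\<close>

lemma lq_norm_D2_le:
  assumes R: "1 \<le> R" "\<And>n. \<Lambda> (Suc n) \<le> R * \<Lambda> n" and q: "2 \<le> q"
  defines "C \<equiv> (R * exp 1)\<^sup>2 * (2 / (1 - \<theta>)) ^ 3"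
  shows "lq_norm q (D2 \<Lambda> \<mu>)
    \<le> ennreal (sqrt C) * schatten_norm q leb01 (muntz_space \<Lambda>) \<mu> (muntz_embedding \<Lambda>)"
proof -
  have C: "0 < C" unfolding C_def using R rate by (intro mult_pos_pos zero_less_power) auto
  define s where "s k = approx_number leb01 (muntz_space \<Lambda>) \<mu> (muntz_embedding \<Lambda>) (Suc k)" for k
  have schatten: "schatten_norm q leb01 (muntz_space \<Lambda>) \<mu> (muntz_embedding \<Lambda>) = epowr (\<Sum>k. epowr (s k) q) (1 / q)"
    unfolding schatten_norm_def lq_norm_def s_def ..
  show ?thesis
  proof (cases "(\<Sum>k. epowr (s k) q) < top")
    case False
    then have "schatten_norm q leb01 (muntz_space \<Lambda>) \<mu> (muntz_embedding \<Lambda>) = top"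
      unfolding schatten by (simp add: less_top[symmetric])
    then show ?thesis using C by (simp add: ennreal_mult_top)
  next
    case True
    define a where "a k = enn2real (s k)" for k
    have "epowr (s k) q < top" for k
      using sum_le_suminf[OF summableI, of "{k}" "\<lambda>k. epowr (s k) q"] True
      by (force dest: le_less_trans simp del: epowr_less_top_iff)
    then have a: "s k = ennreal (a k)" "0 \<le> a k" for k unfolding a_def by auto
    note a' = a(1)[unfolded s_def] a(2)
    have maj: "(\<Sum>n\<in>F. D2_integral \<Lambda> \<mu> n) \<le> ennreal (\<Sum>k<card F. C * (a k)\<^sup>2)" if F: "finite F" for F
    proof -
      define A where "A = 2 / (1 - \<theta>) * (\<Sum>k<card F. (a k)\<^sup>2)"
      have "(\<Sum>n\<in>G. diag_integral \<mu> n) \<le> ennreal A" if G: "finite G" "card G \<le> card F" for G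
      proof -
        have "(\<Sum>k<card G. (a k)\<^sup>2) \<le> (\<Sum>k<card F. (a k)\<^sup>2)" using G by (intro sum_mono2) auto
        then have "ennreal (2 / (1 - \<theta>) * (\<Sum>k<card G. (a k)\<^sup>2)) \<le> ennreal A"
          unfolding A_def using rate by (intro ennreal_leI mult_left_mono) auto
        then show ?thesis by (rule order_trans[OF diag_integral_sum_le[OF a' G(1)]])
      qed
      moreover have "0 \<le> A" using rate by (simp add: A_def sum_nonneg)
      ultimately have "(\<Sum>n\<in>F. D2_integral \<Lambda> \<mu> n) \<le> ennreal ((R * exp 1)\<^sup>2 * (2 / (1 - \<theta>))\<^sup>2 * A)"
        by (intro D2_integral_sum_le R F)
      also have "(R * exp 1)\<^sup>2 * (2 / (1 - \<theta>))\<^sup>2 * A = (\<Sum>k<card F. C * (a k)\<^sup>2)"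
        unfolding A_def C_def sum_distrib_left[symmetric] by (simp add: power2_eq_square power3_eq_cube mult_ac)
      finally show ?thesis .
    qed
    \<comment> \<open>Finite, as the majorization on singletons shows.\<close>
    define d where "d n = enn2real (D2_integral \<Lambda> \<mu> n)" for n
    have d: "D2_integral \<Lambda> \<mu> n = ennreal (d n)" "0 \<le> d n" for n
      using maj[of "{n}"] unfolding d_def by (auto dest: le_less_trans[OF _ ennreal_less_top])
    have maj': "(\<Sum>n\<in>F. d n) \<le> (\<Sum>k<card F. C * (a k)\<^sup>2)" if "finite F" for F
    proof -
      have "ennreal (\<Sum>n\<in>F. d n) \<le> ennreal (\<Sum>k<card F. C * (a k)\<^sup>2)"
        using maj[OF that] d by (simp add: sum_ennreal)
      then show ?thesis using C by (subst (asm) ennreal_le_iff) (auto intro!: sum_nonneg)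
    qed
    have p: "1 \<le> q / 2" using q by simp
    have pw: "(C * (a k)\<^sup>2) powr (q / 2) = C powr (q / 2) * a k powr q" for k
    proof -
      have "((a k)\<^sup>2) powr (q / 2) = a k powr q"
      proof (cases "a k = 0")
        case False
        then have "(a k)\<^sup>2 = a k powr 2" using a(2)[of k] by simp
        then show ?thesis by (simp add: powr_powr)
      qed simp
      then show ?thesis using C by (simp add: powr_mult)
    qed
    have "(\<Sum>n. epowr (D2 \<Lambda> \<mu> n) q) \<le> ennreal (C powr (q / 2)) * (\<Sum>k. epowr (s k) q)"
    proof (rule suminf_le_const[OF summableI])
      fix M
      have "(\<Sum>n<M. epowr (D2 \<Lambda> \<mu> n) q) = ennreal (\<Sum>n<M. d n powr (q / 2))"
        unfolding epowr_D2 d(1) by (simp add: epowr_ennreal d(2))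
      also have "\<dots> \<le> ennreal (\<Sum>k<M. (C * (a k)\<^sup>2) powr (q / 2))"
        using sum_powr_le_of_majorized[of "{..<M}" d "\<lambda>k. C * (a k)\<^sup>2" "q / 2"] maj' d(2) C p
        by (intro ennreal_leI) (simp add: finite_subset[OF _ finite_lessThan])
      also have "\<dots> = ennreal (C powr (q / 2)) * (\<Sum>k<M. epowr (s k) q)"
        unfolding pw a(1) by (simp add: epowr_ennreal a(2) sum_distrib_left ennreal_mult[symmetric] sum_nonneg)
      also have "\<dots> \<le> ennreal (C powr (q / 2)) * (\<Sum>k. epowr (s k) q)"
        by (intro mult_left_mono sum_le_suminf summableI) auto
      finally show "(\<Sum>n<M. epowr (D2 \<Lambda> \<mu> n) q) \<le> ennreal (C powr (q / 2)) * (\<Sum>k. epowr (s k) q)" .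
    qed
    then have "lq_norm q (D2 \<Lambda> \<mu>) \<le> epowr (ennreal (C powr (q / 2)) * (\<Sum>k. epowr (s k) q)) (1 / q)"
      unfolding lq_norm_def using q by (intro epowr_mono) auto
    also have "\<dots> = ennreal (sqrt C) * schatten_norm q leb01 (muntz_space \<Lambda>) \<mu> (muntz_embedding \<Lambda>)"
      unfolding schatten using q C by (simp add: epowr_mult epowr_ennreal powr_powr powr_half_sqrt)
    finally show ?thesis .
  qed
qed

end

end

text \<open>For \<open>r > 1\<close> the quotient (x + 1/2)/(r x + 1/2) decreases in x, so its value
  at the smallest exponent, \<open>\<rho>\<close>, bounds all ratios of consecutive shifted
  exponents. The locale uses the square of its rate, hence \<open>sqrt \<rho>\<close>.\<close>

lemma lacunary_muntz_exponents:
  assumes "lacunary \<Lambda>"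
  obtains \<theta> where "muntz_exponents \<Lambda> \<theta>"
proof -
  obtain r where pos: "\<And>n. 0 < \<Lambda> n" and r: "1 < r" "\<And>n. r * \<Lambda> n \<le> \<Lambda> (Suc n)"
    using assms unfolding lacunary_def by auto
  have "\<Lambda> n \<le> \<Lambda> (Suc n)" for n
    using r(2)[of n] mult_right_mono[of 1 r "\<Lambda> n"] r(1) pos[of n] by linarith
  then have mono: "\<Lambda> 0 \<le> \<Lambda> n" for n by (rule lift_Suc_mono_le) simp
  define \<rho> where "\<rho> = (\<Lambda> 0 + 1/2) / (r * \<Lambda> 0 + 1/2)"
  have den: "0 < r * \<Lambda> 0 + 1/2" using r pos[of 0] by (intro add_pos_pos) auto
  have \<rho>: "0 < \<rho>" "\<rho> < 1"
    unfolding \<rho>_def using r pos[of 0] den by (auto intro!: divide_pos_pos add_pos_pos simp: divide_less_eq)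
  have "muntz_exponents \<Lambda> (sqrt \<rho>)"
  proof
    fix n
    have "0 \<le> (r - 1) * (\<Lambda> n - \<Lambda> 0)" using r mono[of n] by simp
    then have "(\<Lambda> n + 1/2) * (r * \<Lambda> 0 + 1/2) \<le> (\<Lambda> 0 + 1/2) * (r * \<Lambda> n + 1/2)"
      by (simp add: algebra_simps)
    then have "\<Lambda> n + 1/2 \<le> \<rho> * (r * \<Lambda> n + 1/2)"
      unfolding \<rho>_def using den by (simp add: le_divide_eq)
    also have "\<dots> \<le> \<rho> * (\<Lambda> (Suc n) + 1/2)"
      using r(2)[of n] \<rho> by (intro mult_left_mono) auto
    finally show "\<Lambda> n + 1/2 \<le> (sqrt \<rho>)\<^sup>2 * (\<Lambda> (Suc n) + 1/2)" using \<rho> by simp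
  qed (use pos \<rho> in auto)
  then show ?thesis by (rule that)
qed

theorem theorem5p11:
  fixes \<Lambda> :: "nat \<Rightarrow> real" and q :: real
  assumes "lacunary \<Lambda>" and "q > 0"
  shows
    "(\<exists>c>0. \<forall>\<mu>. finite_measure_on_01 \<mu> \<longrightarrow> lq_norm q (D2 \<Lambda> \<mu>) < top \<longrightarrow>
        bounded_op leb01 (muntz_space \<Lambda>) \<mu> (muntz_embedding \<Lambda>) \<and>
        schatten_norm q leb01 (muntz_space \<Lambda>) \<mu> (muntz_embedding \<Lambda>)
          \<le> ennreal c * lq_norm q (D2 \<Lambda> \<mu>)) \<and>
     (quasi_geometric \<Lambda> \<and> q \<ge> 2 \<longrightarrow>
        (\<exists>c>0. \<exists>c'>0. \<forall>\<mu>. finite_measure_on_01 \<mu> \<longrightarrow>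
           schatten_norm q leb01 (muntz_space \<Lambda>) \<mu> (muntz_embedding \<Lambda>)
             \<le> ennreal c * lq_norm q (D2 \<Lambda> \<mu>) \<and>
           lq_norm q (D2 \<Lambda> \<mu>)
             \<le> ennreal c' * schatten_norm q leb01 (muntz_space \<Lambda>) \<mu> (muntz_embedding \<Lambda>)))"
proof -
  obtain \<theta> where "muntz_exponents \<Lambda> \<theta>" using lacunary_muntz_exponents[OF assms(1)] .
  then interpret muntz_exponents \<Lambda> \<theta> .
  define c where "c = sqrt embed_const"
  have c: "0 < c" using embed_const_pos by (simp add: c_def)
  \<comment> \<open>Both norms live in [0, infinity], so an infinite right side makes the bound
    trivial; the equivalence therefore includes that of finiteness.\<close>
  have upper: "schatten_norm q leb01 (muntz_space \<Lambda>) \<mu> (muntz_embedding \<Lambda>) \<le> ennreal c * lq_norm q (D2 \<Lambda> \<mu>)"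
    if "finite_measure_on_01 \<mu>" for \<mu>
  proof (cases "lq_norm q (D2 \<Lambda> \<mu>) < top")
    case True
    then show ?thesis unfolding c_def by (rule schatten_norm_le(2)[OF that assms(2)])
  next
    case False
    then show ?thesis using c by (simp add: less_top[symmetric] ennreal_mult_top)
  qed
  have "\<exists>c'>0. \<forall>\<mu>. finite_measure_on_01 \<mu> \<longrightarrow> lq_norm q (D2 \<Lambda> \<mu>)
             \<le> ennreal c' * schatten_norm q leb01 (muntz_space \<Lambda>) \<mu> (muntz_embedding \<Lambda>)"
    if qg: "quasi_geometric \<Lambda>" and q: "2 \<le> q"
  proof -
    obtain r R where "1 < r" and R': "\<And>n. r \<le> \<Lambda> (Suc n) / \<Lambda> n" "\<And>n. \<Lambda> (Suc n) / \<Lambda> n \<le> R"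
      using qg unfolding quasi_geometric_def by blast
    have R: "1 \<le> R" "\<Lambda> (Suc n) \<le> R * \<Lambda> n" for n
      using R'(1)[of 0] R'(2)[of 0] \<open>1 < r\<close> R'(2)[of n] pos[of n] by (linarith, simp add: divide_le_eq)
    define C where "C = (R * exp 1)\<^sup>2 * (2 / (1 - \<theta>)) ^ 3"
    have "0 < C" unfolding C_def using R rate by (intro mult_pos_pos zero_less_power) auto
    then show ?thesis
      using lq_norm_D2_le[OF _ R q] unfolding C_def by (intro exI[of _ "sqrt C"]) (auto simp: C_def)
  qed
  then show ?thesis
    using c upper schatten_norm_le(1)[OF _ assms(2)] by blast
qed

end
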